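(* Let $(V,\omega,\Gamma)$ be an indecomposable symplectic triple, $t\in\mathbb{C}$, $c:S\to\mathbb{C}$ a conjugation-invariant function on the set $S$ of symplectic reflections of $\Gamma$, $\mathbf{H}_{t,c}$ the associated symplectic reflection algebra, $e=\frac{1}{|\Gamma|}\sum_{h\in\Gamma}h$, and $\mathbf{U}_{t,c}=e\mathbf{H}_{t,c}e$ the spherical subalgebra. Then $\mathbf{U}_{t,c}$ is $LD$-stable and $LD\,\mathbf{U}_{t,c}=\dim V$.
   Context: $V$ is a complex vector space of dimension $2n$ with a non-degenerate skew-symmetric form $\omega$; $\Gamma\subset Sp(V)$ is a finite group generated by symplectic reflections (elements $g$ with $\operatorname{rank}(1-g)=2$). The triple is indecomposable if $V$ is not a direct sum of two nonzero $\Gamma$-invariant subspaces $V_1,V_2$ with $\omega(V_1,V_2)=0$. For $s\in S$, $\omega_s$ is the skew form with radical $\ker(1-s)$ that agrees with $\omega$ on $\operatorname{im}(1-s)$. $\mathbf{H}_{t,c}$ is the quotient of the skew group ring $T(V)*\Gamma$ by the relations $[x,y]=t\,\omega(x,y)+\sum_{s\in S}c(s)\omega_s(x,y)s$ for $x,y\in V$. $GK$ is Gelfand–Kirillov dimension over $\mathbb{C}$: $GK\,A=\sup_W\limsup_m\log(\dim W^m)/\log m$ over subframes $W$ (finite-dimensional subspaces containing $1$). Lower transcendence degree $LD$: if every subframe $W$ admits a finite-dimensional nonzero $X$ with $\dim WX=\dim X$, then $LD\,A=0$; otherwise $LD\,A=\sup_W\sup\{d>0:\exists c'>0,\ \dim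 WX\ge\dim X+c'(\dim X)^{(d-1)/d}\text{ for all finite-dimensional }X\neq0\}$. $A$ is $LD$-stable if $LD\,A=GK\,A$. *)

theory Defs
  imports "HOL-Analysis.Analysis" "HOL-Library.Liminf_Limsup"
begin

section \<open>The symplectic vector space V = C^'n and the group Gamma\<close>

type_synonym 'n cmat = "complex^'n^'n"

text \<open>The skew form omega(x,y) = x^T Om y, given by its Gram matrix Om.\<close>
definition sform :: "'n::finite cmat \<Rightarrow> complex^'n \<Rightarrow> complex^'n \<Rightarrow> complex" where
  "sform Om x y = (\<Sum>i\<in>UNIV. x$i * (Om *v y)$i)"

inductive_set gen_group :: "'n::finite cmat set \<Rightarrow> 'n cmat set" for S where
  one: "mat 1 \<in> gen_group S"
| gen: "s \<in> S \<Longrightarrow> s \<in> gen_group S"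
| mult: "g \<in> gen_group S \<Longrightarrow> h \<in> gen_group S \<Longrightarrow> g ** h \<in> gen_group S"
| inv: "g \<in> gen_group S \<Longrightarrow> matrix_inv g \<in> gen_group S"

text \<open>Symplectic reflections: elements g with rank(1 - g) = 2.\<close>
definition sympl_refls :: "'n::finite cmat set \<Rightarrow> 'n cmat set" where
  "sympl_refls G = {g \<in> G. rank (mat 1 - g) = 2}"

text \<open>(V, omega, Gamma): omega non-degenerate skew-symmetric, Gamma a finite subgroup of Sp(V)
  generated by symplectic reflections.\<close>
definition symplectic_triple :: "'n::finite cmat \<Rightarrow> 'n cmat set \<Rightarrow> bool" where
  "symplectic_triple Om G \<longleftrightarrow>
     (\<forall>x y. sform Om x y = - sform Om y x) \<and>
     (\<forall>x. (\<forall>y. sform Om x y = 0) \<longrightarrow> x = 0) \<and>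
     finite G \<and> mat 1 \<in> G \<and> (\<forall>g\<in>G. \<forall>h\<in>G. g ** h \<in> G) \<and>
     (\<forall>g\<in>G. invertible g \<and> matrix_inv g \<in> G \<and>
        (\<forall>x y. sform Om (g *v x) (g *v y) = sform Om x y)) \<and>
     G = gen_group (sympl_refls G)"

definition indecomposable :: "'n::finite cmat \<Rightarrow> 'n cmat set \<Rightarrow> bool" where
  "indecomposable Om G \<longleftrightarrow>
     \<not> (\<exists>V1 V2. vec.subspace V1 \<and> vec.subspace V2 \<and> V1 \<noteq> {0} \<and> V2 \<noteq> {0} \<and>
          V1 \<inter> V2 = {0} \<and> {x + y | x y. x \<in> V1 \<and> y \<in> V2} = UNIV \<and>
          (\<forall>g\<in>G. \<forall>x\<in>V1. g *v x \<in> V1) \<and> (\<forall>g\<in>G. \<forall>x\<in>V2. g *v x \<in> V2) \<and>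
          (\<forall>x\<in>V1. \<forall>y\<in>V2. sform Om x y = 0))"

text \<open>omega_s: the skew (bilinear) form with radical ker(1-s) agreeing with omega on im(1-s).\<close>
definition omega_s :: "'n::finite cmat \<Rightarrow> 'n cmat \<Rightarrow> complex^'n \<Rightarrow> complex^'n \<Rightarrow> complex" where
  "omega_s Om s = (THE f.
     (\<forall>x x' y. f (x + x') y = f x y + f x' y) \<and> (\<forall>a x y. f (a *s x) y = a * f x y) \<and>
     (\<forall>x y. f x y = - f y x) \<and>
     {x. \<forall>y. f x y = 0} = {x. (mat 1 - s) *v x = 0} \<and>
     (\<forall>x\<in>range ((*v) (mat 1 - s)). \<forall>y\<in>range ((*v) (mat 1 - s)). f x y = sform Om x y))"

section \<open>The skew group ring T(V) * Gamma\<close>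

text \<open>Elements are finitely supported coefficient functions on pairs (w, g), where the word
  w = [i1,...,ik] stands for x_i1 (x) ... (x) x_ik (x_i the standard basis of V) and g in Gamma.\<close>
type_synonym 'n sk = "('n list \<times> 'n cmat) \<Rightarrow> complex"

definition skel :: "'n::finite cmat set \<Rightarrow> 'n sk \<Rightarrow> bool" where
  "skel G a \<longleftrightarrow> finite {p. a p \<noteq> 0} \<and> (\<forall>p. a p \<noteq> 0 \<longrightarrow> snd p \<in> G)"

definition sk_basis :: "'n list \<Rightarrow> 'n cmat \<Rightarrow> 'n sk" where
  "sk_basis w g = (\<lambda>p. if p = (w, g) then 1 else 0)"

text \<open>(w g)(u h) = w g(u) (g h), where g(x_j) = sum_i g_ij x_i.\<close>
definition sk_mult :: "'n::finite sk \<Rightarrow> 'n sk \<Rightarrow> 'n sk" where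
  "sk_mult a b = (\<lambda>(z, k). \<Sum>p\<in>{p. a p \<noteq> 0}. \<Sum>q\<in>{q. b q \<noteq> 0}.
      if snd p ** snd q = k \<and> length z = length (fst p) + length (fst q)
         \<and> take (length (fst p)) z = fst p
      then a p * b q * (\<Prod>l<length (fst q). snd p $ (drop (length (fst p)) z ! l) $ (fst q ! l))
      else 0)"

definition cspan :: "('a \<Rightarrow> complex) set \<Rightarrow> ('a \<Rightarrow> complex) set" where
  "cspan X = {v. \<exists>F coef. finite F \<and> F \<subseteq> X \<and> v = (\<lambda>p. \<Sum>f\<in>F. coef f * f p)}"

section \<open>The symplectic reflection algebra H_{t,c} = (T(V)*Gamma)/I and U_{t,c} = eHe\<close>

definition sra_rel :: "'n::finite cmat \<Rightarrow> 'n cmat set \<Rightarrow> complex \<Rightarrow> ('n cmat \<Rightarrow> complex)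
                       \<Rightarrow> 'n \<Rightarrow> 'n \<Rightarrow> 'n sk" where
  "sra_rel Om G t c i j = (\<lambda>p. sk_basis [i, j] (mat 1) p - sk_basis [j, i] (mat 1) p
      - t * sform Om (axis i 1) (axis j 1) * sk_basis [] (mat 1) p
      - (\<Sum>s\<in>sympl_refls G. c s * omega_s Om s (axis i 1) (axis j 1) * sk_basis [] s p))"

text \<open>The two-sided ideal generated by the defining relations.\<close>
definition sra_ideal :: "'n::finite cmat \<Rightarrow> 'n cmat set \<Rightarrow> complex \<Rightarrow> ('n cmat \<Rightarrow> complex) \<Rightarrow> 'n sk set" where
  "sra_ideal Om G t c = cspan {sk_mult (sk_mult a (sra_rel Om G t c i j)) b | a b i j. skel G a \<and> skel G b}"

definition sym_idem :: "'n::finite cmat set \<Rightarrow> 'n sk" where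
  "sym_idem G = (\<lambda>p. (1 / of_nat (card G)) * (\<Sum>h\<in>G. sk_basis [] h p))"

text \<open>Representatives (modulo the ideal) of the spherical subalgebra eHe.\<close>
definition spherical :: "'n::finite cmat \<Rightarrow> 'n cmat set \<Rightarrow> complex \<Rightarrow> ('n cmat \<Rightarrow> complex) \<Rightarrow> 'n sk set" where
  "spherical Om G t c = cspan ({sk_mult (sk_mult (sym_idem G) a) (sym_idem G) | a. skel G a}
                               \<union> sra_ideal Om G t c)"

section \<open>Linear algebra in the quotient: subspaces of T(V)*Gamma / I are represented by
  subspaces Y of T(V)*Gamma containing I\<close>

definition indep_mod :: "'n sk set \<Rightarrow> 'n sk set \<Rightarrow> bool" where
  "indep_mod I F \<longleftrightarrow> (\<forall>coef. (\<lambda>p. \<Sum>f\<in>F. coef f * f p) \<in> I \<longrightarrow> (\<forall>f\<in>F. coef f = 0))"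

definition qdim :: "'n sk set \<Rightarrow> 'n sk set \<Rightarrow> nat" where
  "qdim I Y = Sup {card F | F. finite F \<and> F \<subseteq> Y \<and> indep_mod I F}"

definition qfindim :: "'n sk set \<Rightarrow> 'n sk set \<Rightarrow> bool" where
  "qfindim I Y \<longleftrightarrow> (\<exists>F. finite F \<and> F \<subseteq> Y \<and> Y \<subseteq> cspan (F \<union> I))"

definition qsubspace :: "'n sk set \<Rightarrow> 'n sk set \<Rightarrow> 'n sk set \<Rightarrow> bool" where
  "qsubspace I A Y \<longleftrightarrow> I \<subseteq> Y \<and> Y \<subseteq> A \<and> cspan Y = Y"

definition qprod :: "'n::finite sk set \<Rightarrow> 'n sk set \<Rightarrow> 'n sk set \<Rightarrow> 'n sk set" where
  "qprod I Y Z = cspan ({sk_mult y z | y z. y \<in> Y \<and> z \<in> Z} \<union> I)"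

primrec qpow :: "'n::finite sk set \<Rightarrow> 'n sk \<Rightarrow> 'n sk set \<Rightarrow> nat \<Rightarrow> 'n sk set" where
  "qpow I u W 0 = cspan ({u} \<union> I)"
| "qpow I u W (Suc m) = qprod I W (qpow I u W m)"

text \<open>Subframes of the algebra A/I with unit u: finite-dimensional subspaces containing u.\<close>
definition subframes :: "'n::finite sk set \<Rightarrow> 'n sk set \<Rightarrow> 'n sk \<Rightarrow> 'n sk set set" where
  "subframes I A u = {W. qsubspace I A W \<and> qfindim I W \<and> u \<in> W}"

definition GKdim :: "'n::finite sk set \<Rightarrow> 'n sk set \<Rightarrow> 'n sk \<Rightarrow> ereal" where
  "GKdim I A u = (SUP W\<in>subframes I A u.
       limsup (\<lambda>m. ereal (ln (real (qdim I (qpow I u W m))) / ln (real m))))"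

definition LDdim :: "'n::finite sk set \<Rightarrow> 'n sk set \<Rightarrow> 'n sk \<Rightarrow> ereal" where
  "LDdim I A u =
    (if \<forall>W\<in>subframes I A u. \<exists>X. qsubspace I A X \<and> qfindim I X \<and> qdim I X \<noteq> 0
                              \<and> qdim I (qprod I W X) = qdim I X
     then 0
     else (SUP W\<in>subframes I A u. Sup {ereal d | d. d > 0 \<and>
             (\<exists>c'>0. \<forall>X. qsubspace I A X \<and> qfindim I X \<and> qdim I X \<noteq> 0 \<longrightarrow>
                 real (qdim I (qprod I W X)) \<ge> real (qdim I X) + c' * real (qdim I X) powr ((d - 1) / d))}))"

end

theory Submission
  imports Defs "HOL-Library.Poly_Mapping" "HOL-Library.Function_Algebras" "HOL-Combinatorics.Multiset_Permutations"
begin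

text \<open>The left module \<open>H e\<close> is the tensor algebra modulo the relations
  \<open>a x y b = a y x b + (\<Sum>s\<in>G. K s x y * a (s b))\<close>. The diamond lemma gives unique normal forms in
  sorted words: overlaps of disjoint descents resolve by equivariance of \<open>K\<close>, and overlapping
  descents by the Jacobi identity, which for \<open>omega_s\<close> holds because \<open>1 - s\<close> has rank 2. Hence \<open>U = e H e\<close>
  embeds into polynomials, and every element of \<open>U\<close> has a leading exponent for the degree-lexicographic
  order; the dimension of a finite-dimensional subspace \<open>X\<close> is the number of leading exponents of its
  elements.

  For a coordinate \<open>x_i\<close>, the elementary symmetric functions \<open>e_k\<close> of its orbit lift to elements of \<open>U\<close>
  which multiply leading exponents by that of \<open>e_k\<close>. Since \<open>x_i\<close> is a root of the polynomial with coefficients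
  \<open>\<plusminus>e_k\<close>, two terms of that relation share their leading exponent, so the leading exponents of some
  \<open>e_k\<close> and \<open>e_l\<close> differ by a positive multiple of the \<open>i\<close>-th unit vector. Let \<open>W\<close> be spanned by these
  lifts. Then \<open>W X\<close> has at least \<open>|Q| + |proj_i Q|\<close> leading exponents for every \<open>i\<close>, where \<open>Q\<close> is the set of
  those of \<open>X\<close>, and a Loomis-Whitney type inequality yields the isoperimetric inequality with exponent \<open>dim V\<close>.
  Iterating such an inequality forces polynomial growth of that exponent, whereas the degree filtration bounds the growth of
  every subframe by \<open>dim V\<close>; this determines both \<open>LD\<close> and \<open>GK\<close>.\<close>

section \<open>Polynomials with a grading exponent\<close>

text \<open>The ring of Gamma-invariant polynomials, which should be the associated graded ring of
  U, is never computed. It suffices that enough invariants exist, and orbit polynomials supply them.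
  Their leading exponents are unknown, so a single lift gives no direction; only the difference of
  two leading exponents is controlled, and therefore \<open>W\<close> has to contain all the
  \<open>e_k\<close>. Passing from H to H e absorbs group elements at the right end of every word,
  so that normal forms are commutative polynomials with scalar coefficients instead of coefficients
  in the group algebra. The price is that the normal form forgets part of H. On U nothing is lost
  modulo the ideal, because elements there agree with their corners e a e. The quotient H e is
  handled through functions on words. A linear map on H e is a function \<open>T\<close> satisfying
  a commutation identity. That \<open>T\<close> is determined by its values on sorted words is an
  easy induction; the diamond lemma supplies the converse, a compatible function with prescribed
  monomials as values there.\<close>

abbreviation coeff_of :: "('a \<Rightarrow>\<^sub>0 complex) \<Rightarrow> 'a \<Rightarrow> complex" where
  "coeff_of \<equiv> Poly_Mapping.lookup"

abbreviation support :: "('a \<Rightarrow>\<^sub>0 'b::zero) \<Rightarrow> 'a set" where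
  "support \<equiv> Poly_Mapping.keys"

text \<open>Exponent vectors carry the total degree in coordinate 0, so that the lexicographic order
  is the degree-lexicographic monomial order.\<close>

type_synonym expo = "nat \<Rightarrow>\<^sub>0 nat"
type_synonym cpoly = "expo \<Rightarrow>\<^sub>0 complex"

definition const :: "complex \<Rightarrow> cpoly" where
  "const z = Poly_Mapping.single 0 z"

lemma const_0 [simp]: "const 0 = 0" and const_1 [simp]: "const 1 = 1"
  and const_add: "const (a + b) = const a + const b"
  and const_uminus: "const (- a) = - const a"
  and const_mult: "const (a * b) = const a * const b"
  by (simp_all add: const_def single_add single_uminus mult_single)

lemma const_sum: "const (sum f A) = (\<Sum>x\<in>A. const (f x))"
  by (induction A rule: infinite_finite_induct) (simp_all add: const_add)

lemma const_inject [simp]: "const a = const b \<longleftrightarrow> a = b"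
  by (metis const_def lookup_single_eq)

lemma coeff_const_mult [simp]: "coeff_of (const z * p) m = z * coeff_of p m"
  unfolding const_def mult_map_scale_conv_mult[symmetric] by (simp add: Poly_Mapping.map.rep_eq when_def)

lemma support_const_mult: "support (const z * p) \<subseteq> support p"
  by (auto simp: in_keys_iff)

definition supported :: "expo set \<Rightarrow> cpoly set" where
  "supported E = {p. support p \<subseteq> E}"

lemma supported_0 [simp]: "0 \<in> supported E"
  by (simp add: supported_def)

lemma supported_add: "p \<in> supported E \<Longrightarrow> q \<in> supported E \<Longrightarrow> p + q \<in> supported E"
  using keys_add[of p q] by (auto simp: supported_def)

lemma supported_const_mult: "p \<in> supported E \<Longrightarrow> const z * p \<in> supported E"
  using support_const_mult[of z p] by (auto simp: supported_def)

lemma supported_sum: "(\<And>x. x \<in> A \<Longrightarrow> f x \<in> supported E) \<Longrightarrow> sum f A \<in> supported E"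
  by (induction A rule: infinite_finite_induct) (auto intro: supported_add)

lemma supported_mono: "p \<in> supported E \<Longrightarrow> E \<subseteq> E' \<Longrightarrow> p \<in> supported E'"
  by (auto simp: supported_def)

lemma supported_mult:
  "p \<in> supported E \<Longrightarrow> q \<in> supported F \<Longrightarrow> (\<And>a b. a \<in> E \<Longrightarrow> b \<in> F \<Longrightarrow> a + b \<in> D) \<Longrightarrow> p * q \<in> supported D"
  using keys_mult[of p q] by (fastforce simp: supported_def)

section \<open>Multilinear extension of functions on words\<close>

abbreviation ax :: "'n::finite \<Rightarrow> complex^'n" where
  "ax j \<equiv> axis j 1"

text \<open>A function on words is a linear map on the tensor algebra, and \<open>mext F vs\<close>
  is its value on the pure tensor of \<open>vs\<close>. A group element acting on part of a word
  then just replaces letters by vectors, with no need to expand the result.\<close>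

primrec mext :: "('n::finite list \<Rightarrow> cpoly) \<Rightarrow> (complex^'n) list \<Rightarrow> cpoly" where
  "mext F [] = F []"
| "mext F (v # vs) = (\<Sum>i\<in>UNIV. const (v $ i) * mext (\<lambda>u. F (i # u)) vs)"

lemma mext_cong_length:
  "(\<And>u. length u = length vs \<Longrightarrow> F u = H u) \<Longrightarrow> mext F vs = mext H vs"
proof (induction vs arbitrary: F H)
  case (Cons v vs)
  have "mext (\<lambda>u. F (i # u)) vs = mext (\<lambda>u. H (i # u)) vs" for i
    by (rule Cons.IH) (simp add: Cons.prems)
  then show ?case by simp
qed simp

text \<open>Lets \<open>function\<close> see that recursive calls below \<open>mext\<close> concern
  only words of the length of the argument list; the termination of \<open>NF\<close> rests on
  this.\<close>

lemma mext_fundef_cong [fundef_cong]: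
  "vs = vs' \<Longrightarrow> (\<And>u. length u = length vs' \<Longrightarrow> F u = H u) \<Longrightarrow> mext F vs = mext H vs'"
  using mext_cong_length by blast

lemma mext_append: "mext F (a @ b) = mext (\<lambda>u. mext (\<lambda>v. F (u @ v)) b) a"
  by (induction a arbitrary: F) auto

lemma sum_axis: "(\<Sum>i\<in>UNIV. const (axis j x $ i) * f i) = const x * f (j :: 'n::finite)"
proof -
  have "(\<Sum>i\<in>UNIV. const (axis j x $ i) * f i) = (\<Sum>i\<in>UNIV. if i = j then const x * f i else 0)"
    by (intro sum.cong) (auto simp: axis_def)
  then show ?thesis by simp
qed

lemma mext_axis [simp]: "mext F (map ax w) = F w"
  by (induction w arbitrary: F) (simp_all add: sum_axis)

lemma mext_axis_append: "mext F (map ax w @ vs) = mext (\<lambda>v. F (w @ v)) vs"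
  by (simp add: mext_append)

lemma mext_add: "mext (\<lambda>u. F u + H u) vs = mext F vs + mext H vs"
  by (induction vs arbitrary: F H) (simp_all add: sum.distrib distrib_left)

lemma mext_diff: "mext (\<lambda>u. F u - H u) vs = mext F vs - mext H vs"
  by (induction vs arbitrary: F H) (simp_all add: sum_subtractf right_diff_distrib)

lemma mext_mult: "mext (\<lambda>u. c * F u) vs = c * mext F vs"
  by (induction vs arbitrary: F) (simp_all add: sum_distrib_left mult.left_commute)

lemma mext_0 [simp]: "mext (\<lambda>u. 0) vs = 0"
  by (induction vs) simp_all

lemma mext_sum: "mext (\<lambda>u. \<Sum>x\<in>A. F x u) vs = (\<Sum>x\<in>A. mext (F x) vs)"
  by (induction A rule: infinite_finite_induct) (simp_all add: mext_add)

lemma mext_supported: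
  "(\<And>u. length u = length vs \<Longrightarrow> F u \<in> supported E) \<Longrightarrow> mext F vs \<in> supported E"
  by (induction vs arbitrary: F) (auto intro!: supported_sum supported_const_mult)

lemma mext_commute:
  "mext (\<lambda>u. mext (\<lambda>v. F u v) b) a = mext (\<lambda>v. mext (\<lambda>u. F u v) a) b"
  by (induction a arbitrary: F) (simp_all add: mext_sum mext_mult)

lemma mext_linear_combination:
  "mext F (a @ (\<Sum>i\<in>A. c i *s x i) # b) = (\<Sum>i\<in>A. const (c i) * mext F (a @ x i # b))"
proof -
  have "mext F (a @ (\<Sum>i\<in>A. c i *s x i) # b) =
      (\<Sum>k\<in>UNIV. \<Sum>i\<in>A. const (c i) * (const (x i $ k) * mext (\<lambda>u. mext (\<lambda>v. F (u @ k # v)) b) a))"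
    by (simp add: mext_append mext_sum mext_mult const_sum const_mult sum_distrib_right mult.assoc)
  also have "\<dots> = (\<Sum>i\<in>A. const (c i) * mext F (a @ x i # b))"
    by (subst sum.swap) (simp add: mext_append mext_sum mext_mult sum_distrib_left)
  finally show ?thesis .
qed

lemma vec_expand: "(\<Sum>i\<in>UNIV. v $ i *s ax i) = (v :: complex^'n::finite)"
  by (simp add: vec_eq_iff axis_def if_distrib cong: if_cong)

lemma mext_expand: "mext F (a @ v # b) = (\<Sum>i\<in>UNIV. const (v $ i) * mext F (a @ ax i # b))"
  using mext_linear_combination[of F a "\<lambda>i. v $ i" ax UNIV b] by (simp add: vec_expand)

lemma mext_expand_matrix:
  "mext F (a @ (g *v v) # b) = (\<Sum>i\<in>UNIV. const (v $ i) * mext F (a @ (g *v ax i) # b))"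
proof -
  have "g *v v = (\<Sum>i\<in>UNIV. v $ i *s (g *v ax i))"
    by (simp add: vec_eq_iff matrix_vector_mult_def axis_def if_distrib mult.commute cong: if_cong)
  then show ?thesis using mext_linear_combination[of F a "\<lambda>i. v $ i" "\<lambda>i. g *v ax i" UNIV b] by simp
qed

definition multilinear :: "((complex^'n::finite) list \<Rightarrow> cpoly) \<Rightarrow> bool" where
  "multilinear f \<longleftrightarrow> (\<forall>a v b. f (a @ v # b) = (\<Sum>i\<in>UNIV. const (v $ i) * f (a @ ax i # b)))"

lemma multilinearD: "multilinear f \<Longrightarrow> f (a @ v # b) = (\<Sum>i\<in>UNIV. const (v $ i) * f (a @ ax i # b))"
  unfolding multilinear_def by blast

lemma multilinear_eq_mext:
  assumes "multilinear f"
  shows "f (a @ vs) = mext (\<lambda>w. f (a @ map ax w)) vs"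
proof (induction vs arbitrary: a)
  case Nil
  then show ?case by simp
next
  case (Cons v vs)
  have "f (a @ v # vs) = (\<Sum>i\<in>UNIV. const (v $ i) * f ((a @ [ax i]) @ vs))"
    by (subst multilinearD[OF assms]) simp
  then show ?case by (simp only: Cons) simp
qed

lemma multilinear_mext: "multilinear (\<lambda>vs. mext F (a @ map ((*v) g) vs @ b))"
  unfolding multilinear_def
proof (intro allI)
  fix a' v b'
  show "mext F (a @ map ((*v) g) (a' @ v # b') @ b) =
      (\<Sum>i\<in>UNIV. const (v $ i) * mext F (a @ map ((*v) g) (a' @ ax i # b') @ b))"
    using mext_expand_matrix[of F "a @ map ((*v) g) a'" g v "map ((*v) g) b' @ b"] by simp
qed

lemma multilinear_mext': "multilinear (\<lambda>vs. mext F (a @ vs @ b))"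
  unfolding multilinear_def
proof (intro allI)
  fix a' v b'
  show "mext F (a @ (a' @ v # b') @ b) = (\<Sum>i\<in>UNIV. const (v $ i) * mext F (a @ (a' @ ax i # b') @ b))"
    using mext_expand[of F "a @ a'" v "b' @ b"] by simp
qed

lemma multilinear_zero:
  assumes "multilinear f" "\<And>w. length w = length vs \<Longrightarrow> f (map ax w) = 0"
  shows "f vs = 0"
proof -
  have "f vs = mext (\<lambda>w. f (map ax w)) vs"
    using multilinear_eq_mext[OF assms(1), of "[]" vs] by simp
  also have "\<dots> = mext (\<lambda>w. 0) vs" by (rule mext_cong_length) (rule assms(2))
  finally show ?thesis by simp
qed

lemma multilinearI:
  "(\<And>a v b. f (a @ v # b) = (\<Sum>i\<in>UNIV. const (v $ i) * f (a @ ax i # b))) \<Longrightarrow> multilinear f"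
  unfolding multilinear_def by blast

lemma multilinear_diff:
  assumes f: "multilinear f" and h: "multilinear h"
  shows "multilinear (\<lambda>v. f v - h v)"
proof (rule multilinearI)
  fix a v b
  show "f (a @ v # b) - h (a @ v # b) = (\<Sum>i\<in>UNIV. const (v $ i) * (f (a @ ax i # b) - h (a @ ax i # b)))"
    unfolding multilinearD[OF f, of a v b] multilinearD[OF h, of a v b] by (simp add: right_diff_distrib sum_subtractf)
qed

lemma multilinear_add:
  assumes f: "multilinear f" and h: "multilinear h"
  shows "multilinear (\<lambda>v. f v + h v)"
proof (rule multilinearI)
  fix a v b
  show "f (a @ v # b) + h (a @ v # b) = (\<Sum>i\<in>UNIV. const (v $ i) * (f (a @ ax i # b) + h (a @ ax i # b)))"
    unfolding multilinearD[OF f, of a v b] multilinearD[OF h, of a v b] by (simp add: distrib_left sum.distrib)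
qed

lemma multilinear_mult:
  assumes f: "multilinear f"
  shows "multilinear (\<lambda>v. c * f v)"
proof (rule multilinearI)
  fix a v b
  show "c * f (a @ v # b) = (\<Sum>i\<in>UNIV. const (v $ i) * (c * f (a @ ax i # b)))"
    unfolding multilinearD[OF f, of a v b] by (simp add: sum_distrib_left mult.left_commute)
qed

lemma multilinear_0: "multilinear (\<lambda>v. 0)"
  by (rule multilinearI) simp

lemma multilinear_sum: "(\<And>x. x \<in> A \<Longrightarrow> multilinear (f x)) \<Longrightarrow> multilinear (\<lambda>v. \<Sum>x\<in>A. f x v)"
  by (induction A rule: infinite_finite_induct) (auto intro: multilinear_0 multilinear_add)

abbreviation act :: "complex^'n^'n \<Rightarrow> 'n::finite list \<Rightarrow> (complex^'n) list" where
  "act g u \<equiv> map (\<lambda>j. g *v ax j) u"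

lemma mext_mext_act: "mext (\<lambda>u. mext F (a @ act g u @ b)) vs = mext F (a @ map ((*v) g) vs @ b)"
  using multilinear_eq_mext[OF multilinear_mext[of F a g b], of "[]" vs] by (simp add: o_def)

text \<open>The coefficients are the products of matrix entries in \<open>sk_mult\<close> and of
  coordinates in \<open>tensor\<close>; this links those explicit formulas to the recursive
  extension.\<close>

lemma mext_explicit:
  "mext F vs = (\<Sum>w | length w = length vs. const (\<Prod>l<length vs. vs ! l $ (w ! l)) * F w)"
proof (induction vs arbitrary: F)
  case Nil
  then show ?case by simp
next
  case (Cons v vs)
  have fin: "finite {w::'a list. length w = m}" for m
    using finite_lists_length_eq[of "UNIV :: 'a set" m] by simp
  have *: "{w::'a list. length w = length (v # vs)} = (\<lambda>(i, w). i # w) ` (UNIV \<times> {w. length w = length vs})"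
    by (force simp: length_Suc_conv)
  have "(\<Sum>w | length w = length (v # vs). const (\<Prod>l<length (v # vs). (v # vs) ! l $ (w ! l)) * F w)
      = (\<Sum>(i, w)\<in>UNIV \<times> {w. length w = length vs}.
           const (\<Prod>l<length (v # vs). (v # vs) ! l $ ((i # w) ! l)) * F (i # w))"
    unfolding * by (subst sum.reindex) (auto simp: inj_on_def o_def case_prod_unfold)
  also have "\<dots> = (\<Sum>i\<in>UNIV. \<Sum>w | length w = length vs.
           const (v $ i) * (const (\<Prod>l<length vs. vs ! l $ (w ! l)) * F (i # w)))"
    by (subst sum.cartesian_product[symmetric])
       (simp add: prod.lessThan_Suc_shift const_mult mult.assoc del: prod.lessThan_Suc)
  finally show ?case by (simp add: Cons sum_distrib_left)
qed

section \<open>Normal forms modulo deformed commutation relations\<close>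

text \<open>Here \<open>K s x y\<close> is the coefficient of \<open>s\<close> in the commutator of
  \<open>x\<close> and \<open>y\<close>. By \<open>K_equivariant\<close>, conjugating a relation
  with a group element gives a relation again. \<open>K_jacobi\<close> is the Jacobi identity read
  off at \<open>s\<close>: since \<open>s z = s(z) s\<close>, commuting \<open>z\<close> with
  \<open>s\<close> leaves \<open>(z - s(z)) s\<close>.\<close>

locale deformed_commutation =
  fixes idx :: "'n::finite \<Rightarrow> nat"
    and G :: "(complex^'n^'n) set"
    and K :: "complex^'n^'n \<Rightarrow> complex^'n \<Rightarrow> complex^'n \<Rightarrow> complex"
  assumes inj_idx: "inj idx"
    and finite_G: "finite G"
    and one_G: "mat 1 \<in> G"
    and mult_G: "g \<in> G \<Longrightarrow> h \<in> G \<Longrightarrow> g ** h \<in> G"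
    and inv_G: "g \<in> G \<Longrightarrow> \<exists>h\<in>G. g ** h = mat 1 \<and> h ** g = mat 1"
    and K_add: "K s (x + x') y = K s x y + K s x' y"
    and K_scale: "K s (a *s x) y = a * K s x y"
    and K_skew: "K s x y = - K s y x"
    and K_equivariant: "g \<in> G \<Longrightarrow> s \<in> G \<Longrightarrow> h \<in> G \<Longrightarrow> g ** h = mat 1 \<Longrightarrow>
      K (g ** s ** h) (g *v x) (g *v y) = K s x y"
    and K_jacobi: "s \<in> G \<Longrightarrow>
      K s y z *s (x - s *v x) + K s z x *s (y - s *v y) + K s x y *s (z - s *v z) = 0"
begin

section \<open>Commutation corrections and the two kinds of overlap\<close>

lemma K_self [simp]: "K s x x = 0"
  using K_skew[of s x x] by simp

lemma K_sum: "K s (\<Sum>i\<in>A. c i *s f i) y = (\<Sum>i\<in>A. c i * K s (f i) y)"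
proof (induction A rule: infinite_finite_induct)
  case empty
  show ?case using K_scale[of s 0 0 y] by simp
next
  case (infinite A)
  then show ?case using K_scale[of s 0 0 y] by simp
qed (simp add: K_add K_scale)

lemma K_expand1: "K s x y = (\<Sum>i\<in>UNIV. x $ i * K s (ax i) y)"
  using K_sum[of s "\<lambda>i. x $ i" ax UNIV y] by (simp add: vec_expand)

lemma K_expand2: "K s x y = (\<Sum>i\<in>UNIV. y $ i * K s x (ax i))"
  using K_expand1[of s y x] K_skew[of s x] by (simp add: sum_negf)

text \<open>The correction for replacing \<open>x y\<close> by \<open>y x\<close> between
  \<open>a\<close> and \<open>b\<close>. The commutator puts \<open>s\<close> in their place; moving
  it to the right turns \<open>b\<close> into \<open>s b\<close>, and at the right end it is
  absorbed.\<close>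

definition reorder :: "('n list \<Rightarrow> cpoly) \<Rightarrow> (complex^'n) list \<Rightarrow> complex^'n \<Rightarrow> complex^'n \<Rightarrow> (complex^'n) list \<Rightarrow> cpoly" where
  "reorder T a x y b = (\<Sum>s\<in>G. const (K s x y) * mext T (a @ map ((*v) s) b))"

lemma reorder_words:
  "reorder T (map ax a) x y (map ax b) = (\<Sum>s\<in>G. const (K s x y) * mext (\<lambda>v. T (a @ v)) (act s b))"
  by (simp add: reorder_def mext_axis_append o_def)

text \<open>These are the linear maps on the tensor algebra that descend to H e.\<close>

definition compatible :: "('n list \<Rightarrow> cpoly) \<Rightarrow> bool" where
  "compatible T \<longleftrightarrow> (\<forall>a i j b. T (a @ i # j # b) - T (a @ j # i # b)
     = (\<Sum>s\<in>G. const (K s (ax i) (ax j)) * mext (\<lambda>v. T (a @ v)) (act s b)))"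

lemma compatibleD:
  "compatible T \<Longrightarrow> T (a @ i # j # b) - T (a @ j # i # b) = reorder T (map ax a) (ax i) (ax j) (map ax b)"
  by (simp add: compatible_def reorder_words)

text \<open>Both sides are linear in every slot, so basis words suffice. The lengths are fixed
  because, while \<open>NF\<close> is being analysed, the relation is available only for short
  words.\<close>

lemma relation_words_to_vectors:
  assumes "\<And>a i j b. length a = m \<Longrightarrow> length b = n \<Longrightarrow>
      T (a @ i # j # b) - T (a @ j # i # b) = reorder T (map ax a) (ax i) (ax j) (map ax b)"
    and "length a = m" "length b = n"
  shows "mext T (a @ x # y # b) - mext T (a @ y # x # b) = reorder T a x y b"
proof -
  define D where "D a x y b = mext T (a @ x # y # b) - mext T (a @ y # x # b) - reorder T a x y b" for a x y b
  have 0: "D (map ax u) (ax i) (ax j) (map ax v) = 0" if "length u = m" "length v = n" for u i j v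
    using assms(1)[OF that, of i j] mext_axis[of T "u @ i # j # v"] mext_axis[of T "u @ j # i # v"]
    by (simp add: D_def)
  have 1: "D (map ax u) (ax i) (ax j) b = 0" if "length u = m" for u i j
  proof -
    have "multilinear (\<lambda>b. D (map ax u) (ax i) (ax j) b)"
      unfolding D_def reorder_def
      using multilinear_mext'[of T "map ax u @ [ax i, ax j]" "[]"]
        multilinear_mext'[of T "map ax u @ [ax j, ax i]" "[]"] multilinear_mext[of T "map ax u" _ "[]"]
      by (intro multilinear_diff multilinear_sum multilinear_mult) simp_all
    then show ?thesis by (rule multilinear_zero) (use 0 that assms(3) in auto)
  qed
  have y: "D a x y b = (\<Sum>j\<in>UNIV. const (y $ j) * D a x (ax j) b)" for a x y
    unfolding D_def reorder_def
    using mext_expand[of T "a @ [x]" y b] mext_expand[of T a y "x # b"]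
    by (subst K_expand2)
       (simp add: right_diff_distrib sum_subtractf const_sum const_mult sum_distrib_left sum_distrib_right
         mult.assoc sum.swap[of _ G])
  have x: "D a x y b = (\<Sum>j\<in>UNIV. const (x $ j) * D a (ax j) y b)" for a x y
    unfolding D_def reorder_def
    using mext_expand[of T "a @ [y]" x b] mext_expand[of T a x "y # b"]
    by (subst K_expand1)
       (simp add: right_diff_distrib sum_subtractf const_sum const_mult sum_distrib_left sum_distrib_right
         mult.assoc sum.swap[of _ G])
  have 2: "D (map ax u) x y b = 0" if "length u = m" for u
    by (subst x, subst y) (simp add: 1 that)
  have "multilinear (\<lambda>a. D a x y b)"
    unfolding D_def reorder_def
    using multilinear_mext'[of T "[]" "x # y # b"]
      multilinear_mext'[of T "[]" "y # x # b"] multilinear_mext'[of T "[]"]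
    by (intro multilinear_diff multilinear_sum multilinear_mult) simp_all
  then have "D a x y b = 0" by (rule multilinear_zero) (use 2 assms(2) in auto)
  then show ?thesis by (simp add: D_def)
qed

lemma compatible_vectors:
  "compatible T \<Longrightarrow> mext T (a @ x # y # b) - mext T (a @ y # x # b) = reorder T a x y b"
  by (rule relation_words_to_vectors[where m = "length a" and n = "length b"]) (auto dest: compatibleD)

text \<open>Substitute \<open>s t s^-1\<close> for \<open>t\<close>: equivariance restores the
  coefficient, and \<open>t s\<close> becomes \<open>s t\<close>. This is how a commutator passes a
  group element.\<close>

lemma conj_sum:
  assumes "s \<in> G"
  shows "(\<Sum>t\<in>G. const (K t (s *v z) (s *v u)) * F (t ** s)) = (\<Sum>t\<in>G. const (K t z u) * F (s ** t))"
proof -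
  obtain h where h: "h \<in> G" "s ** h = mat 1" "h ** s = mat 1" using inv_G assms by blast
  have c1: "s ** (h ** t ** s) ** h = t" for t
  proof -
    have "s ** (h ** t ** s) ** h = (s ** h) ** t ** (s ** h)" by (simp add: matrix_mul_assoc)
    then show ?thesis by (simp add: h)
  qed
  have c2: "h ** (s ** t ** h) ** s = t" for t
  proof -
    have "h ** (s ** t ** h) ** s = (h ** s) ** t ** (h ** s)" by (simp add: matrix_mul_assoc)
    then show ?thesis by (simp add: h)
  qed
  have c3: "s ** t ** h ** s = s ** t" for t
    using matrix_mul_assoc[of "s ** t" h s] h by simp
  show ?thesis
  proof (rule sum.reindex_bij_witness[where i = "\<lambda>t. s ** t ** h" and j = "\<lambda>t. h ** t ** s"])
    fix t assume t: "t \<in> G"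
    show "s ** (h ** t ** s) ** h = t" "h ** (s ** t ** h) ** s = t" by (fact c1 c2)+
    show "h ** t ** s \<in> G" "s ** t ** h \<in> G" using t h assms mult_G by auto
    have "K t (s *v z) (s *v u) = K (h ** t ** s) z u"
      using K_equivariant[OF assms \<open>h ** t ** s \<in> G\<close> h(1,2), of z u] by (simp add: c1)
    moreover have "s ** (h ** t ** s) = t ** s"
      using c3[of "h ** t ** s"] by (metis c1 c3 matrix_mul_assoc)
    ultimately show "const (K (h ** t ** s) z u) * F (s ** (h ** t ** s)) = const (K t (s *v z) (s *v u)) * F (t ** s)"
      by simp
  qed
qed

text \<open>The two exchanges do not touch each other, so either order leaves the same double sum
  over \<open>s\<close> and \<open>t\<close>. The only discrepancy is whether the tail carries
  \<open>t s\<close> or \<open>s t\<close>, and \<open>conj_sum\<close> settles it. The relation is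
  required only for words from which one of the pairs is gone.\<close>

lemma disjoint_overlap:
  assumes rel: "\<And>a x y b. length a = length A + length B \<Longrightarrow> length b = length C \<Longrightarrow>
      mext T (a @ x # y # b) - mext T (a @ y # x # b) = reorder T a x y b"
    and rel': "\<And>a x y b. length a = length A \<Longrightarrow> length b = length B + length C \<Longrightarrow>
      mext T (a @ x # y # b) - mext T (a @ y # x # b) = reorder T a x y b"
  shows "reorder T A x y (B @ z # u # C) - reorder T A x y (B @ u # z # C)
       = reorder T (A @ x # y # B) z u C - reorder T (A @ y # x # B) z u C"
proof -
  have "reorder T A x y (B @ z # u # C) - reorder T A x y (B @ u # z # C)
      = (\<Sum>s\<in>G. const (K s x y) * reorder T (A @ map ((*v) s) B) (s *v z) (s *v u) (map ((*v) s) C))"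
    unfolding reorder_def[of T A x y]
    by (subst rel[symmetric]) (simp_all add: sum_subtractf right_diff_distrib)
  also have "\<dots> = (\<Sum>s\<in>G. const (K s x y) *
        (\<Sum>t\<in>G. const (K t (s *v z) (s *v u)) * mext T (A @ map ((*v) s) B @ map ((*v) (t ** s)) C)))"
    by (simp add: reorder_def o_def matrix_vector_mul_assoc)
  also have "\<dots> = (\<Sum>s\<in>G. const (K s x y) *
        (\<Sum>t\<in>G. const (K t z u) * mext T (A @ map ((*v) s) B @ map ((*v) (s ** t)) C)))"
    by (intro sum.cong refl arg_cong2[of _ _ _ _ "(*)"] conj_sum)
  also have "\<dots> = (\<Sum>t\<in>G. const (K t z u) *
        (\<Sum>s\<in>G. const (K s x y) * mext T (A @ map ((*v) s) B @ map ((*v) (s ** t)) C)))"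
    unfolding sum_distrib_left by (subst sum.swap) (simp add: mult.left_commute)
  also have "\<dots> = (\<Sum>t\<in>G. const (K t z u) * reorder T A x y (B @ map ((*v) t) C))"
    by (simp add: reorder_def o_def matrix_vector_mul_assoc)
  also have "\<dots> = reorder T (A @ x # y # B) z u C - reorder T (A @ y # x # B) z u C"
    unfolding reorder_def[of T _ z u]
    by (subst rel'[symmetric]) (simp_all add: sum_subtractf right_diff_distrib)
  finally show ?thesis .
qed

text \<open>Each side collects the corrections along one of the two ways from \<open>x y z\<close>
  to \<open>z y x\<close>. For fixed \<open>s\<close>, the third letter stands before
  \<open>s\<close>, untouched, or behind it and is moved by it. The difference of the sides is, up
  to sign, \<open>T\<close> on the Jacobi expression followed by \<open>s B\<close>, hence
  zero.\<close>

lemma triple_overlap: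
  "reorder T A x y (z # B) + reorder T (A @ [y]) x z B + reorder T A y z (x # B)
   = reorder T (A @ [x]) y z B + reorder T A x z (y # B) + reorder T (A @ [z]) x y B"
proof -
  have lin: "mext T (A @ (a *s u + b *s v + c *s w) # B') =
     const a * mext T (A @ u # B') + const b * mext T (A @ v # B') + const c * mext T (A @ w # B')" for a b c u v w B'
    using mext_linear_combination[of T A "\<lambda>i. [a, b, c] ! i" "\<lambda>i. [u, v, w] ! i" "{0, 1, 2::nat}" B']
    by (simp add: add.assoc)
  have sub: "mext T (A @ (u - v) # B') = mext T (A @ u # B') - mext T (A @ v # B')" for u v B'
    using lin[of 1 u "-1" v 0 0 B'] by (simp add: const_uminus)
  have zero: "mext T (A @ 0 # B') = 0" for B'
    using lin[of 0 0 0 0 0 0 B'] by simp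
  have "const (K s y z) * (mext T (A @ x # map ((*v) s) B) - mext T (A @ s *v x # map ((*v) s) B))
      + const (K s z x) * (mext T (A @ y # map ((*v) s) B) - mext T (A @ s *v y # map ((*v) s) B))
      + const (K s x y) * (mext T (A @ z # map ((*v) s) B) - mext T (A @ s *v z # map ((*v) s) B)) = 0"
    if "s \<in> G" for s
    using lin[of "K s y z" "x - s *v x" "K s z x" "y - s *v y" "K s x y" "z - s *v z" "map ((*v) s) B"]
    unfolding K_jacobi[OF that] sub zero by simp
  then have "(\<Sum>s\<in>G. const (K s y z) * (mext T (A @ x # map ((*v) s) B) - mext T (A @ s *v x # map ((*v) s) B))
      + const (K s z x) * (mext T (A @ y # map ((*v) s) B) - mext T (A @ s *v y # map ((*v) s) B))
      + const (K s x y) * (mext T (A @ z # map ((*v) s) B) - mext T (A @ s *v z # map ((*v) s) B))) = 0"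
    by simp
  then show ?thesis
    unfolding reorder_def using K_skew[of _ z x]
    by (simp add: sum.distrib sum_subtractf right_diff_distrib const_uminus sum_negf algebra_simps)
qed

section \<open>Rewriting words to sorted form\<close>

primrec inversions :: "'n list \<Rightarrow> nat" where
  "inversions [] = 0"
| "inversions (x # xs) = length (filter (\<lambda>y. idx y < idx x) xs) + inversions xs"

lemma inversions_swap: "idx i < idx j \<Longrightarrow> inversions (a @ i # j # b) < inversions (a @ j # i # b)"
  by (induction a) auto

lemma descent_exists:
  "\<not> sorted (map idx w) \<Longrightarrow> \<exists>a j i b. w = a @ j # i # b \<and> idx i < idx j"
proof (induction w)
  case (Cons x w)
  show ?case
  proof (cases "sorted (map idx w)")
    case True
    with Cons.prems obtain y ys where "w = y # ys" "idx y < idx x"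
      by (cases w) (auto simp: not_le intro: le_less_trans order_trans dest: leI)
    then show ?thesis by (metis append_Nil)
  next
    case False
    then show ?thesis using Cons.IH by (metis append_Cons)
  qed
qed simp

text \<open>The choice is arbitrary; that the outcome does not depend on it is the content of
  \<open>NF_descent_aux\<close>.\<close>

definition descent :: "'n list \<Rightarrow> 'n list \<times> 'n \<times> 'n \<times> 'n list" where
  "descent w = (SOME (a, j, i, b). w = a @ j # i # b \<and> idx i < idx j)"

lemma descentE:
  assumes "descent w = (a, j, i, b)" "\<not> sorted (map idx w)"
  shows "w = a @ j # i # b" "idx i < idx j"
proof -
  have "\<exists>p. (\<lambda>(a, j, i, b). w = a @ j # i # b \<and> idx i < idx j) p"
    using descent_exists[OF assms(2)] by auto
  from someI_ex[OF this] show "w = a @ j # i # b" "idx i < idx j"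
    using assms(1) unfolding descent_def by auto
qed

lemma descent_decreases:
  assumes "(a, j, i, b) = descent w" "\<not> sorted (map idx w)"
  shows "length w = length a + length b + 2 \<and> inversions (a @ i # j # b) < inversions w"
  using descentE[OF assms(1)[symmetric] assms(2)] inversions_swap by auto

definition word_expo :: "'n list \<Rightarrow> expo" where
  "word_expo w = (\<Sum>j\<leftarrow>w. Poly_Mapping.single 0 1 + Poly_Mapping.single (Suc (idx j)) 1)"

abbreviation monomial :: "'n list \<Rightarrow> cpoly" where
  "monomial w \<equiv> Poly_Mapping.single (word_expo w) 1"

context
  notes sum.cong [fundef_cong]
begin

text \<open>Exchanging the letters of a descent keeps the length and removes an inversion, while
  every correction loses two letters; hence the lexicographic measure.\<close>

function NF :: "'n list \<Rightarrow> cpoly" where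
  "NF w = (if sorted (map idx w) then monomial w
     else case descent w of (a, j, i, b) \<Rightarrow> NF (a @ i # j # b)
       + (\<Sum>s\<in>G. const (K s (ax j) (ax i)) * mext (\<lambda>v. NF (a @ v)) (act s b)))"
  by pat_completeness auto
termination
  by (relation "measures [length, inversions]") (auto dest!: descent_decreases)

end

declare NF.simps [simp del]

lemma NF_sorted: "sorted (map idx w) \<Longrightarrow> NF w = monomial w"
  by (simp add: NF.simps)

text \<open>The diamond lemma. For the descent picked by \<open>descent\<close> this is the defining
  equation. For any other descent, both reductions can be continued to a common word, and the
  corrections met on the two ways agree: by \<open>disjoint_overlap\<close> if the pairs are
  disjoint, by \<open>triple_overlap\<close> if they share a letter.\<close>

lemma NF_descent_aux:
  assumes "w = a @ j # i # b" "idx i < idx j"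
  shows "NF w - NF (a @ i # j # b) = reorder NF (map ax a) (ax j) (ax i) (map ax b)"
  using assms
proof (induction w arbitrary: a j i b rule: wf_induct_rule[OF wf_measures[of "[length, inversions]"]])
  case (1 w)
  note IH = 1(1)
  have IHs: "NF (a' @ j' # i' # b') - NF (a' @ i' # j' # b') = reorder NF (map ax a') (ax j') (ax i') (map ax b')"
    if "length (a' @ j' # i' # b') < length w \<or>
      length (a' @ j' # i' # b') = length w \<and> inversions (a' @ j' # i' # b') < inversions w" "idx i' < idx j'" for a' j' i' b'
    by (rule IH) (use that in auto)
  \<comment> \<open>Corrections contain group translates of words, hence words in arbitrary order.
    On shorter words the relation is therefore needed for every adjacent pair, not just for
    descents.\<close>
  have words: "NF (a' @ i' # j' # b') - NF (a' @ j' # i' # b') = reorder NF (map ax a') (ax i') (ax j') (map ax b')"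
    if "length (a' @ j' # i' # b') < length w" for a' j' i' b'
  proof -
    consider "idx i' < idx j'" | "idx j' < idx i'" | "i' = j'"
      using inj_idx by (metis injD linorder_neqE_nat)
    then show ?thesis
    proof cases
      case 1
      then show ?thesis using IHs[of a' j' i' b'] that
        unfolding reorder_def by (subst K_skew) (simp add: const_uminus sum_negf algebra_simps)
    next
      case 2
      then show ?thesis using IHs[of a' i' j' b'] that by simp
    next
      case 3
      then show ?thesis by (simp add: reorder_def)
    qed
  qed
  have vecs: "mext NF (a' @ x # y # b') - mext NF (a' @ y # x # b') = reorder NF a' x y b'"
    if "length a' + length b' + 2 < length w" for a' x y b'
    by (rule relation_words_to_vectors[where m = "length a'" and n = "length b'"]) (use that words in auto)
  have disj: "NF (a @ i # j # m @ l # k # c) + reorder NF (map ax a) (ax j) (ax i) (map ax (m @ l # k # c))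
      = NF (a @ j # i # m @ k # l # c) + reorder NF (map ax (a @ j # i # m)) (ax l) (ax k) (map ax c)"
    if w: "w = a @ j # i # m @ l # k # c" and ij: "idx i < idx j" and kl: "idx k < idx l" for a j i m l k c
  proof -
    have "NF (a @ i # j # m @ l # k # c) - NF (a @ i # j # m @ k # l # c)
        = reorder NF (map ax (a @ i # j # m)) (ax l) (ax k) (map ax c)"
      using IHs[of "a @ i # j # m" l k c] inversions_swap[OF ij, of a "m @ l # k # c"] kl w by simp
    moreover have "NF (a @ j # i # m @ k # l # c) - NF (a @ i # j # m @ k # l # c)
        = reorder NF (map ax a) (ax j) (ax i) (map ax (m @ k # l # c))"
      using IHs[of a j i "m @ k # l # c"] inversions_swap[OF kl, of "a @ j # i # m" c] ij w by simp
    moreover have "reorder NF (map ax a) (ax j) (ax i) (map ax m @ ax l # ax k # map ax c)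
         - reorder NF (map ax a) (ax j) (ax i) (map ax m @ ax k # ax l # map ax c)
       = reorder NF (map ax a @ ax j # ax i # map ax m) (ax l) (ax k) (map ax c)
         - reorder NF (map ax a @ ax i # ax j # map ax m) (ax l) (ax k) (map ax c)"
      by (rule disjoint_overlap) (use w in \<open>auto intro!: vecs\<close>)
    ultimately show ?thesis by (simp add: algebra_simps)
  qed
  have over: "NF (a @ j # k # i # b) + reorder NF (map ax a) (ax k) (ax j) (map ax (i # b))
      = NF (a @ k # i # j # b) + reorder NF (map ax (a @ [k])) (ax j) (ax i) (map ax b)"
    if w: "w = a @ k # j # i # b" and ij: "idx i < idx j" and jk: "idx j < idx k" for a k j i b
  proof -
    have i1: "inversions (a @ j # k # i # b) < inversions w" using inversions_swap[OF jk, of a "i # b"] w by simp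
    have i2: "inversions (a @ k # i # j # b) < inversions w" using inversions_swap[OF ij, of "a @ [k]" "b"] w by simp
    have ik: "idx i < idx k" using ij jk by simp
    have i3: "inversions (a @ j # i # k # b) < inversions w"
      using inversions_swap[OF ik, of "a @ [j]" "b"] i1 by simp
    have i4: "inversions (a @ i # k # j # b) < inversions w"
      using inversions_swap[OF ik, of "a" "j # b"] i2 by simp
    have "NF (a @ j # k # i # b) - NF (a @ j # i # k # b) = reorder NF (map ax a @ [ax j]) (ax k) (ax i) (map ax b)"
      using IHs[of "a @ [j]" k i b] i1 ik w by simp
    moreover have "NF (a @ j # i # k # b) - NF (a @ i # j # k # b) = reorder NF (map ax a) (ax j) (ax i) (ax k # map ax b)"
      using IHs[of a j i "k # b"] i3 ij w by simp
    moreover have "NF (a @ k # i # j # b) - NF (a @ i # k # j # b) = reorder NF (map ax a) (ax k) (ax i) (ax j # map ax b)"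
      using IHs[of a k i "j # b"] i2 ik w by simp
    moreover have "NF (a @ i # k # j # b) - NF (a @ i # j # k # b) = reorder NF (map ax a @ [ax i]) (ax k) (ax j) (map ax b)"
      using IHs[of "a @ [i]" k j b] i4 jk w by simp
    moreover note triple_overlap[of NF "map ax a" "ax k" "ax j" "ax i" "map ax b"]
    ultimately show ?thesis by (simp add: algebra_simps)
  qed
  have ns: "\<not> sorted (map idx w)" using 1(2,3) by (auto simp: sorted_append)
  obtain a' j' i' b' where d: "descent w = (a', j', i', b')" by (metis prod_cases4)
  note d' = descentE[OF d ns]
  have NFw: "NF w = NF (a' @ i' # j' # b') + reorder NF (map ax a') (ax j') (ax i') (map ax b')"
    using ns by (simp add: NF.simps[of w] d reorder_words)
  have eq: "a' @ j' # i' # b' = a @ j # i # b" using d' 1 by simp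
  \<comment> \<open>By symmetry the first descent starts no later than the second. The gap
    \<open>u\<close> decides: if it is empty the descents coincide, one letter means an overlap, two
    or more letters mean disjoint pairs.\<close>
  have cmp: "NF (a @ i # j # b) + reorder NF (map ax a) (ax j) (ax i) (map ax b)
       = NF (a' @ i' # j' # b') + reorder NF (map ax a') (ax j') (ax i') (map ax b')"
    if eq: "a @ j # i # b = a' @ j' # i' # b'" and w: "w = a @ j # i # b" and ij: "idx i < idx j" and
      ij': "idx i' < idx j'" and le: "length a \<le> length a'" for a j i b a' j' i' b'
  proof -
    obtain u where u: "a' = a @ u" "j # i # b = u @ j' # i' # b'"
      using eq le by (auto simp: append_eq_append_conv_if) (metis append_take_drop_id)
    show ?thesis
    proof (cases u)
      case Nil
      then show ?thesis using u by simp
    next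
      case (Cons v u')
      show ?thesis
      proof (cases u')
        case Nil
        then show ?thesis using over[of a j i i' b'] u w ij ij' Cons by simp
      next
        case (Cons v' u'')
        then show ?thesis using disj[of a j i u'' j' i' b'] u w ij ij' \<open>u = v # u'\<close> by simp
      qed
    qed
  qed
  have "NF (a @ i # j # b) + reorder NF (map ax a) (ax j) (ax i) (map ax b)
       = NF (a' @ i' # j' # b') + reorder NF (map ax a') (ax j') (ax i') (map ax b')"
    using cmp[of a j i b a' j' i' b'] cmp[of a' j' i' b' a j i b] eq d' 1(2,3) by (metis nle_le)
  then show ?case using NFw by (simp add: algebra_simps)
qed

lemma compatible_NF: "compatible NF"
  unfolding compatible_def reorder_words[symmetric]
proof (intro allI)
  fix a i j b
  consider "idx i < idx j" | "idx j < idx i" | "i = j"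
    using inj_idx by (metis injD linorder_neqE_nat)
  then show "NF (a @ i # j # b) - NF (a @ j # i # b) = reorder NF (map ax a) (ax i) (ax j) (map ax b)"
  proof cases
    case 1
    then show ?thesis using NF_descent_aux[OF refl, of i j a b]
      unfolding reorder_def by (subst K_skew) (simp add: const_uminus sum_negf algebra_simps)
  next
    case 2
    then show ?thesis using NF_descent_aux[OF refl, of j i a b] by simp
  next
    case 3
    then show ?thesis by (simp add: reorder_def)
  qed
qed

lemma compatible_vectors_descent:
  "compatible T \<Longrightarrow> T (a @ j # i # b) = T (a @ i # j # b) + (\<Sum>s\<in>G. const (K s (ax j) (ax i)) * mext (\<lambda>v. T (a @ v)) (act s b))"
  unfolding compatible_def by (metis diff_add_cancel add.commute)

lemma word_induct [case_names sorted descent]: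
  assumes "\<And>w. sorted (map idx w) \<Longrightarrow> P w"
    and "\<And>a j i b. P (a @ i # j # b) \<Longrightarrow> (\<And>v. length v < length (a @ j # i # b) \<Longrightarrow> P v) \<Longrightarrow> P (a @ j # i # b)"
  shows "P w"
proof (induction w rule: wf_induct_rule[OF wf_measures[of "[length, inversions]"]])
  case (1 w)
  show ?case
  proof (cases "sorted (map idx w)")
    case False
    then obtain a j i b where w: "w = a @ j # i # b" "idx i < idx j" using descent_exists by blast
    show ?thesis unfolding w(1)
      by (rule assms(2); rule 1) (use w inversions_swap in auto)
  qed (rule assms(1))
qed

section \<open>Sorted words as monomials, and functions determined by them\<close>

definition normal_word :: "expo \<Rightarrow> 'n list" where
  "normal_word m = (SOME w. sorted (map idx w) \<and> word_expo w = m)"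

lemma word_expo_Nil [simp]: "word_expo [] = 0"
  by (simp add: word_expo_def)

lemma word_expo_append: "word_expo (u @ v) = word_expo u + word_expo v"
  by (simp add: word_expo_def)

lemma monomial_append: "monomial (u @ v) = monomial u * monomial v"
  by (simp add: word_expo_append mult_single)

lemma lookup_word_expo_0: "Poly_Mapping.lookup (word_expo w) 0 = length w"
  by (induction w) (simp_all add: word_expo_def lookup_add lookup_single)

lemma lookup_word_expo_Suc: "Poly_Mapping.lookup (word_expo w) (Suc (idx j)) = count (mset w) j"
  by (induction w) (auto simp: word_expo_def lookup_add lookup_single when_def dest: injD[OF inj_idx])

lemma word_expo_eq_iff: "word_expo u = word_expo v \<longleftrightarrow> mset u = mset v"
proof
  assume "word_expo u = word_expo v"
  then show "mset u = mset v"
    by (intro multiset_eqI) (metis lookup_word_expo_Suc)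
next
  have m: "word_expo w = sum_mset (image_mset (\<lambda>j. Poly_Mapping.single 0 1 + Poly_Mapping.single (Suc (idx j)) 1) (mset w))" for w
    by (induction w) (simp_all add: word_expo_def)
  assume "mset u = mset v"
  then show "word_expo u = word_expo v" by (simp add: m)
qed

lemma normal_word_word_expo:
  assumes "sorted (map idx w)"
  shows "normal_word (word_expo w) = w"
  unfolding normal_word_def
proof (rule some_equality)
  fix v assume v: "sorted (map idx v) \<and> word_expo v = word_expo w"
  then have "mset v = mset w" by (simp add: word_expo_eq_iff)
  then have "mset (map idx v) = mset (map idx w)" by simp
  then have "map idx v = map idx w"
    using v assms by (metis properties_for_sort)
  then show "v = w" using inj_idx by (simp add: inj_map_eq_map)
qed (use assms in simp)

lemma word_expo_normal_word: "word_expo (normal_word (word_expo w)) = word_expo w"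
proof -
  define v where "v = sort_key idx w"
  have "word_expo v = word_expo w" by (simp add: word_expo_eq_iff v_def)
  moreover have "sorted (map idx v)" by (simp add: v_def)
  ultimately show ?thesis using normal_word_word_expo[of v] by metis
qed

lemma length_normal_word: "length (normal_word (word_expo w)) = length w"
  by (metis lookup_word_expo_0 word_expo_normal_word)

definition from_normal :: "('n list \<Rightarrow> cpoly) \<Rightarrow> cpoly \<Rightarrow> cpoly" where
  "from_normal T q = (\<Sum>m\<in>support q. const (coeff_of q m) * T (normal_word m))"

lemma from_normal_superset:
  "finite S \<Longrightarrow> support q \<subseteq> S \<Longrightarrow> from_normal T q = (\<Sum>m\<in>S. const (coeff_of q m) * T (normal_word m))"
  unfolding from_normal_def by (rule sum.mono_neutral_left) (auto simp: in_keys_iff)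

lemma from_normal_0 [simp]: "from_normal T 0 = 0"
  by (simp add: from_normal_def)

lemma from_normal_add: "from_normal T (p + q) = from_normal T p + from_normal T q"
proof -
  let ?S = "support p \<union> support q"
  have "from_normal T (p + q) = (\<Sum>m\<in>?S. const (coeff_of (p + q) m) * T (normal_word m))"
    by (rule from_normal_superset) (use keys_add[of p q] in auto)
  also have "\<dots> = from_normal T p + from_normal T q"
    by (subst (1 2) from_normal_superset[of ?S]) (auto simp: lookup_add const_add distrib_right sum.distrib)
  finally show ?thesis .
qed

lemma from_normal_const_mult: "from_normal T (const c * q) = const c * from_normal T q"
proof -
  have "from_normal T (const c * q) = (\<Sum>m\<in>support q. const (coeff_of (const c * q) m) * T (normal_word m))"
    by (rule from_normal_superset) (use support_const_mult in auto)
  then show ?thesis by (simp add: from_normal_def sum_distrib_left const_mult mult.assoc)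
qed

lemma from_normal_sum: "from_normal T (sum f A) = (\<Sum>x\<in>A. from_normal T (f x))"
  by (induction A rule: infinite_finite_induct) (simp_all add: from_normal_add)

lemma from_normal_mext: "from_normal T (mext F vs) = mext (\<lambda>u. from_normal T (F u)) vs"
  by (induction vs arbitrary: F) (simp_all add: from_normal_sum from_normal_const_mult)

text \<open>Both sides obey the same rewriting rule, since \<open>NF\<close> is compatible itself,
  and they agree on sorted words. So \<open>NF\<close> is universal: every compatible function is a
  linear image of it.\<close>

lemma from_normal_NF:
  assumes "compatible T"
  shows "T u = from_normal T (NF u)"
proof (induction u rule: word_induct)
  case (sorted w)
  then show ?case by (simp add: NF_sorted from_normal_def normal_word_word_expo)
next
  case (descent a j i b)
  have "mext (\<lambda>v. T (a @ v)) (act s b) = mext (\<lambda>v. from_normal T (NF (a @ v))) (act s b)" for s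
    by (rule mext_cong_length) (use descent(2) in auto)
  then show ?case
    unfolding compatible_vectors_descent[OF assms, of a j i b] compatible_vectors_descent[OF compatible_NF, of a j i b]
    using descent(1)
    by (simp add: from_normal_add from_normal_sum from_normal_const_mult from_normal_mext)
qed

text \<open>The bound is strict, so that what remains after splitting off the part of degree
  \<open>n\<close> lies in \<open>expos n\<close>.\<close>

definition expos :: "nat \<Rightarrow> expo set" where
  "expos n = word_expo ` {w. length w < n}"

lemma expos_mono: "m \<le> n \<Longrightarrow> expos m \<subseteq> expos n"
  by (auto simp: expos_def)

text \<open>An exchange does not change the commutative monomial, and each correction is two letters
  shorter. In top degree, words therefore multiply like commuting variables.\<close>

lemma NF_top: "NF w - monomial w \<in> supported (expos (length w))"
proof (induction w rule: word_induct)
  case (sorted w)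
  then show ?case by (simp add: NF_sorted)
next
  case (descent a j i b)
  let ?n = "length (a @ j # i # b)"
  have "NF v \<in> supported (expos ?n)" if "length v < ?n" for v
  proof -
    have "NF v - monomial v \<in> supported (expos ?n)"
      using descent(2)[OF that] expos_mono[of "length v" ?n] that by (auto intro: supported_mono)
    moreover have "monomial v \<in> supported (expos ?n)" using that by (simp add: supported_def expos_def)
    ultimately show ?thesis using supported_add by fastforce
  qed
  then have S: "(\<Sum>s\<in>G. const (K s (ax j) (ax i)) * mext (\<lambda>v. NF (a @ v)) (act s b)) \<in> supported (expos ?n)"
    (is "?S \<in> _")
    by (intro supported_sum supported_const_mult mext_supported) auto
  have "word_expo (a @ i # j # b) = word_expo (a @ j # i # b)"
    by (simp add: word_expo_eq_iff)
  then have "NF (a @ j # i # b) - monomial (a @ j # i # b) = (NF (a @ i # j # b) - monomial (a @ i # j # b)) + ?S"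
    unfolding compatible_vectors_descent[OF compatible_NF, of a j i b] by simp
  then show ?case using supported_add[OF _ S] descent(1) by simp
qed

lemma NF_supported: "NF w \<in> supported (expos (Suc (length w)))"
proof -
  have "NF w - monomial w \<in> supported (expos (Suc (length w)))"
    using NF_top expos_mono[of "length w" "Suc (length w)"] by (auto intro: supported_mono)
  moreover have "monomial w \<in> supported (expos (Suc (length w)))" by (simp add: supported_def expos_def)
  ultimately show ?thesis using supported_add by fastforce
qed

definition linear_form :: "complex^'n \<Rightarrow> cpoly" where
  "linear_form v = (\<Sum>i\<in>UNIV. const (v $ i) * monomial [i])"

lemma mext_monomial: "mext monomial vs = (\<Prod>v\<leftarrow>vs. linear_form v)"
proof (induction vs)
  case (Cons v vs)
  have "mext (\<lambda>u. monomial (i # u)) vs = monomial [i] * mext monomial vs" for i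
  proof -
    have "monomial (i # u) = monomial [i] * monomial u" for u
      using monomial_append[of "[i]" u] by simp
    then have "(\<lambda>u. monomial (i # u)) = (\<lambda>u. monomial [i] * monomial u)" by blast
    then show ?thesis by (simp only: mext_mult)
  qed
  then show ?case by (simp add: Cons linear_form_def sum_distrib_right mult.assoc)
qed simp

end

section \<open>The skew group ring\<close>

definition csc :: "complex \<Rightarrow> ('a \<Rightarrow> complex) \<Rightarrow> 'a \<Rightarrow> complex" where
  "csc z f = (\<lambda>p. z * f p)"

lemma csc_apply [simp]: "csc z f p = z * f p"
  by (simp add: csc_def)

interpretation cvec: vector_space "csc :: complex \<Rightarrow> ('a \<Rightarrow> complex) \<Rightarrow> 'a \<Rightarrow> complex"
  by unfold_locales (auto simp: fun_eq_iff algebra_simps)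

lemma sum_fun_apply: "(\<Sum>i\<in>A. f i) p = (\<Sum>i\<in>A. f i p :: complex)"
  by (induction A rule: infinite_finite_induct) auto

lemma linear_combination_eq: "(\<lambda>p. \<Sum>f\<in>F. c f * h f p) = (\<Sum>f\<in>F. csc (c f) (h f))"
  by (simp add: fun_eq_iff sum_fun_apply)

lemma cspan_eq_span: "cspan X = cvec.span X"
  unfolding cspan_def cvec.span_explicit linear_combination_eq by blast

abbreviation finite_supp :: "('a \<Rightarrow> complex) \<Rightarrow> bool" where
  "finite_supp a \<equiv> finite {p. a p \<noteq> 0}"

lemma finite_supp_add: "finite_supp a \<Longrightarrow> finite_supp b \<Longrightarrow> finite_supp (a + b)"
  by (rule finite_subset[of _ "{p. a p \<noteq> 0} \<union> {p. b p \<noteq> 0}"]) auto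

lemma finite_supp_csc: "finite_supp a \<Longrightarrow> finite_supp (csc z a)"
  by (rule finite_subset[of _ "{p. a p \<noteq> 0}"]) auto

text \<open>The linear map with values \<open>\<Psi>\<close> on the basis, applied to
  \<open>a\<close>. An element is determined by all its pairings, and comparing products through
  them keeps the \<open>take\<close> and \<open>drop\<close> of \<open>sk_mult\<close> out of later
  computations.\<close>

definition pairing :: "('a \<Rightarrow> complex) \<Rightarrow> ('a \<Rightarrow> cpoly) \<Rightarrow> cpoly" where
  "pairing a \<Psi> = (\<Sum>p | a p \<noteq> 0. const (a p) * \<Psi> p)"

lemma pairing_superset:
  "finite S \<Longrightarrow> {p. a p \<noteq> 0} \<subseteq> S \<Longrightarrow> pairing a \<Psi> = (\<Sum>p\<in>S. const (a p) * \<Psi> p)"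
  unfolding pairing_def by (rule sum.mono_neutral_left) auto

lemma pairing_0 [simp]: "pairing 0 \<Psi> = 0"
  by (simp add: pairing_def)

lemma pairing_add:
  assumes "finite_supp a" "finite_supp b"
  shows "pairing (a + b) \<Psi> = pairing a \<Psi> + pairing b \<Psi>"
proof -
  let ?S = "{p. a p \<noteq> 0} \<union> {p. b p \<noteq> 0}"
  have "finite ?S" using assms by simp
  then show ?thesis
    by (subst (1 2 3) pairing_superset[of ?S]) (auto simp: const_add distrib_right sum.distrib)
qed

lemma pairing_csc:
  assumes "finite_supp a"
  shows "pairing (csc z a) \<Psi> = const z * pairing a \<Psi>"
proof -
  have "pairing (csc z a) \<Psi> = (\<Sum>p | a p \<noteq> 0. const (csc z a p) * \<Psi> p)"
    by (rule pairing_superset) (use assms in auto)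
  then show ?thesis by (simp add: pairing_def sum_distrib_left const_mult mult.assoc)
qed

lemma pairing_diff:
  assumes "finite_supp a" "finite_supp b"
  shows "pairing (a - b) \<Psi> = pairing a \<Psi> - pairing b \<Psi>"
proof -
  have e: "a - b = a + csc (-1) b" by (simp add: fun_eq_iff)
  show ?thesis unfolding e
    using assms by (subst pairing_add) (simp_all only: finite_supp_csc pairing_csc, simp add: const_uminus)
qed

lemma pairing_sum:
  "(\<And>i. i \<in> A \<Longrightarrow> finite_supp (f i)) \<Longrightarrow> pairing (\<Sum>i\<in>A. f i) \<Psi> = (\<Sum>i\<in>A. pairing (f i) \<Psi>)
    \<and> finite_supp (\<Sum>i\<in>A. f i)"
proof (induction A rule: infinite_finite_induct)
  case (insert x A)
  then have h: "finite_supp (f x)" "finite_supp (\<Sum>i\<in>A. f i)" and ih: "pairing (\<Sum>i\<in>A. f i) \<Psi> = (\<Sum>i\<in>A. pairing (f i) \<Psi>)"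
    by blast+
  have "pairing (f x + sum f A) \<Psi> = pairing (f x) \<Psi> + (\<Sum>i\<in>A. pairing (f i) \<Psi>)"
    unfolding pairing_add[OF h] ih by (rule refl)
  with finite_supp_add[OF h] show ?case
    unfolding sum.insert[OF insert.hyps(1,2)] by blast
qed simp_all

lemma pairing_fun_mult: "pairing a (\<lambda>p. c * \<Psi> p) = c * pairing a \<Psi>"
  by (simp add: pairing_def sum_distrib_left mult.left_commute)

lemma pairing_fun_sum: "pairing a (\<lambda>p. \<Sum>i\<in>A. \<Psi> i p) = (\<Sum>i\<in>A. pairing a (\<Psi> i))"
  by (simp add: pairing_def sum_distrib_left sum.swap[of _ A])

lemma pairing_fun_diff: "pairing a (\<lambda>p. \<Psi> p - \<Theta> p) = pairing a \<Psi> - pairing a \<Theta>"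
  by (simp add: pairing_def right_diff_distrib sum_subtractf)

lemma pairing_fun_add: "pairing a (\<lambda>p. \<Psi> p + \<Theta> p) = pairing a \<Psi> + pairing a \<Theta>"
  by (simp add: pairing_def distrib_left sum.distrib)

lemma pairing_mext: "pairing a (\<lambda>p. mext (F p) vs) = mext (\<lambda>u. pairing a (\<lambda>p. F p u)) vs"
  by (induction vs arbitrary: F) (simp_all add: pairing_fun_sum pairing_fun_mult)

lemma pairing_supported:
  "(\<And>p. a p \<noteq> 0 \<Longrightarrow> \<Psi> p \<in> supported E) \<Longrightarrow> pairing a \<Psi> \<in> supported E"
  unfolding pairing_def by (intro supported_sum supported_const_mult) simp

lemma pairing_cong: "(\<And>p. a p \<noteq> 0 \<Longrightarrow> \<Psi> p = \<Theta> p) \<Longrightarrow> pairing a \<Psi> = pairing a \<Theta>"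
  unfolding pairing_def by (rule sum.cong) simp_all

lemma pairing_delta: "finite_supp a \<Longrightarrow> pairing a (\<lambda>q. if q = p then 1 else 0) = const (a p)"
  by (simp add: pairing_def if_distrib sum.delta cong: if_cong)

lemma pairing_eqI:
  assumes "finite_supp a" "finite_supp b" "\<And>\<Psi>. pairing a \<Psi> = pairing b \<Psi>"
  shows "a = b"
proof
  fix p
  have "const (a p) = const (b p)"
    using pairing_delta[OF assms(1), of p] pairing_delta[OF assms(2), of p] assms(3) by simp
  then show "a p = b p" by simp
qed

lemma finite_supp_sk_basis [simp]: "finite_supp (sk_basis w g)"
  by (simp add: sk_basis_def)

lemma pairing_sk_basis [simp]: "pairing (sk_basis w g) \<Psi> = \<Psi> (w, g)"
  by (simp add: pairing_def sk_basis_def)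

lemma matrix_mult_axis: "(g *v ax j) $ i = g $ i $ (j :: 'n::finite)" for g :: "complex^'n^'n"
  by (simp add: matrix_vector_mult_def axis_def if_distrib cong: if_cong)

text \<open>Here the coefficient formula of \<open>sk_mult\<close> becomes the rule
  \<open>(w g)(u h) = w g(u) (g h)\<close>. Finiteness is proved along with it, since the finite set
  \<open>S\<close> that bounds the support also carries the sum.\<close>

lemma pairing_mult_aux:
  fixes a b :: "'n::finite sk"
  assumes "finite_supp a" "finite_supp b"
  shows "finite_supp (sk_mult a b) \<and> pairing (sk_mult a b) \<Psi>
    = pairing a (\<lambda>(w, g). pairing b (\<lambda>(u, h). mext (\<lambda>z. \<Psi> (w @ z, g ** h)) (act g u)))"
proof -
  define words where "words m = {v :: 'n list. length v = m}" for m
  have fw: "finite (words m)" for m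
    unfolding words_def using finite_lists_length_eq[of "UNIV :: 'n set" m] by simp
  define blk where "blk p q = (\<lambda>v. (fst p @ v, snd p ** snd q)) ` words (length (fst q))"
    for p q :: "'n list \<times> (complex^'n^'n)"
  define S where "S = (\<Union>p\<in>{p. a p \<noteq> 0}. \<Union>q\<in>{q. b q \<noteq> 0}. blk p q)"
  have finS: "finite S" unfolding S_def blk_def using assms fw by blast
  \<comment> \<open>The contribution of one pair of basis elements to a coefficient of the product;
    it is supported on \<open>blk p q\<close>.\<close>
  define trm where "trm p q = (\<lambda>(z, k). if snd p ** snd q = k \<and> length z = length (fst p) + length (fst q)
         \<and> take (length (fst p)) z = fst p
      then a p * b q * (\<Prod>l<length (fst q). snd p $ (drop (length (fst p)) z ! l) $ (fst q ! l))
      else 0)" for p q :: "'n list \<times> (complex^'n^'n)"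
  have mult: "sk_mult a b x = (\<Sum>p | a p \<noteq> 0. \<Sum>q | b q \<noteq> 0. trm p q x)" for x
    by (cases x) (simp add: sk_mult_def trm_def)
  have trm0: "trm p q x = 0" if "x \<notin> blk p q" for p q x
  proof (rule ccontr)
    assume n: "trm p q x \<noteq> 0"
    obtain z k where x: "x = (z, k)" by (cases x)
    have "snd p ** snd q = k" "length z = length (fst p) + length (fst q)" "take (length (fst p)) z = fst p"
      using n by (auto simp: trm_def x split: if_splits)
    then have "x = (fst p @ drop (length (fst p)) z, snd p ** snd q)"
      "drop (length (fst p)) z \<in> words (length (fst q))"
      unfolding x words_def by (metis append_take_drop_id, simp)
    then show False using that unfolding blk_def by blast
  qed
  have sup: "{x. sk_mult a b x \<noteq> 0} \<subseteq> S"
  proof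
    fix x assume "x \<in> {x. sk_mult a b x \<noteq> 0}"
    then have "(\<Sum>p | a p \<noteq> 0. \<Sum>q | b q \<noteq> 0. trm p q x) \<noteq> 0" by (simp add: mult)
    then obtain p where "a p \<noteq> 0" "(\<Sum>q | b q \<noteq> 0. trm p q x) \<noteq> 0"
      by (metis (mono_tags, lifting) mem_Collect_eq sum.neutral)
    moreover then obtain q where "b q \<noteq> 0" "trm p q x \<noteq> 0"
      by (metis (mono_tags, lifting) mem_Collect_eq sum.neutral)
    ultimately show "x \<in> S" using trm0 unfolding S_def by blast
  qed
  have blk: "(\<Sum>x\<in>S. const (trm p q x) * \<Psi> x)
      = const (a p) * (const (b q) * mext (\<lambda>z. \<Psi> (fst p @ z, snd p ** snd q)) (act (snd p) (fst q)))"
    if "a p \<noteq> 0" "b q \<noteq> 0" for p q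
  proof -
    have "(\<Sum>x\<in>S. const (trm p q x) * \<Psi> x) = (\<Sum>x\<in>blk p q. const (trm p q x) * \<Psi> x)"
      by (rule sum.mono_neutral_right[OF finS]) (use that trm0 in \<open>auto simp: S_def\<close>)
    also have "\<dots> = (\<Sum>v\<in>words (length (fst q)).
        const (trm p q (fst p @ v, snd p ** snd q)) * \<Psi> (fst p @ v, snd p ** snd q))"
      unfolding blk_def by (subst sum.reindex) (auto simp: inj_on_def)
    also have "\<dots> = (\<Sum>v\<in>words (length (fst q)). const (a p) * (const (b q) *
        (const (\<Prod>l<length (fst q). act (snd p) (fst q) ! l $ (v ! l)) * \<Psi> (fst p @ v, snd p ** snd q))))"
      by (rule sum.cong) (auto simp: words_def trm_def const_mult mult.assoc matrix_mult_axis)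
    finally show ?thesis
      by (subst mext_explicit) (simp add: sum_distrib_left words_def)
  qed
  have "pairing (sk_mult a b) \<Psi> = (\<Sum>x\<in>S. const (sk_mult a b x) * \<Psi> x)"
    by (rule pairing_superset[OF finS sup])
  also have "\<dots> = (\<Sum>p | a p \<noteq> 0. \<Sum>q | b q \<noteq> 0. \<Sum>x\<in>S. const (trm p q x) * \<Psi> x)"
    unfolding mult const_sum sum_distrib_right
    by (simp add: sum.swap[where A = S])
  also have "\<dots> = (\<Sum>p | a p \<noteq> 0. \<Sum>q | b q \<noteq> 0. const (a p) * (const (b q) *
      mext (\<lambda>z. \<Psi> (fst p @ z, snd p ** snd q)) (act (snd p) (fst q))))"
    using blk by (intro sum.cong refl) auto
  also have "\<dots> = pairing a (\<lambda>(w, g). pairing b (\<lambda>(u, h). mext (\<lambda>z. \<Psi> (w @ z, g ** h)) (act g u)))"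
    by (simp add: pairing_def case_prod_unfold sum_distrib_left)
  finally show ?thesis using finite_subset[OF sup finS] by blast
qed

lemmas finite_supp_mult = pairing_mult_aux[THEN conjunct1]
lemmas pairing_mult = pairing_mult_aux[THEN conjunct2]

text \<open>On basis elements this is \<open>g(u h(v)) = g(u) (g h)(v)\<close>; the letters of
  \<open>h(v)\<close> and those of \<open>g(u)\<close> may be summed in either order by
  \<open>mext_commute\<close>.\<close>

lemma sk_mult_assoc:
  fixes a b c :: "'n::finite sk"
  assumes "finite_supp a" "finite_supp b" "finite_supp c"
  shows "sk_mult (sk_mult a b) c = sk_mult a (sk_mult b c)"
proof (rule pairing_eqI)
  fix \<Psi> :: "'n list \<times> (complex^'n^'n) \<Rightarrow> cpoly"
  have "mext (\<lambda>z. mext (\<lambda>z'. \<Psi> ((w @ z) @ z', (g ** h) ** k)) (act (g ** h) v)) (act g u)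
      = mext (\<lambda>z'. mext (\<lambda>z. \<Psi> (w @ z, g ** (h ** k))) (act g (u @ z'))) (act h v)" for w u v g h k
  proof -
    have "mext (\<lambda>z'. mext (\<lambda>z. \<Psi> (w @ z, g ** (h ** k))) (act g (u @ z'))) (act h v)
       = mext (\<lambda>z. mext (\<lambda>z'. mext (\<lambda>z''. \<Psi> (w @ z @ z'', g ** (h ** k))) (act g z')) (act h v)) (act g u)"
      by (simp add: mext_append) (rule mext_commute)
    also have "\<dots> = mext (\<lambda>z. mext (\<lambda>z''. \<Psi> (w @ z @ z'', g ** (h ** k))) (map ((*v) g) (act h v))) (act g u)"
      using mext_mext_act[of _ "[]" g "[]" "act h v"] by simp
    finally show ?thesis by (simp add: o_def matrix_vector_mul_assoc matrix_mul_assoc)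
  qed
  then show "pairing (sk_mult (sk_mult a b) c) \<Psi> = pairing (sk_mult a (sk_mult b c)) \<Psi>"
    by (simp add: pairing_mult finite_supp_mult assms case_prod_unfold pairing_mext[symmetric])
qed (simp_all add: finite_supp_mult assms)

context
  fixes a b c :: "'n::finite sk"
  assumes fin: "finite_supp a" "finite_supp b" "finite_supp c"
begin

lemma sk_mult_add_left: "sk_mult (a + b) c = sk_mult a c + sk_mult b c"
  by (rule pairing_eqI) (simp_all only: finite_supp_mult finite_supp_add fin pairing_mult pairing_add)

lemma sk_mult_add_right: "sk_mult c (a + b) = sk_mult c a + sk_mult c b"
  by (rule pairing_eqI)
    (simp_all only: finite_supp_mult finite_supp_add fin pairing_mult pairing_add pairing_fun_add[symmetric] case_prod_unfold)

lemma sk_mult_csc_left: "sk_mult (csc z a) c = csc z (sk_mult a c)"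
  by (rule pairing_eqI) (simp_all only: finite_supp_mult finite_supp_csc fin pairing_mult pairing_csc)

lemma sk_mult_csc_right: "sk_mult c (csc z a) = csc z (sk_mult c a)"
  by (rule pairing_eqI)
    (simp_all only: finite_supp_mult finite_supp_csc fin pairing_mult pairing_csc pairing_fun_mult[symmetric] case_prod_unfold)

end

lemma sk_mult_0_left [simp]: "sk_mult 0 a = 0" and sk_mult_0_right [simp]: "sk_mult a 0 = 0"
  by (simp_all add: sk_mult_def fun_eq_iff)

lemma mult_left_span:
  assumes "\<And>x. x \<in> X \<Longrightarrow> finite_supp x" "finite_supp a" "\<And>x. x \<in> X \<Longrightarrow> sk_mult a x \<in> S" "cvec.subspace S"
    and "y \<in> cvec.span X"
  shows "sk_mult a y \<in> S"
proof -
  have "cvec.subspace {x. finite_supp x \<and> sk_mult a x \<in> S}"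
    unfolding cvec.subspace_def
    using assms(2,4) by (auto simp: sk_mult_add_right sk_mult_csc_right finite_supp_add finite_supp_csc cvec.subspace_add
      cvec.subspace_scale cvec.subspace_0 simp del: plus_fun_apply csc_apply)
  moreover have "X \<subseteq> {x. finite_supp x \<and> sk_mult a x \<in> S}" using assms by blast
  ultimately show ?thesis using cvec.span_minimal assms(5) by blast
qed

lemma mult_right_span:
  assumes "\<And>x. x \<in> X \<Longrightarrow> finite_supp x" "finite_supp a" "\<And>x. x \<in> X \<Longrightarrow> sk_mult x a \<in> S" "cvec.subspace S"
    and "y \<in> cvec.span X"
  shows "sk_mult y a \<in> S"
proof -
  have "cvec.subspace {x. finite_supp x \<and> sk_mult x a \<in> S}"
    unfolding cvec.subspace_def
    using assms(2,4) by (auto simp: sk_mult_add_left sk_mult_csc_left finite_supp_add finite_supp_csc cvec.subspace_add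
      cvec.subspace_scale cvec.subspace_0 simp del: plus_fun_apply csc_apply)
  moreover have "X \<subseteq> {x. finite_supp x \<and> sk_mult x a \<in> S}" using assms by blast
  ultimately show ?thesis using cvec.span_minimal assms(5) by blast
qed

lemma skel_finite_supp: "skel G a \<Longrightarrow> finite_supp a"
  by (simp add: skel_def)

lemma subspace_skel: "cvec.subspace {a. skel G a}"
proof -
  have "skel G (a + b)" if "skel G a" "skel G b" for a b
    unfolding skel_def
  proof (intro conjI allI impI)
    fix p assume "(a + b) p \<noteq> 0"
    then have "a p \<noteq> 0 \<or> b p \<noteq> 0" by auto
    then show "snd p \<in> G" using that unfolding skel_def by blast
  qed (use that finite_supp_add[of a b] in \<open>simp add: skel_def\<close>)
  moreover have "skel G (csc z a)" if "skel G a" for z a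
    unfolding skel_def
  proof (intro conjI allI impI)
    fix p assume "csc z a p \<noteq> 0"
    then have "a p \<noteq> 0" by auto
    then show "snd p \<in> G" using that unfolding skel_def by blast
  qed (use that finite_supp_csc[of a z] in \<open>simp add: skel_def\<close>)
  moreover have "skel G 0" by (simp add: skel_def)
  ultimately show ?thesis unfolding cvec.subspace_def by blast
qed

lemma skel_sk_basis: "g \<in> G \<Longrightarrow> skel G (sk_basis w g)"
  by (simp add: skel_def) (simp add: sk_basis_def)

lemma skel_mult:
  assumes "skel G a" "skel G b" "\<And>g h. g \<in> G \<Longrightarrow> h \<in> G \<Longrightarrow> g ** h \<in> G"
  shows "skel G (sk_mult a b)"
proof -
  have "snd x \<in> G" if "sk_mult a b x \<noteq> 0" for x
  proof (rule ccontr)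
    assume n: "snd x \<notin> G"
    \<comment> \<open>Pairing with the indicator of \<open>x\<close> reads off the coefficient at
      \<open>x\<close>.\<close>
    have "const (sk_mult a b x) = pairing (sk_mult a b) (\<lambda>q. if q = x then 1 else 0)"
      using assms by (subst pairing_delta) (auto intro: finite_supp_mult skel_finite_supp)
    also have "\<dots> = pairing a (\<lambda>(w, g). pairing b (\<lambda>(u, h). mext (\<lambda>z. if (w @ z, g ** h) = x then 1 else 0) (act g u)))"
      using assms by (subst pairing_mult) (auto intro: skel_finite_supp)
    also have "\<dots> = 0"
      unfolding pairing_def case_prod_unfold
    proof (intro sum.neutral ballI)
      fix r assume "r \<in> {p. a p \<noteq> 0}"
      then have "snd r \<in> G" using assms(1) by (cases r) (auto simp: skel_def)
      have "const (b p) * mext (\<lambda>z. if (fst r @ z, snd r ** snd p) = x then 1 else 0) (act (snd r) (fst p)) = 0"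
        if "p \<in> {p. b p \<noteq> 0}" for p
      proof -
        have "snd p \<in> G" using that assms(2) by (cases p) (auto simp: skel_def)
        then have "(fst r @ z, snd r ** snd p) \<noteq> x" for z using assms(3) \<open>snd r \<in> G\<close> n by auto
        then show ?thesis by simp
      qed
      then have "(\<Sum>p | b p \<noteq> 0. const (b p) *
          mext (\<lambda>z. if (fst r @ z, snd r ** snd p) = x then 1 else 0) (act (snd r) (fst p))) = 0"
        by (intro sum.neutral ballI)
      then show "const (a r) * (\<Sum>p | b p \<noteq> 0. const (b p) *
          mext (\<lambda>z. if (fst r @ z, snd r ** snd p) = x then 1 else 0) (act (snd r) (fst p))) = 0"
        by (simp only: mult_zero_right)
    qed
    finally show False using that by (metis const_0 const_inject)
  qed
  then show ?thesis
    using finite_supp_mult[of a b] assms by (auto simp: skel_def)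
qed

text \<open>Turns membership in the ideal into a question about functionals vanishing on it; these
  are functions on words, to which the uniqueness of normal forms applies.\<close>

lemma separating_functional:
  fixes I :: "('a \<Rightarrow> complex) set"
  assumes "cvec.subspace I" "x \<notin> I"
  obtains f where "Vector_Spaces.linear csc (*) f" "\<And>y. y \<in> I \<Longrightarrow> f y = 0" "f x = (1::complex)"
proof -
  interpret C: vector_space "(*) :: complex \<Rightarrow> complex \<Rightarrow> complex"
    by unfold_locales (auto simp: algebra_simps)
  interpret VP: vector_space_pair "csc :: complex \<Rightarrow> ('a \<Rightarrow> complex) \<Rightarrow> _" "(*) :: complex \<Rightarrow> complex \<Rightarrow> complex" ..
  obtain B where B: "B \<subseteq> I" "cvec.independent B" "I \<subseteq> cvec.span B"
    using cvec.maximal_independent_subset by blast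
  have x: "x \<notin> cvec.span B" using B assms cvec.span_minimal by blast
  then have ind: "cvec.independent (insert x B)"
    using B(2) cvec.span_superset by (auto simp: cvec.independent_insert)
  obtain f where f: "Vector_Spaces.linear csc (*) f" "\<forall>b\<in>insert x B. f b = (if b = x then 1 else 0)"
    using VP.linear_independent_extend[OF ind, of "\<lambda>b. if b = x then 1 else 0"] by blast
  interpret f: Vector_Spaces.linear csc "(*)" f by (fact f(1))
  have "cvec.subspace {y. f y = 0}"
    unfolding cvec.subspace_def by (auto simp: f.add f.scale f.zero simp del: plus_fun_apply csc_apply)
  moreover have "B \<subseteq> {y. f y = 0}" using f(2) x cvec.span_superset by force
  ultimately have "cvec.span B \<subseteq> {y. f y = 0}" using cvec.span_minimal by blast
  then show ?thesis using that[OF f(1)] f(2) B(3) by auto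
qed

section \<open>The deformed algebra and its spherical subalgebra\<close>

definition tensor :: "(complex^'n::finite) list \<Rightarrow> 'n sk" where
  "tensor vs = (\<lambda>(w, g). if g = mat 1 \<and> length w = length vs then \<Prod>l<length vs. vs ! l $ (w ! l) else 0)"

lemma tensor_pairing_aux:
  fixes vs :: "(complex^'n::finite) list"
  shows "finite_supp (tensor vs) \<and> pairing (tensor vs) \<Psi> = mext (\<lambda>w. \<Psi> (w, mat 1)) vs"
proof -
  let ?W = "{w :: 'n list. length w = length vs}"
  let ?S = "(\<lambda>w. (w, mat 1 :: complex^'n^'n)) ` ?W"
  have fin: "finite ?S" using finite_lists_length_eq[of "UNIV :: 'n set"] by simp
  have sup: "{p. tensor vs p \<noteq> 0} \<subseteq> ?S" by (auto simp: tensor_def split: if_splits)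
  have "pairing (tensor vs) \<Psi> = (\<Sum>p\<in>?S. const (tensor vs p) * \<Psi> p)"
    by (rule pairing_superset[OF fin sup])
  also have "\<dots> = mext (\<lambda>w. \<Psi> (w, mat 1)) vs"
    unfolding mext_explicit by (subst sum.reindex) (auto simp: inj_on_def tensor_def intro!: sum.cong)
  finally show ?thesis using finite_subset[OF sup fin] by blast
qed

lemmas finite_supp_tensor = tensor_pairing_aux[THEN conjunct1]
lemmas pairing_tensor = tensor_pairing_aux[THEN conjunct2]

lemma act_one [simp]: "act (mat 1) u = map ax u"
  by simp

lemma finite_supp_diff: "finite_supp a \<Longrightarrow> finite_supp b \<Longrightarrow> finite_supp (a - b)"
  by (rule finite_subset[of _ "{p. a p \<noteq> 0} \<union> {p. b p \<noteq> 0}"]) auto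

context deformed_commutation
begin

section \<open>The ideal of relations and the module of normal forms\<close>

definition relator :: "'n \<Rightarrow> 'n \<Rightarrow> 'n sk" where
  "relator i j = sk_basis [i, j] (mat 1) - sk_basis [j, i] (mat 1)
     - (\<Sum>s\<in>G. csc (K s (ax i) (ax j)) (sk_basis [] s))"

lemma finite_supp_relator_sum: "finite_supp (\<Sum>s\<in>G. csc (K s (ax i) (ax j)) (sk_basis [] s))"
  using pairing_sum[of G "\<lambda>s. csc (K s (ax i) (ax j)) (sk_basis [] s)"] finite_supp_csc[OF finite_supp_sk_basis] by blast

lemma pairing_relator:
  "pairing (relator i j) \<Psi> = \<Psi> ([i, j], mat 1) - \<Psi> ([j, i], mat 1) - (\<Sum>s\<in>G. const (K s (ax i) (ax j)) * \<Psi> ([], s))"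
proof -
  have "pairing (\<Sum>s\<in>G. csc (K s (ax i) (ax j)) (sk_basis [] s)) \<Psi>
      = (\<Sum>s\<in>G. pairing (csc (K s (ax i) (ax j)) (sk_basis [] s)) \<Psi>)"
    using pairing_sum[of G "\<lambda>s. csc (K s (ax i) (ax j)) (sk_basis [] s)"] finite_supp_csc[OF finite_supp_sk_basis] by blast
  moreover have "pairing (csc z (sk_basis [] s)) \<Psi> = const z * \<Psi> ([], s)" for z s
    by (simp add: pairing_csc del: csc_apply)
  ultimately show ?thesis
    unfolding relator_def
    by (subst pairing_diff[OF finite_supp_diff[OF finite_supp_sk_basis finite_supp_sk_basis] finite_supp_relator_sum],
        subst pairing_diff[OF finite_supp_sk_basis finite_supp_sk_basis]) simp
qed

lemma skel_relator: "skel G (relator i j)"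
proof -
  have "relator i j \<in> {a. skel G a}"
    unfolding relator_def
    by (intro cvec.subspace_diff[OF subspace_skel] cvec.subspace_sum[OF subspace_skel] cvec.subspace_scale[OF subspace_skel])
      (auto intro: skel_sk_basis one_G)
  then show ?thesis by simp
qed

lemma finite_supp_relator: "finite_supp (relator i j)"
  by (rule skel_finite_supp[OF skel_relator])

lemmas skel_multG = skel_mult[OF _ _ mult_G]

definition relator_ideal :: "'n sk set" where
  "relator_ideal = cvec.span {sk_mult (sk_mult a (relator i j)) b | a b i j. skel G a \<and> skel G b}"

lemma subspace_relator_ideal: "cvec.subspace relator_ideal"
  unfolding relator_ideal_def by (rule cvec.subspace_span)

lemma relator_ideal_skel: "x \<in> relator_ideal \<Longrightarrow> skel G x"
proof -
  have "relator_ideal \<subseteq> {a. skel G a}"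
    unfolding relator_ideal_def
    by (rule cvec.span_minimal[OF _ subspace_skel]) (auto intro: skel_multG skel_relator)
  then show "x \<in> relator_ideal \<Longrightarrow> skel G x" by blast
qed

lemma relator_in_ideal: "skel G a \<Longrightarrow> skel G b \<Longrightarrow> sk_mult (sk_mult a (relator i j)) b \<in> relator_ideal"
  unfolding relator_ideal_def by (rule cvec.span_base) blast

lemma relator_ideal_left:
  assumes "x \<in> relator_ideal" "skel G c"
  shows "sk_mult c x \<in> relator_ideal"
proof (rule mult_left_span[OF _ _ _ subspace_relator_ideal assms(1)[unfolded relator_ideal_def]])
  fix x assume "x \<in> {sk_mult (sk_mult a (relator i j)) b | a b i j. skel G a \<and> skel G b}"
  then obtain a b i j where x: "x = sk_mult (sk_mult a (relator i j)) b" "skel G a" "skel G b" by blast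
  then show "finite_supp x" by (auto intro!: skel_finite_supp[of G] skel_multG skel_relator)
  have "sk_mult c x = sk_mult (sk_mult (sk_mult c a) (relator i j)) b"
    by (simp only: x sk_mult_assoc finite_supp_mult finite_supp_relator skel_finite_supp[OF x(2)]
      skel_finite_supp[OF x(3)] skel_finite_supp[OF assms(2)])
  then show "sk_mult c x \<in> relator_ideal" using relator_in_ideal skel_multG x assms by metis
qed (rule skel_finite_supp[OF assms(2)])

lemma relator_ideal_right:
  assumes "x \<in> relator_ideal" "skel G c"
  shows "sk_mult x c \<in> relator_ideal"
proof (rule mult_right_span[OF _ _ _ subspace_relator_ideal assms(1)[unfolded relator_ideal_def]])
  fix x assume "x \<in> {sk_mult (sk_mult a (relator i j)) b | a b i j. skel G a \<and> skel G b}"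
  then obtain a b i j where x: "x = sk_mult (sk_mult a (relator i j)) b" "skel G a" "skel G b" by blast
  then show "finite_supp x" by (auto intro!: skel_finite_supp[of G] skel_multG skel_relator)
  have "sk_mult x c = sk_mult (sk_mult a (relator i j)) (sk_mult b c)"
    by (simp only: x sk_mult_assoc finite_supp_mult finite_supp_relator skel_finite_supp[OF x(2)]
      skel_finite_supp[OF x(3)] skel_finite_supp[OF assms(2)])
  then show "sk_mult x c \<in> relator_ideal" using relator_in_ideal skel_multG x assms by metis
qed (rule skel_finite_supp[OF assms(2)])

text \<open>The normal form of the image of an element in the left module induced from the trivial
  representation: group elements on the right act trivially.\<close>

definition nform :: "'n sk \<Rightarrow> cpoly" where
  "nform a = pairing a (\<lambda>(w, g). NF w)"

text \<open>Left multiplication by \<open>w g\<close> on the module, as a function of the word it is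
  applied to.\<close>

definition prefixed :: "'n list \<Rightarrow> complex^'n^'n \<Rightarrow> 'n list \<Rightarrow> cpoly" where
  "prefixed w g u = mext NF (map ax w @ act g u)"

lemma prefixed_one: "prefixed w (mat 1) u = NF (w @ u)"
  unfolding prefixed_def by (metis act_one map_append mext_axis)

lemma nform_mult_prefixed:
  "finite_supp a \<Longrightarrow> finite_supp b \<Longrightarrow> nform (sk_mult a b) = pairing a (\<lambda>(w, g). pairing b (\<lambda>(u, h). prefixed w g u))"
  by (simp add: nform_def pairing_mult prefixed_def mext_axis_append)

text \<open>Makes left multiplication well defined on normal forms. The relation between
  \<open>g x\<close> and \<open>g y\<close> produces group elements \<open>t g\<close> acting on the
  tail; \<open>conj_sum\<close> rewrites them as \<open>g t\<close>, which is the relation between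
  \<open>x\<close> and \<open>y\<close> multiplied by \<open>g\<close>.\<close>

lemma compatible_prefixed:
  assumes "g \<in> G"
  shows "compatible (prefixed w g)"
  unfolding compatible_def
proof (intro allI)
  fix a i j b
  have "prefixed w g (a @ i # j # b) - prefixed w g (a @ j # i # b)
      = reorder NF (map ax w @ act g a) (g *v ax i) (g *v ax j) (act g b)"
    using compatible_vectors[OF compatible_NF, of "map ax w @ act g a"] by (simp add: prefixed_def)
  also have "\<dots> = (\<Sum>t\<in>G. const (K t (g *v ax i) (g *v ax j)) * mext NF (map ax w @ act g a @ act (t ** g) b))"
    by (simp add: reorder_def o_def matrix_vector_mul_assoc)
  also have "\<dots> = (\<Sum>t\<in>G. const (K t (ax i) (ax j)) * mext NF (map ax w @ act g a @ act (g ** t) b))"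
    by (rule conj_sum[OF assms])
  also have "\<dots> = (\<Sum>s\<in>G. const (K s (ax i) (ax j)) * mext (\<lambda>v. prefixed w g (a @ v)) (act s b))"
    using mext_mext_act[of NF "map ax w @ act g a" g "[]"]
    by (simp add: prefixed_def o_def matrix_vector_mul_assoc)
  finally show "prefixed w g (a @ i # j # b) - prefixed w g (a @ j # i # b)
    = (\<Sum>s\<in>G. const (K s (ax i) (ax j)) * mext (\<lambda>v. prefixed w g (a @ v)) (act s b))" .
qed

lemma from_normal_pairing: "from_normal T (pairing a \<Psi>) = pairing a (\<lambda>p. from_normal T (\<Psi> p))"
  by (simp add: pairing_def from_normal_sum from_normal_const_mult)

lemma pairing_compatible:
  assumes "compatible T"
  shows "pairing b (\<lambda>(u, h). T u) = from_normal T (nform b)"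
  unfolding nform_def from_normal_pairing
  by (rule arg_cong2[of _ _ _ _ pairing]) (auto simp: fun_eq_iff intro: from_normal_NF[OF assms])

text \<open>Since \<open>prefixed w g\<close> is compatible, left multiplication sees
  \<open>b\<close> only through its normal form.\<close>

lemma nform_mult:
  assumes "skel G a" "finite_supp b"
  shows "nform (sk_mult a b) = pairing a (\<lambda>(w, g). from_normal (prefixed w g) (nform b))"
  unfolding nform_mult_prefixed[OF skel_finite_supp[OF assms(1)] assms(2)]
proof (rule pairing_cong)
  fix p assume "a p \<noteq> 0"
  then have "snd p \<in> G" using assms(1) by (cases p) (auto simp: skel_def)
  then show "(case p of (w, g) \<Rightarrow> pairing b (\<lambda>(u, h). prefixed w g u)) = (case p of (w, g) \<Rightarrow> from_normal (prefixed w g) (nform b))"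
    by (cases p) (simp add: pairing_compatible[OF compatible_prefixed])
qed

lemma nform_add: "finite_supp a \<Longrightarrow> finite_supp b \<Longrightarrow> nform (a + b) = nform a + nform b"
  by (simp only: nform_def pairing_add)

lemma nform_diff: "finite_supp a \<Longrightarrow> finite_supp b \<Longrightarrow> nform (a - b) = nform a - nform b"
  by (simp only: nform_def pairing_diff)

lemma nform_csc: "finite_supp a \<Longrightarrow> nform (csc z a) = const z * nform a"
  by (simp only: nform_def pairing_csc)

lemma nform_0 [simp]: "nform 0 = 0"
  by (simp add: nform_def)

lemma nform_relator_mult:
  assumes "finite_supp b"
  shows "nform (sk_mult (relator i j) b) = 0"
proof -
  have z: "prefixed [i, j] (mat 1) u - prefixed [j, i] (mat 1) u
      - (\<Sum>s\<in>G. const (K s (ax i) (ax j)) * prefixed [] s u) = 0" for u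
    using compatible_vectors[OF compatible_NF, of "[]" "ax i" "ax j" "map ax u"]
    by (simp add: prefixed_def reorder_def o_def)
  have "nform (sk_mult (relator i j) b) = pairing b (\<lambda>(u, h). prefixed [i, j] (mat 1) u - prefixed [j, i] (mat 1) u
      - (\<Sum>s\<in>G. const (K s (ax i) (ax j)) * prefixed [] s u))"
    by (simp only: nform_mult_prefixed[OF finite_supp_relator assms] pairing_relator case_prod_unfold fst_conv snd_conv
      pairing_fun_diff pairing_fun_sum pairing_fun_mult)
  then show ?thesis by (simp add: z pairing_def)
qed

lemma nform_relator_ideal:
  assumes "x \<in> relator_ideal"
  shows "nform x = 0"
proof -
  have "cvec.subspace {x. finite_supp x \<and> nform x = 0}"
    unfolding cvec.subspace_def
    by (auto simp: nform_add nform_csc finite_supp_add finite_supp_csc simp del: plus_fun_apply csc_apply)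
  moreover have "{sk_mult (sk_mult a (relator i j)) b | a b i j. skel G a \<and> skel G b} \<subseteq> {x. finite_supp x \<and> nform x = 0}"
  proof clarify
    fix a b i j assume ab: "skel G a" "skel G b"
    note fin = skel_finite_supp[OF ab(1)] skel_finite_supp[OF ab(2)] finite_supp_relator[of i j]
    have "sk_mult (sk_mult a (relator i j)) b = sk_mult a (sk_mult (relator i j) b)"
      by (rule sk_mult_assoc) (fact fin)+
    moreover have "nform (sk_mult a (sk_mult (relator i j) b)) = 0"
      by (subst nform_mult[OF ab(1)]) (simp_all add: fin finite_supp_mult nform_relator_mult pairing_def case_prod_unfold)
    ultimately show "finite_supp (sk_mult (sk_mult a (relator i j)) b) \<and> nform (sk_mult (sk_mult a (relator i j)) b) = 0"
      using fin by (simp add: finite_supp_mult)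
  qed
  ultimately show ?thesis using assms cvec.span_minimal unfolding relator_ideal_def by blast
qed

section \<open>The idempotent and the spherical part\<close>

abbreviation idem :: "'n sk" where
  "idem \<equiv> sym_idem G"

lemma card_G_nonzero: "(of_nat (card G) :: complex) \<noteq> 0"
  using finite_G one_G by (auto simp: card_eq_0_iff)

lemma sum_left_translate:
  assumes "g \<in> G"
  shows "(\<Sum>h\<in>G. F (g ** h)) = (\<Sum>h\<in>G. F h)"
proof -
  obtain k where k: "k \<in> G" "g ** k = mat 1" "k ** g = mat 1" using inv_G assms by blast
  have "g ** (k ** h) = h" "k ** (g ** h) = h" for h
    using matrix_mul_assoc[of g k h] matrix_mul_assoc[of k g h] k by simp_all
  then show ?thesis
    by (intro sum.reindex_bij_witness[where i = "\<lambda>h. k ** h" and j = "\<lambda>h. g ** h"]) (auto intro: mult_G assms k)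
qed

lemma idem_eq: "idem = csc (1 / of_nat (card G)) (\<Sum>h\<in>G. sk_basis [] h)"
  by (simp add: sym_idem_def fun_eq_iff sum_fun_apply)

lemma skel_idem: "skel G idem"
proof -
  have "idem \<in> {a. skel G a}"
    unfolding idem_eq
    by (intro cvec.subspace_sum[OF subspace_skel] cvec.subspace_scale[OF subspace_skel]) (auto intro: skel_sk_basis)
  then show ?thesis by simp
qed

lemmas finite_supp_idem = skel_finite_supp[OF skel_idem]

lemma pairing_idem: "pairing idem \<Psi> = const (1 / of_nat (card G)) * (\<Sum>h\<in>G. \<Psi> ([], h))"
proof -
  have s: "pairing (\<Sum>h\<in>G. sk_basis [] h) \<Psi> = (\<Sum>h\<in>G. pairing (sk_basis [] h) \<Psi>)"
    "finite_supp (\<Sum>h\<in>G. sk_basis [] h)"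
    using pairing_sum[of G "\<lambda>h. sk_basis [] h"] finite_supp_sk_basis by blast+
  show ?thesis unfolding idem_eq pairing_csc[OF s(2)] s(1) by simp
qed

lemma sum_const_average [simp]: "const (1 / of_nat (card G)) * (\<Sum>h\<in>G. p) = p"
proof -
  have "(\<Sum>h\<in>G. p) = of_nat (card G) * p" by simp
  also have "of_nat (card G) = const (of_nat (card G))"
    by (simp add: const_def)
  finally show ?thesis
    by (simp only: mult.assoc[symmetric] const_mult[symmetric]) (use card_G_nonzero in simp)
qed

lemma idem_idem: "sk_mult idem idem = idem"
proof (rule pairing_eqI)
  fix \<Psi> :: "'n list \<times> (complex^'n^'n) \<Rightarrow> cpoly"
  have "pairing (sk_mult idem idem) \<Psi> = const (1 / of_nat (card G)) *
      (\<Sum>g\<in>G. const (1 / of_nat (card G)) * (\<Sum>h\<in>G. \<Psi> ([], g ** h)))"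
    by (simp add: finite_supp_idem pairing_mult pairing_idem)
  also have "\<dots> = const (1 / of_nat (card G)) *
      (\<Sum>g\<in>G. const (1 / of_nat (card G)) * (\<Sum>h\<in>G. \<Psi> ([], h)))"
    by (intro arg_cong2[of _ _ _ _ "(*)"] sum.cong refl sum_left_translate[where F = "\<lambda>h. \<Psi> ([], h)"])
  finally show "pairing (sk_mult idem idem) \<Psi> = pairing idem \<Psi>"
    by (simp only: pairing_idem sum_const_average)
qed (simp_all add: finite_supp_mult finite_supp_idem)

text \<open>The converse of \<open>nform_relator_ideal\<close>, after multiplication by e. If
  \<open>f\<close> vanishes on the ideal, then \<open>u \<mapsto> f(u e)\<close> is a compatible
  function of words, so \<open>f(b e)\<close> depends only on the normal form of \<open>b\<close>. A
  vanishing normal form thus leaves no functional that separates \<open>b e\<close> from the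
  ideal.\<close>

lemma mult_idem_in_ideal:
  assumes b: "skel G b" and 0: "nform b = 0"
  shows "sk_mult b idem \<in> relator_ideal"
proof (rule ccontr)
  assume "sk_mult b idem \<notin> relator_ideal"
  then obtain f where f: "Vector_Spaces.linear csc (*) f" "\<And>y. y \<in> relator_ideal \<Longrightarrow> f y = 0"
      "f (sk_mult b idem) = (1::complex)"
    using separating_functional[OF subspace_relator_ideal] by metis
  interpret f: Vector_Spaces.linear csc "(*)" f by (fact f(1))
  \<comment> \<open>Scalars become constant polynomials because \<open>pairing\<close> and
    \<open>mext\<close> take polynomial values.\<close>
  define \<Psi> where "\<Psi> p = const (f (sk_basis (fst p) (snd p)))" for p
  have eval: "const (f a) = pairing a \<Psi>" if "finite_supp a" for a
  proof -
    have "a = (\<Sum>p | a p \<noteq> 0. csc (a p) (sk_basis (fst p) (snd p)))"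
    proof
      fix q
      have "(\<Sum>p | a p \<noteq> 0. csc (a p) (sk_basis (fst p) (snd p)) q) = (\<Sum>p | a p \<noteq> 0. if p = q then a p else 0)"
        by (rule sum.cong) (auto simp: sk_basis_def)
      then show "a q = (\<Sum>p | a p \<noteq> 0. csc (a p) (sk_basis (fst p) (snd p))) q"
        using that by (simp add: sum_fun_apply)
    qed
    then have "f a = (\<Sum>p | a p \<noteq> 0. a p * f (sk_basis (fst p) (snd p)))"
      by (metis (no_types, lifting) f.scale f.sum sum.cong)
    then show ?thesis by (simp add: pairing_def \<Psi>_def const_sum const_mult)
  qed
  \<comment> \<open>\<open>T u\<close> is \<open>f(u e)\<close>. The average over \<open>h\<close>
    makes it insensitive to group elements in front of e, which is \<open>translate\<close>.\<close>
  define T where "T u = const (1 / of_nat (card G)) * (\<Sum>h\<in>G. \<Psi> (u, h))" for u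
  have translate: "const (1 / of_nat (card G)) * (\<Sum>h\<in>G. \<Psi> (u, g ** h)) = T u" if "g \<in> G" for u g
    unfolding T_def using sum_left_translate[OF that, of "\<lambda>h. \<Psi> (u, h)"] by simp
  have word_idem: "pairing (sk_mult (sk_basis v (mat 1)) idem) \<Theta> = const (1 / of_nat (card G)) * (\<Sum>h\<in>G. \<Theta> (v, h))"
    for v and \<Theta> :: "'n list \<times> (complex^'n^'n) \<Rightarrow> cpoly"
    by (simp add: pairing_mult finite_supp_idem pairing_idem)
  have "compatible T"
    unfolding compatible_def
  proof (intro allI)
    fix a v :: "'n list" and i j :: 'n
    let ?v = "sk_mult (sk_basis v (mat 1)) idem"
    let ?a = "sk_basis a (mat 1 :: complex^'n^'n)"
    have v: "skel G ?v" by (intro skel_multG skel_sk_basis one_G skel_idem)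
    have fin: "finite_supp (sk_mult (sk_mult ?a (relator i j)) ?v)"
      by (intro finite_supp_mult finite_supp_relator finite_supp_sk_basis finite_supp_idem)
    have "0 = const (f (sk_mult (sk_mult ?a (relator i j)) ?v))"
      using f(2)[OF relator_in_ideal[OF skel_sk_basis[OF one_G] v]] by simp
    also have "\<dots> = pairing (sk_mult (sk_mult ?a (relator i j)) ?v) \<Psi>" by (rule eval[OF fin])
    also have "\<dots> = pairing (relator i j) (\<lambda>(w, g). pairing ?v (\<lambda>(u, h). mext (\<lambda>z. \<Psi> (a @ w @ z, g ** h)) (act g u)))"
      by (simp add: pairing_mult finite_supp_mult finite_supp_relator finite_supp_idem case_prod_unfold)
    also have "\<dots> = T (a @ i # j # v) - T (a @ j # i # v)
        - (\<Sum>s\<in>G. const (K s (ax i) (ax j)) * (const (1 / of_nat (card G)) * (\<Sum>h\<in>G. mext (\<lambda>z. \<Psi> (a @ z, s ** h)) (act s v))))"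
      unfolding pairing_relator prod.case word_idem by (simp add: T_def)
    also have "(\<Sum>s\<in>G. const (K s (ax i) (ax j)) * (const (1 / of_nat (card G)) * (\<Sum>h\<in>G. mext (\<lambda>z. \<Psi> (a @ z, s ** h)) (act s v))))
        = (\<Sum>s\<in>G. const (K s (ax i) (ax j)) * mext (\<lambda>z. T (a @ z)) (act s v))"
      by (intro sum.cong refl) (simp add: mext_sum[symmetric] mext_mult[symmetric] translate del: sum_const_average)
    finally show "T (a @ i # j # v) - T (a @ j # i # v)
        = (\<Sum>s\<in>G. const (K s (ax i) (ax j)) * mext (\<lambda>z. T (a @ z)) (act s v))" by simp
  qed
  have "const 1 = pairing (sk_mult b idem) \<Psi>"
    using eval[of "sk_mult b idem"] f(3) skel_finite_supp[OF b] finite_supp_idem finite_supp_mult by metis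
  also have "\<dots> = pairing b (\<lambda>(w, g). const (1 / of_nat (card G)) * (\<Sum>h\<in>G. \<Psi> (w, g ** h)))"
    by (simp add: pairing_mult skel_finite_supp[OF b] finite_supp_idem pairing_idem)
  also have "\<dots> = pairing b (\<lambda>(w, g). T w)"
  proof (rule pairing_cong)
    fix p assume "b p \<noteq> 0"
    then have "snd p \<in> G" using b by (cases p) (auto simp: skel_def)
    then show "(case p of (w, g) \<Rightarrow> const (1 / of_nat (card G)) * (\<Sum>h\<in>G. \<Psi> (w, g ** h))) = (case p of (w, g) \<Rightarrow> T w)"
      by (cases p) (simp add: translate)
  qed
  also have "\<dots> = 0" by (simp add: pairing_compatible[OF \<open>compatible T\<close>] 0)
  finally show False by simp
qed

definition spherical_part :: "'n sk set" where
  "spherical_part = cvec.span ({sk_mult (sk_mult idem a) idem | a. skel G a} \<union> relator_ideal)"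

lemma subspace_spherical_part: "cvec.subspace spherical_part"
  unfolding spherical_part_def by (rule cvec.subspace_span)

lemma ideal_subset_spherical: "relator_ideal \<subseteq> spherical_part"
  unfolding spherical_part_def using cvec.span_superset by blast

lemma corner_in_spherical: "skel G a \<Longrightarrow> sk_mult (sk_mult idem a) idem \<in> spherical_part"
  unfolding spherical_part_def by (rule cvec.span_base) blast

lemma spherical_skel: "x \<in> spherical_part \<Longrightarrow> skel G x"
proof -
  have "spherical_part \<subseteq> {a. skel G a}"
    unfolding spherical_part_def
    by (rule cvec.span_minimal[OF _ subspace_skel]) (auto intro: skel_multG skel_idem relator_ideal_skel)
  then show "x \<in> spherical_part \<Longrightarrow> skel G x" by blast
qed

text \<open>Corners \<open>e a e\<close> are fixed exactly, by idempotence, and for elements of the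
  ideal both terms stay in the ideal; linearity does the rest. So e is a two-sided unit of U modulo
  the ideal.\<close>

lemma spherical_corner:
  assumes "x \<in> spherical_part"
  shows "sk_mult (sk_mult idem x) idem - x \<in> relator_ideal"
proof -
  let ?S = "{x. skel G x \<and> sk_mult (sk_mult idem x) idem - x \<in> relator_ideal}"
  have "cvec.subspace ?S"
    unfolding cvec.subspace_def
  proof (intro conjI ballI allI)
    show "0 \<in> ?S" using cvec.subspace_0[OF subspace_skel] cvec.subspace_0[OF subspace_relator_ideal] by simp
    fix x y assume xy: "x \<in> ?S" "y \<in> ?S"
    have eq: "sk_mult (sk_mult idem (x + y)) idem - (x + y)
        = (sk_mult (sk_mult idem x) idem - x) + (sk_mult (sk_mult idem y) idem - y)"
    proof -
      have "finite_supp x" "finite_supp y" using xy skel_finite_supp by blast+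
      then show ?thesis
        by (simp only: sk_mult_add_left sk_mult_add_right finite_supp_mult finite_supp_idem) (simp add: algebra_simps)
    qed
    show "x + y \<in> ?S"
      unfolding mem_Collect_eq eq using xy cvec.subspace_add[OF subspace_skel[of G], of x y] cvec.subspace_add[OF subspace_relator_ideal] by blast
  next
    fix z x assume x: "x \<in> ?S"
    have eq: "sk_mult (sk_mult idem (csc z x)) idem - csc z x = csc z (sk_mult (sk_mult idem x) idem - x)"
    proof -
      have "finite_supp x" using x skel_finite_supp by blast
      then show ?thesis
        by (simp only: sk_mult_csc_left sk_mult_csc_right finite_supp_mult finite_supp_idem cvec.scale_right_diff_distrib)
    qed
    show "csc z x \<in> ?S"
      unfolding mem_Collect_eq eq using x cvec.subspace_scale[OF subspace_skel[of G], of x z] cvec.subspace_scale[OF subspace_relator_ideal] by blast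
  qed
  moreover have "{sk_mult (sk_mult idem a) idem | a. skel G a} \<union> relator_ideal \<subseteq> ?S"
  proof
    fix x assume "x \<in> {sk_mult (sk_mult idem a) idem | a. skel G a} \<union> relator_ideal"
    then show "x \<in> ?S"
    proof
      assume "x \<in> {sk_mult (sk_mult idem a) idem | a. skel G a}"
      then obtain a where a: "skel G a" "x = sk_mult (sk_mult idem a) idem" by blast
      note fin = skel_finite_supp[OF a(1)] finite_supp_idem finite_supp_mult
      have "sk_mult (sk_mult idem x) idem = sk_mult (sk_mult (sk_mult idem idem) a) (sk_mult idem idem)"
        unfolding a(2) by (simp only: fin sk_mult_assoc)
      then have "sk_mult (sk_mult idem x) idem - x = 0" by (simp add: idem_idem a(2))
      then show ?thesis using a skel_idem skel_multG cvec.subspace_0[OF subspace_relator_ideal] by simp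
    next
      assume "x \<in> relator_ideal"
      then show ?thesis
        using relator_ideal_skel relator_ideal_left relator_ideal_right skel_idem
          cvec.subspace_diff[OF subspace_relator_ideal] by simp
    qed
  qed
  ultimately show ?thesis using assms cvec.span_minimal unfolding spherical_part_def by blast
qed

end

context deformed_commutation
begin

section \<open>Degrees of products and their top parts\<close>

lemma prefixed_supported: "prefixed w g u \<in> supported (expos (Suc (length w + length u)))"
  unfolding prefixed_def
proof (rule mext_supported)
  fix z :: "'n list" assume "length z = length (map ax w @ act g u)"
  then show "NF z \<in> supported (expos (Suc (length w + length u)))"
    using NF_supported[of z] by simp
qed

lemma nform_supported_expos:
  assumes "\<And>w g. a (w, g) \<noteq> 0 \<Longrightarrow> length w \<le> n"
  shows "nform a \<in> supported (expos (Suc n))"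
  unfolding nform_def
proof (rule pairing_supported)
  fix p assume "a p \<noteq> 0"
  then show "(case p of (w, g) \<Rightarrow> NF w) \<in> supported (expos (Suc n))"
    using NF_supported[of "fst p"] expos_mono[of "Suc (length (fst p))" "Suc n"] assms[of "fst p" "snd p"]
    by (cases p) (auto intro: supported_mono)
qed

lemma nform_supported: "finite_supp a \<Longrightarrow> \<exists>n. nform a \<in> supported (expos n)"
proof -
  assume fin: "finite_supp a"
  obtain n where "\<forall>p\<in>{p. a p \<noteq> 0}. length (fst p) \<le> n"
    using finite_imageI[OF fin, of "\<lambda>p. length (fst p)"] by (meson finite_nat_set_iff_bounded_le imageI)
  then show ?thesis using nform_supported_expos[of a n] by force
qed

lemma from_normal_supported:
  assumes "q \<in> supported (expos n)"
  shows "from_normal (prefixed w g) q \<in> supported (expos (length w + n))"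
  unfolding from_normal_def
proof (intro supported_sum supported_const_mult)
  fix m assume "m \<in> support q"
  then obtain v where v: "m = word_expo v" "length v < n" using assms by (auto simp: supported_def expos_def)
  then show "prefixed w g (normal_word m) \<in> supported (expos (length w + n))"
    using prefixed_supported[of w g "normal_word m"] expos_mono[of "Suc (length w + length v)" "length w + n"]
    by (auto simp: length_normal_word intro: supported_mono)
qed

lemma nform_mult_supported:
  assumes "skel G a" "finite_supp b" "\<And>w g. a (w, g) \<noteq> 0 \<Longrightarrow> length w \<le> k" "nform b \<in> supported (expos n)"
  shows "nform (sk_mult a b) \<in> supported (expos (k + n))"
  unfolding nform_mult[OF assms(1,2)]
proof (rule pairing_supported)
  fix p assume "a p \<noteq> 0"
  then show "(case p of (w, g) \<Rightarrow> from_normal (prefixed w g) (nform b)) \<in> supported (expos (k + n))"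
    using from_normal_supported[OF assms(4), of "fst p" "snd p"] assms(3)[of "fst p" "snd p"]
      expos_mono[of "length (fst p) + n" "k + n"]
    by (cases p) (auto intro: supported_mono)
qed

lemma cpoly_expand: "q = (\<Sum>m\<in>support q. const (coeff_of q m) * Poly_Mapping.single m 1)"
proof (rule poly_mapping_eqI)
  fix m
  have "(\<Sum>x\<in>support q. coeff_of q x * coeff_of (Poly_Mapping.single x 1 :: cpoly) m) = (\<Sum>x\<in>support q. if x = m then coeff_of q m else 0)"
    by (rule sum.cong) (auto simp: lookup_single)
  then show "coeff_of q m = coeff_of (\<Sum>m\<in>support q. const (coeff_of q m) * Poly_Mapping.single m 1) m"
    by (simp add: lookup_sum in_keys_iff)
qed

text \<open>Only words \<open>w v\<close> with \<open>v\<close> sorted occur, and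
  \<open>NF_top\<close> replaces each by its commutative monomial up to lower degree. As
  \<open>q\<close> has degree at most \<open>n\<close>, the error stays strictly below degree
  \<open>length w + n\<close>.\<close>

lemma from_normal_top:
  assumes "q \<in> supported (expos (Suc n))"
  shows "from_normal (prefixed w (mat 1)) q - monomial w * q \<in> supported (expos (length w + n))"
proof -
  have "monomial w * q = (\<Sum>m\<in>support q. const (coeff_of q m) * (monomial w * Poly_Mapping.single m 1))"
    by (subst cpoly_expand[of q]) (simp add: sum_distrib_left mult.left_commute)
  then have "from_normal (prefixed w (mat 1)) q - monomial w * q
      = (\<Sum>m\<in>support q. const (coeff_of q m) * (NF (w @ normal_word m) - monomial w * Poly_Mapping.single m 1))"
    by (simp add: from_normal_def prefixed_one sum_subtractf right_diff_distrib)
  also have "\<dots> \<in> supported (expos (length w + n))"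
  proof (intro supported_sum supported_const_mult)
    fix m assume "m \<in> support q"
    then obtain v where v: "m = word_expo v" "length v < Suc n" using assms by (auto simp: supported_def expos_def)
    have "monomial w * Poly_Mapping.single m 1 = monomial (w @ normal_word m)"
      by (simp add: word_expo_append mult_single v word_expo_normal_word)
    moreover have "expos (length (w @ normal_word m)) \<subseteq> expos (length w + n)"
      using v by (intro expos_mono) (simp add: length_normal_word)
    ultimately show "NF (w @ normal_word m) - monomial w * Poly_Mapping.single m 1 \<in> supported (expos (length w + n))"
      using NF_top[of "w @ normal_word m"] supported_mono by metis
  qed
  finally show ?thesis .
qed

lemma skel_tensor: "skel G (tensor vs)"
  using finite_supp_tensor[of vs] one_G by (auto simp: skel_def tensor_def split: if_splits)

lemma nform_tensor_mult:
  assumes "finite_supp b" "nform b \<in> supported (expos (Suc n))"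
  shows "nform (sk_mult (tensor vs) b) - (\<Prod>v\<leftarrow>vs. linear_form v) * nform b \<in> supported (expos (length vs + n))"
proof -
  have "nform (sk_mult (tensor vs) b) - (\<Prod>v\<leftarrow>vs. linear_form v) * nform b
      = mext (\<lambda>w. from_normal (prefixed w (mat 1)) (nform b) - monomial w * nform b) vs"
    using mext_mult[of "nform b" monomial vs]
    by (simp add: nform_mult[OF skel_tensor assms(1)] pairing_tensor mext_diff mext_monomial mult.commute)
  also have "\<dots> \<in> supported (expos (length vs + n))"
  proof (rule mext_supported)
    fix u :: "'n list" assume "length u = length vs"
    then show "from_normal (prefixed u (mat 1)) (nform b) - monomial u * nform b \<in> supported (expos (length vs + n))"
      using from_normal_top[OF assms(2), of u] by simp
  qed
  finally show ?thesis .
qed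

lemma basis_mult_tensor:
  fixes h :: "complex^'n^'n"
  shows "sk_mult (sk_basis [] h) (tensor vs) = sk_mult (tensor (map ((*v) h) vs)) (sk_basis [] h)"
proof (rule pairing_eqI)
  fix \<Psi> :: "'n list \<times> (complex^'n^'n) \<Rightarrow> cpoly"
  show "pairing (sk_mult (sk_basis [] h) (tensor vs)) \<Psi> = pairing (sk_mult (tensor (map ((*v) h) vs)) (sk_basis [] h)) \<Psi>"
    using mext_mext_act[of "\<lambda>z. \<Psi> (z, h)" "[]" h "[]" vs]
    by (simp add: pairing_mult finite_supp_tensor pairing_tensor)
qed (simp_all add: finite_supp_mult finite_supp_tensor)

section \<open>Invariant lifts of the symmetric functions of an orbit\<close>

definition arrangements :: "nat \<Rightarrow> (complex^'n^'n) list set" where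
  "arrangements k = {gs. distinct gs \<and> set gs \<subseteq> G \<and> length gs = k}"

text \<open>A tensor lift of \<open>k!\<close> times the elementary symmetric function of the orbit of \<open>v\<close>;
  summing over all orderings makes the tensor itself invariant.\<close>

definition orbit_tensor :: "complex^'n \<Rightarrow> nat \<Rightarrow> 'n sk" where
  "orbit_tensor v k = (\<Sum>gs\<in>arrangements k. tensor (map (\<lambda>g. g *v v) gs))"

text \<open>The commutative image of \<open>orbit_tensor\<close>. Factors are indexed by group
  elements and not by points of the orbit, so the polynomial with these coefficients has degree
  \<open>card G\<close> whatever the stabilizer of \<open>v\<close> is.\<close>

definition orbit_sym :: "complex^'n \<Rightarrow> nat \<Rightarrow> cpoly" where
  "orbit_sym v k = (\<Sum>gs\<in>arrangements k. \<Prod>g\<leftarrow>gs. linear_form (g *v v))"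

lemma skel_orbit_tensor: "skel G (orbit_tensor v k)"
proof -
  have "orbit_tensor v k \<in> {a. skel G a}"
    unfolding orbit_tensor_def by (intro cvec.subspace_sum[OF subspace_skel]) (simp add: skel_tensor)
  then show ?thesis by simp
qed

lemma finite_supp_sum: "(\<And>i. i \<in> A \<Longrightarrow> finite_supp (f i)) \<Longrightarrow> finite_supp (\<Sum>i\<in>A. f i)"
  using pairing_sum[of A f] by blast

lemma nform_sum: "(\<And>i. i \<in> A \<Longrightarrow> finite_supp (f i)) \<Longrightarrow> nform (\<Sum>i\<in>A. f i) = (\<Sum>i\<in>A. nform (f i))"
  unfolding nform_def using pairing_sum[of A f] by blast

lemma sk_mult_sum_right:
  fixes c :: "'m::finite sk"
  assumes "finite_supp c" "\<And>i. i \<in> A \<Longrightarrow> finite_supp (f i)"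
  shows "sk_mult c (\<Sum>i\<in>A. f i) = (\<Sum>i\<in>A. sk_mult c (f i))"
  using assms(2)
proof (induction A rule: infinite_finite_induct)
  case (insert x A)
  then have h: "finite_supp (f x)" "finite_supp (sum f A)" using finite_supp_sum[of A f] by blast+
  have "sk_mult c (sum f A) = (\<Sum>i\<in>A. sk_mult c (f i))" using insert by blast
  then show ?case
    unfolding sum.insert[OF insert.hyps(1,2)] sk_mult_add_right[OF h assms(1)] by (simp only:)
qed simp_all

lemma sk_mult_sum_left:
  fixes c :: "'m::finite sk"
  assumes "finite_supp c" "\<And>i. i \<in> A \<Longrightarrow> finite_supp (f i)"
  shows "sk_mult (\<Sum>i\<in>A. f i) c = (\<Sum>i\<in>A. sk_mult (f i) c)"
  using assms(2)
proof (induction A rule: infinite_finite_induct)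
  case (insert x A)
  then have h: "finite_supp (f x)" "finite_supp (sum f A)" using finite_supp_sum[of A f] by blast+
  have "sk_mult (sum f A) c = (\<Sum>i\<in>A. sk_mult (f i) c)" using insert by blast
  then show ?case
    unfolding sum.insert[OF insert.hyps(1,2)] sk_mult_add_left[OF h assms(1)] by (simp only:)
qed simp_all

text \<open>Moving \<open>h\<close> through a tensor translates its arrangement by \<open>h\<close>,
  and translation permutes the arrangements of each length.\<close>

lemma basis_mult_orbit_tensor:
  assumes "h \<in> G"
  shows "sk_mult (sk_basis [] h) (orbit_tensor v k) = sk_mult (orbit_tensor v k) (sk_basis [] h)"
proof -
  obtain h' where h': "h' \<in> G" "h ** h' = mat 1" "h' ** h = mat 1" using inv_G assms by blast
  have inv: "h ** (h' ** x) = x" "h' ** (h ** x) = x" for x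
    using matrix_mul_assoc[of h h' x] matrix_mul_assoc[of h' h x] h' by simp_all
  have inj: "inj_on ((**) h) S" "inj_on ((**) h') S" for S
    by (metis inj_onI inv(2), metis inj_onI inv(1))
  have bij: "(\<Sum>gs\<in>arrangements k. F (map ((**) h) gs)) = (\<Sum>gs\<in>arrangements k. F gs)" for F :: "_ \<Rightarrow> 'n sk"
    by (rule sum.reindex_bij_witness[where i = "map ((**) h')" and j = "map ((**) h)"])
      (auto simp: arrangements_def o_def inv distinct_map inj assms h' intro!: mult_G)
  have "sk_mult (sk_basis [] h) (orbit_tensor v k)
      = (\<Sum>gs\<in>arrangements k. sk_mult (tensor (map (\<lambda>g. g *v v) (map ((**) h) gs))) (sk_basis [] h))"
    unfolding orbit_tensor_def
    by (subst sk_mult_sum_right) (simp_all add: finite_supp_tensor basis_mult_tensor o_def matrix_vector_mul_assoc)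
  also have "\<dots> = sk_mult (orbit_tensor v k) (sk_basis [] h)"
    unfolding bij[of "\<lambda>gs. sk_mult (tensor (map (\<lambda>g. g *v v) gs)) (sk_basis [] h)"] orbit_tensor_def
    by (subst sk_mult_sum_left) (simp_all add: finite_supp_tensor)
  finally show ?thesis .
qed

lemma idem_mult_orbit_tensor: "sk_mult idem (orbit_tensor v k) = sk_mult (orbit_tensor v k) idem"
proof -
  note fin = skel_finite_supp[OF skel_orbit_tensor] finite_supp_sk_basis
  have s: "finite_supp (\<Sum>h\<in>G. sk_basis [] h)" by (rule finite_supp_sum) (rule fin)
  show ?thesis
    unfolding idem_eq sk_mult_csc_left[OF s s fin(1)] sk_mult_csc_right[OF s s fin(1)]
      sk_mult_sum_left[OF fin(1) fin(2)] sk_mult_sum_right[OF fin(1) fin(2)]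
    by (simp only: basis_mult_orbit_tensor cong: sum.cong)
qed

definition orbit_element :: "complex^'n \<Rightarrow> nat \<Rightarrow> 'n sk" where
  "orbit_element v k = sk_mult (orbit_tensor v k) idem"

lemma orbit_element_spherical: "orbit_element v k \<in> spherical_part"
proof -
  note fin = skel_finite_supp[OF skel_orbit_tensor] finite_supp_idem finite_supp_mult
  have "sk_mult (sk_mult idem (orbit_tensor v k)) idem = orbit_element v k"
    unfolding orbit_element_def idem_mult_orbit_tensor by (simp add: sk_mult_assoc fin idem_idem)
  then show ?thesis using corner_in_spherical[OF skel_orbit_tensor] by metis
qed

lemma idem_spherical: "idem \<in> spherical_part"
  using corner_in_spherical[OF skel_idem] by (simp add: idem_idem)

lemma spherical_idem_left:
  assumes "b \<in> spherical_part"
  shows "sk_mult idem b - b \<in> relator_ideal"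
proof -
  note fin = skel_finite_supp[OF spherical_skel[OF assms]] finite_supp_idem finite_supp_mult
  let ?r = "sk_mult (sk_mult idem b) idem - b"
  have r: "?r \<in> relator_ideal" by (rule spherical_corner[OF assms])
  then have fr: "finite_supp ?r" using relator_ideal_skel skel_finite_supp by blast
  have "sk_mult idem (?r + b) = ?r + b" by (simp add: sk_mult_assoc[symmetric] fin idem_idem)
  moreover have "sk_mult idem (?r + b) = sk_mult idem ?r + sk_mult idem b"
    by (rule sk_mult_add_right) (fact fr fin)+
  ultimately have "sk_mult idem b - b = ?r - sk_mult idem ?r" by (simp add: algebra_simps)
  then show ?thesis
    using r relator_ideal_left[OF r skel_idem] cvec.subspace_diff[OF subspace_relator_ideal] by metis
qed

lemma nform_idem_mult:
  assumes "b \<in> spherical_part"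
  shows "nform (sk_mult idem b) = nform b"
proof -
  note fin = skel_finite_supp[OF spherical_skel[OF assms]] finite_supp_idem finite_supp_mult
  have "nform (sk_mult idem b - b) = 0" by (rule nform_relator_ideal[OF spherical_idem_left[OF assms]])
  then show ?thesis unfolding nform_diff[OF finite_supp_mult[OF fin(2,1)] fin(1)] by simp
qed

text \<open>Since \<open>e b\<close> has the normal form of \<open>b\<close>, the element acts as a
  sum of pure tensors, and each of these multiplies by its linear forms up to lower degree.\<close>

lemma nform_orbit_element_mult:
  assumes b: "b \<in> spherical_part" and n: "nform b \<in> supported (expos (Suc n))"
  shows "nform (sk_mult (orbit_element v k) b) - orbit_sym v k * nform b \<in> supported (expos (k + n))"
proof -
  note fin = skel_finite_supp[OF spherical_skel[OF b]] finite_supp_idem finite_supp_mult skel_finite_supp[OF skel_orbit_tensor]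
  have fb: "finite_supp (sk_mult idem b)" by (intro fin)
  have "sk_mult (orbit_element v k) b = sk_mult (orbit_tensor v k) (sk_mult idem b)"
    unfolding orbit_element_def by (simp add: sk_mult_assoc fin)
  also have "\<dots> = (\<Sum>gs\<in>arrangements k. sk_mult (tensor (map (\<lambda>g. g *v v) gs)) (sk_mult idem b))"
    unfolding orbit_tensor_def by (rule sk_mult_sum_left[OF fb finite_supp_tensor])
  finally have "nform (sk_mult (orbit_element v k) b)
      = (\<Sum>gs\<in>arrangements k. nform (sk_mult (tensor (map (\<lambda>g. g *v v) gs)) (sk_mult idem b)))"
    by (simp only: nform_sum finite_supp_mult[OF finite_supp_tensor fb])
  then have "nform (sk_mult (orbit_element v k) b) - orbit_sym v k * nform b
      = (\<Sum>gs\<in>arrangements k. nform (sk_mult (tensor (map (\<lambda>g. g *v v) gs)) (sk_mult idem b))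
           - (\<Prod>v\<leftarrow>map (\<lambda>g. g *v v) gs. linear_form v) * nform (sk_mult idem b))"
    by (simp add: orbit_sym_def sum_distrib_right sum_subtractf nform_idem_mult[OF b] o_def)
  also have "\<dots> \<in> supported (expos (k + n))"
  proof (rule supported_sum)
    fix gs assume "gs \<in> arrangements k"
    then have "length (map (\<lambda>g. g *v v) gs) = k" by (simp add: arrangements_def)
    then show "nform (sk_mult (tensor (map (\<lambda>g. g *v v) gs)) (sk_mult idem b))
           - (\<Prod>v\<leftarrow>map (\<lambda>g. g *v v) gs. linear_form v) * nform (sk_mult idem b) \<in> supported (expos (k + n))"
      using nform_tensor_mult[OF fb, of n "map (\<lambda>g. g *v v) gs"] n nform_idem_mult[OF b] by simp
  qed
  finally show ?thesis .
qed

text \<open>Modulo the ideal \<open>b\<close> equals \<open>e (b e)\<close>, and \<open>b e\<close>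
  lies in the ideal once the normal form vanishes. So U embeds into polynomials although the normal
  form forgets group elements on the right.\<close>

lemma spherical_nform_zero:
  assumes "b \<in> spherical_part" "nform b = 0"
  shows "b \<in> relator_ideal"
proof -
  note fin = skel_finite_supp[OF spherical_skel[OF assms(1)]] finite_supp_idem finite_supp_mult
  have "sk_mult idem (sk_mult b idem) \<in> relator_ideal"
    using mult_idem_in_ideal[OF spherical_skel[OF assms(1)] assms(2)] relator_ideal_left skel_idem by blast
  moreover have "sk_mult idem (sk_mult b idem) = sk_mult (sk_mult idem b) idem"
    by (simp add: sk_mult_assoc fin)
  ultimately have "sk_mult (sk_mult idem b) idem - (sk_mult (sk_mult idem b) idem - b) \<in> relator_ideal"
    using spherical_corner[OF assms(1)] cvec.subspace_diff[OF subspace_relator_ideal] by metis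
  then show ?thesis by simp
qed

text \<open>Replace both factors by their corners: the product is a corner again, and the
  differences contribute only elements of the ideal.\<close>

lemma spherical_mult:
  assumes "a \<in> spherical_part" "b \<in> spherical_part"
  shows "sk_mult a b \<in> spherical_part"
proof -
  note fin = skel_finite_supp[OF spherical_skel[OF assms(1)]] skel_finite_supp[OF spherical_skel[OF assms(2)]]
    finite_supp_idem finite_supp_mult
  let ?a = "sk_mult (sk_mult idem a) idem" and ?b = "sk_mult (sk_mult idem b) idem"
  have skel: "skel G a" "skel G b" "skel G ?a" "skel G ?b"
    using assms spherical_skel skel_multG skel_idem by blast+
  have e: "sk_mult ?a ?b = sk_mult (sk_mult idem (sk_mult a (sk_mult (sk_mult idem idem) b))) idem"
    by (simp only: sk_mult_assoc fin)
  have 1: "sk_mult ?a ?b \<in> spherical_part"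
    unfolding e by (intro corner_in_spherical skel_multG skel skel_idem)
  have r: "sk_mult (?a - a) ?b \<in> relator_ideal" "sk_mult a (?b - b) \<in> relator_ideal"
    using relator_ideal_right[OF spherical_corner[OF assms(1)] skel(4)]
      relator_ideal_left[OF spherical_corner[OF assms(2)] skel(1)] by blast+
  have fr: "finite_supp (?a - a)" "finite_supp (?b - b)"
    by (intro finite_supp_diff fin)+
  have "sk_mult ?a ?b = sk_mult ((?a - a) + a) ?b" by simp
  also have "\<dots> = sk_mult (?a - a) ?b + sk_mult a ?b"
    by (rule sk_mult_add_left) (intro fr fin)+
  also have "sk_mult a ?b = sk_mult a ((?b - b) + b)" by simp
  also have "\<dots> = sk_mult a (?b - b) + sk_mult a b"
    by (rule sk_mult_add_right) (intro fr fin)+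
  finally have e': "sk_mult ?a ?b = sk_mult (?a - a) ?b + (sk_mult a (?b - b) + sk_mult a b)" .
  have "sk_mult a b = sk_mult ?a ?b - sk_mult (?a - a) ?b - sk_mult a (?b - b)"
    unfolding e' by (simp only: add_diff_cancel_left')
  moreover have "sk_mult ?a ?b - sk_mult (?a - a) ?b \<in> spherical_part"
    by (rule cvec.subspace_diff[OF subspace_spherical_part 1]) (use r ideal_subset_spherical in blast)
  then have "sk_mult ?a ?b - sk_mult (?a - a) ?b - sk_mult a (?b - b) \<in> spherical_part"
    by (rule cvec.subspace_diff[OF subspace_spherical_part]) (use r ideal_subset_spherical in blast)
  ultimately show ?thesis by (simp only:)
qed

end

section \<open>An isoperimetric inequality and growth of sequences\<close>

text \<open>Elimination of one unknown per equation. It will bound the size of independent sets by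
  the number of leading exponents.\<close>

lemma underdetermined_system:
  fixes M :: "'f \<Rightarrow> 'q \<Rightarrow> 'k::field"
  assumes "finite Q" "finite F" "card Q < card F"
  shows "\<exists>c. (\<exists>f\<in>F. c f \<noteq> 0) \<and> (\<forall>q\<in>Q. (\<Sum>f\<in>F. c f * M f q) = 0)"
  using assms
proof (induction Q arbitrary: F M rule: finite_induct)
  case empty
  then obtain f where "f \<in> F" by (metis card_gt_0_iff card.empty ex_in_conv)
  then show ?case by (intro exI[of _ "\<lambda>_. 1"]) auto
next
  case (insert q Q)
  show ?case
  proof (cases "\<forall>f\<in>F. M f q = 0")
    case True
    obtain c where "\<exists>f\<in>F. c f \<noteq> 0" "\<forall>r\<in>Q. (\<Sum>f\<in>F. c f * M f r) = 0"
      using insert.IH[of F M] insert.prems insert.hyps by auto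
    then show ?thesis using True by (intro exI[of _ c]) auto
  next
    case False
    then obtain h where h: "h \<in> F" "M h q \<noteq> 0" by blast
    define M' where "M' f r = M f r - M f q / M h q * M h r" for f r
    have "card Q < card (F - {h})" using insert.prems insert.hyps h by simp
    then obtain c where c: "\<exists>f\<in>F - {h}. c f \<noteq> 0" "\<forall>r\<in>Q. (\<Sum>f\<in>F - {h}. c f * M' f r) = 0"
      using insert.IH[of "F - {h}" M'] insert.prems by auto
    define c' where "c' = c(h := - (\<Sum>f\<in>F - {h}. c f * (M f q / M h q)))"
    have sum: "(\<Sum>f\<in>F. c' f * M f r) = (\<Sum>f\<in>F - {h}. c f * M' f r)" for r
    proof -
      have "(\<Sum>f\<in>F. c' f * M f r) = c' h * M h r + (\<Sum>f\<in>F - {h}. c' f * M f r)"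
        using insert.prems h by (simp add: sum.remove)
      also have "(\<Sum>f\<in>F - {h}. c' f * M f r) = (\<Sum>f\<in>F - {h}. c f * M f r)"
        by (rule sum.cong) (auto simp: c'_def)
      finally show ?thesis
        by (simp add: c'_def M'_def right_diff_distrib sum_subtractf sum_distrib_right mult.assoc)
    qed
    have "M' f q = 0" for f using h by (simp add: M'_def)
    then have "(\<Sum>f\<in>F. c' f * M f r) = 0" if "r \<in> insert q Q" for r
      using that c(2) by (auto simp: sum)
    moreover have "\<exists>f\<in>F. c' f \<noteq> 0" using c(1) by (auto simp: c'_def)
    ultimately show ?thesis by blast
  qed
qed

text \<open>Slice \<open>Q\<close> along a new coordinate \<open>j\<close>. Each slice injects into
  the projection along \<open>j\<close>, of size \<open>M\<close>, so
  \<open>|P z|^((d-1)/d) \<ge> |P z| M^(-1/d)\<close>. Summed over the slices, the induction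
  hypothesis bounds the other projections from below by \<open>|Q| M^(-1/d)\<close>. This is large
  when \<open>M\<close> is small, and otherwise \<open>M\<close> alone suffices.\<close>

lemma card_le_sum_projections:
  fixes Q :: "('i \<Rightarrow> nat) set"
  assumes "finite D" "D \<noteq> {}" "finite Q" "\<forall>f\<in>Q. \<forall>i. i \<notin> D \<longrightarrow> f i = 0"
  shows "real (card Q) powr ((real (card D) - 1) / real (card D)) \<le> (\<Sum>i\<in>D. real (card ((\<lambda>f. f(i := 0)) ` Q)))"
  using assms
proof (induction D arbitrary: Q rule: finite_ne_induct)
  case (singleton i)
  \<comment> \<open>For one coordinate the exponent is 0. The left side is 1 for nonempty
    \<open>Q\<close> and 0 for empty \<open>Q\<close>, since \<open>0 powr 0 = 0\<close>.\<close>
  show ?case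
  proof (cases "Q = {}")
    case False
    then have "card ((\<lambda>f. f(i := 0)) ` Q) \<ge> 1" using singleton by (simp add: Suc_le_eq card_gt_0_iff)
    then have "real (card ((\<lambda>f. f(i := 0)) ` Q)) \<ge> 1" by linarith
    then show ?thesis using False singleton by (simp add: fun_upd_def)
  qed simp
next
  case (insert j D)
  show ?case
  proof (cases "Q = {}")
    case False
    define d where "d = real (card D)"
    have d: "d \<ge> 1" using insert.hyps by (simp add: d_def Suc_le_eq card_gt_0_iff)
    define Z where "Z = (\<lambda>f. f j) ` Q"
    define L where "L z = {f \<in> Q. f j = z}" for z
    define P where "P z = (\<lambda>f. f(j := 0)) ` L z" for z
    define q where "q = real (card Q)"
    define M where "M = real (card ((\<lambda>f. f(j := 0)) ` Q))"
    have finZ: "finite Z" and finL: "finite (L z)" and finP: "finite (P z)" for z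
      using insert.prems by (auto simp: Z_def L_def P_def)
    have q1: "q \<ge> 1" using False insert.prems by (simp add: q_def Suc_le_eq card_gt_0_iff)
    have M1: "M \<ge> 1" using False insert.prems by (simp add: M_def Suc_le_eq card_gt_0_iff)
    have inj: "inj_on (\<lambda>f. f(j := 0)) (L z)" for z
      by (rule inj_onI) (auto simp: L_def fun_eq_iff split: if_splits, metis)
    have cP: "card (P z) = card (L z)" for z
      unfolding P_def by (rule card_image[OF inj])
    have Q: "Q = (\<Union>z\<in>Z. L z)" by (auto simp: Z_def L_def)
    have cQ: "q = (\<Sum>z\<in>Z. real (card (P z)))"
      unfolding q_def cP by (subst Q, subst card_UN_disjoint) (use finZ finL in \<open>auto simp: L_def\<close>)
    have PM: "real (card (P z)) \<le> M" for z
      unfolding M_def P_def using insert.prems by (auto intro!: card_mono simp: L_def)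
    have P1: "real (card (P z)) \<ge> 1" if "z \<in> Z" for z
      using that finP[of z] by (auto simp: Suc_le_eq card_gt_0_iff Z_def P_def L_def)
    have proj: "(\<Sum>z\<in>Z. real (card ((\<lambda>f. f(i := 0)) ` P z))) \<le> real (card ((\<lambda>f. f(i := 0)) ` Q))" if "i \<in> D" for i
    proof -
      have ij: "i \<noteq> j" using that insert.hyps by blast
      have "(\<Sum>z\<in>Z. card ((\<lambda>f. f(i := 0)) ` P z)) \<le> (\<Sum>z\<in>Z. card ((\<lambda>f. f(i := 0)) ` L z))"
      proof (rule sum_mono)
        fix z
        have "(\<lambda>f. f(i := 0)) ` P z = (\<lambda>f. f(j := 0)) ` (\<lambda>f. f(i := 0)) ` L z"
          unfolding P_def image_image using ij by (simp add: fun_upd_twist)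
        then show "card ((\<lambda>f. f(i := 0)) ` P z) \<le> card ((\<lambda>f. f(i := 0)) ` L z)"
          using card_image_le[of "(\<lambda>f. f(i := 0)) ` L z"] finL by simp
      qed
      also have "\<dots> = card (\<Union>z\<in>Z. (\<lambda>f. f(i := 0)) ` L z)"
      proof (rule card_UN_disjoint[symmetric])
        show "\<forall>z\<in>Z. \<forall>z'\<in>Z. z \<noteq> z' \<longrightarrow> (\<lambda>f. f(i := 0)) ` L z \<inter> (\<lambda>f. f(i := 0)) ` L z' = {}"
          using ij by (auto simp: L_def) (metis fun_upd_other)
      qed (use finZ finL in auto)
      also have "(\<Union>z\<in>Z. (\<lambda>f. f(i := 0)) ` L z) = (\<lambda>f. f(i := 0)) ` Q" using Q by blast
      finally show ?thesis unfolding of_nat_sum[symmetric] of_nat_le_iff .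
    qed
    have IH: "real (card (P z)) powr ((d - 1) / d) \<le> (\<Sum>i\<in>D. real (card ((\<lambda>f. f(i := 0)) ` P z)))" for z
      unfolding d_def by (rule insert.IH[OF finP]) (use insert.prems in \<open>auto simp: P_def L_def\<close>)
    have "q * M powr (-1 / d) = (\<Sum>z\<in>Z. real (card (P z)) * M powr (-1 / d))"
      by (simp add: cQ sum_distrib_right)
    also have "\<dots> \<le> (\<Sum>z\<in>Z. real (card (P z)) powr ((d - 1) / d))"
    proof (rule sum_mono)
      fix z assume "z \<in> Z"
      then have p: "real (card (P z)) \<ge> 1" by (rule P1)
      have "M powr (-1 / d) \<le> real (card (P z)) powr (-1 / d)"
        using PM[of z] p d by (intro powr_mono2') auto
      moreover have "real (card (P z)) * real (card (P z)) powr (-1 / d) = real (card (P z)) powr ((d - 1) / d)"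
        using p d powr_mult_base[of "real (card (P z))" "-1 / d"] by (simp add: field_simps)
      ultimately show "real (card (P z)) * M powr (-1 / d) \<le> real (card (P z)) powr ((d - 1) / d)"
        using p by (metis mult_left_mono of_nat_0_le_iff)
    qed
    also have "\<dots> \<le> (\<Sum>z\<in>Z. \<Sum>i\<in>D. real (card ((\<lambda>f. f(i := 0)) ` P z)))"
      by (intro sum_mono IH)
    also have "\<dots> \<le> (\<Sum>i\<in>D. real (card ((\<lambda>f. f(i := 0)) ` Q)))"
      by (subst sum.swap) (intro sum_mono proj)
    finally have main: "q * M powr (-1 / d) \<le> (\<Sum>i\<in>D. real (card ((\<lambda>f. f(i := 0)) ` Q)))" .
    \<comment> \<open>The two summands on the right balance at \<open>M = q^(d/(d+1))\<close>, which
      is the threshold of the case distinction.\<close>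
    have "q powr (d / (d + 1)) \<le> M + q * M powr (-1 / d)"
    proof (cases "M \<ge> q powr (d / (d + 1))")
      case True
      then show ?thesis using q1 by (simp add: add_increasing2)
    next
      case False
      have "(q powr (d / (d + 1))) powr (-1 / d) \<le> M powr (-1 / d)"
        using False M1 d by (intro powr_mono2') auto
      also have "(q powr (d / (d + 1))) powr (-1 / d) = q powr (-1 / (d + 1))"
        using d by (simp add: powr_powr)
      finally have "q * q powr (-1 / (d + 1)) \<le> q * M powr (-1 / d)" using q1 by simp
      moreover have "q * q powr (-1 / (d + 1)) = q powr (d / (d + 1))"
        using q1 d powr_mult_base[of q "-1 / (d + 1)"] by (simp add: field_simps)
      ultimately show ?thesis using M1 by linarith
    qed
    moreover have "(\<Sum>i\<in>insert j D. real (card ((\<lambda>f. f(i := 0)) ` Q)))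
        = M + (\<Sum>i\<in>D. real (card ((\<lambda>f. f(i := 0)) ` Q)))"
      unfolding M_def by (rule sum.insert) (use insert.hyps in auto)
    moreover have "(real (card (insert j D)) - 1) / real (card (insert j D)) = d / (d + 1)"
      using insert.hyps by (simp add: d_def add.commute)
    ultimately show ?thesis using main by (simp only: q_def[symmetric])
  qed simp
qed

text \<open>On each line in direction \<open>i\<close> that meets \<open>Q\<close>, the last point
  leaves \<open>Q\<close> when shifted. Every such line gains a point, and \<open>f(i := 0)\<close>
  labels the lines.\<close>

lemma card_shift_union:
  fixes Q :: "('i \<Rightarrow> nat) set"
  assumes "finite Q" "m > 0"
  shows "card Q + card ((\<lambda>f. f(i := 0)) ` Q) \<le> card (Q \<union> (\<lambda>f. f(i := f i + m)) ` Q)"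
proof -
  let ?S = "(\<lambda>f. f(i := f i + m)) ` Q - Q"
  have "(\<lambda>f. f(i := 0)) ` Q \<subseteq> (\<lambda>f. f(i := 0)) ` ?S"
  proof
    fix g assume "g \<in> (\<lambda>f. f(i := 0)) ` Q"
    then obtain f0 where f0: "f0 \<in> Q" "g = f0(i := 0)" by blast
    let ?F = "{f \<in> Q. f(i := 0) = g}"
    have fin: "finite ((\<lambda>f. f i) ` ?F)" and "(\<lambda>f. f i) ` ?F \<noteq> {}" using assms f0 by auto
    then obtain f where f: "f \<in> Q" "f(i := 0) = g" "\<And>h. h \<in> ?F \<Longrightarrow> h i \<le> f i"
      using Max_in[OF fin] Max_ge[OF fin] by (smt (verit) imageE imageI mem_Collect_eq)
    have "f(i := f i + m) \<notin> Q"
      using f(3)[of "f(i := f i + m)"] f(2) assms by auto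
    then show "g \<in> (\<lambda>f. f(i := 0)) ` ?S"
      using f by (intro image_eqI[of _ _ "f(i := f i + m)"]) auto
  qed
  then have "card ((\<lambda>f. f(i := 0)) ` Q) \<le> card ?S"
    using assms by (meson card_image_le card_mono finite_Diff finite_imageI le_trans)
  moreover have "card (Q \<union> ?S) = card Q + card ?S"
    by (rule card_Un_disjoint) (use assms in auto)
  ultimately show ?thesis by (simp add: Un_Diff_cancel)
qed

text \<open>A discrete form of the differential inequality \<open>a' \<ge> c a^((D-1)/D)\<close>,
  whose solutions grow at least like \<open>m^D\<close>.\<close>

lemma growth_lower_bound:
  fixes a :: "nat \<Rightarrow> real"
  assumes D: "D \<ge> 1" and c: "c > 0" and a0: "a 0 \<ge> 1"
    and step: "\<And>m. a (Suc m) \<ge> a m + c * a m powr ((D - 1) / D)"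
  obtains \<epsilon> where "\<epsilon> > 0" "\<And>m. a m \<ge> (\<epsilon> * real m) powr D"
proof -
  \<comment> \<open>For \<open>m \<ge> 1\<close> the increment of \<open>(\<epsilon> m)^D\<close> is
    at most \<open>\<epsilon>^D D (2 m)^(D-1)\<close>, by the mean value theorem and
    \<open>m + 1 \<le> 2 m\<close>; it must not exceed \<open>c (\<epsilon> m)^(D-1)\<close>. The
    bound by 1 serves the step from \<open>m = 0\<close>.\<close>
  define \<epsilon> where "\<epsilon> = min 1 (c / (D * 2 powr (D - 1)))"
  have e: "\<epsilon> > 0" "\<epsilon> \<le> 1" using c D by (auto simp: \<epsilon>_def)
  have "\<epsilon> \<le> c / (D * 2 powr (D - 1))" by (simp add: \<epsilon>_def)
  then have ec: "\<epsilon> * (D * 2 powr (D - 1)) \<le> c" using D by (simp add: field_simps)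
  have a1: "a m \<ge> 1" for m
  proof (induction m)
    case (Suc m)
    have "c * a m powr ((D - 1) / D) \<ge> 0" using c by simp
    then show ?case using step[of m] Suc by linarith
  qed (rule a0)
  have "a m \<ge> (\<epsilon> * real m) powr D" for m
  proof (induction m)
    case 0
    then show ?case using a0 by simp
  next
    case (Suc m)
    show ?case
    proof (cases "m = 0")
      case True
      have "\<epsilon> powr D \<le> 1" using e D powr_mono2[of D \<epsilon> 1] by simp
      then show ?thesis using a1[of 1] True by simp
    next
      case False
      then have m: "real m \<ge> 1" by simp
      have "\<exists>z. real m < z \<and> z < real m + 1 \<and>
          (real m + 1) powr D - real m powr D = (real m + 1 - real m) * (D * z powr (D - 1))"
        using m by (intro MVT2) (auto intro!: derivative_eq_intros simp: powr_diff)
      then obtain z where z: "real m < z" "z < real m + 1" "(real m + 1) powr D - real m powr D = D * z powr (D - 1)"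
        by auto
      have "z powr (D - 1) \<le> (2 * real m) powr (D - 1)" using z m D by (intro powr_mono2) auto
      then have 1: "(real m + 1) powr D - real m powr D \<le> D * (2 powr (D - 1) * real m powr (D - 1))"
        using z(3) D m by (simp add: powr_mult)
      have "(\<epsilon> * real (Suc m)) powr D = \<epsilon> powr D * (real m + 1) powr D"
        using e by (simp add: powr_mult add.commute)
      also have "\<dots> \<le> \<epsilon> powr D * (real m powr D + D * (2 powr (D - 1) * real m powr (D - 1)))"
        using 1 by (intro mult_left_mono) auto
      also have "\<dots> = (\<epsilon> * real m) powr D + (\<epsilon> * (D * 2 powr (D - 1))) * (\<epsilon> * real m) powr (D - 1)"
        using e m powr_mult_base[of \<epsilon> "D - 1"] by (simp add: powr_mult algebra_simps)
      also have "\<dots> \<le> (\<epsilon> * real m) powr D + c * (\<epsilon> * real m) powr (D - 1)"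
        using ec by (intro add_left_mono mult_right_mono) auto
      also have "(\<epsilon> * real m) powr (D - 1) = ((\<epsilon> * real m) powr D) powr ((D - 1) / D)"
        using D by (simp add: powr_powr)
      also have "(\<epsilon> * real m) powr D + c * \<dots> \<le> a m + c * a m powr ((D - 1) / D)"
        using Suc c D by (intro add_mono mult_left_mono powr_mono2) auto
      also have "\<dots> \<le> a (Suc m)" by (rule step)
      finally show ?thesis .
    qed
  qed
  then show ?thesis using that e by blast
qed

lemma growth_exponent_le:
  fixes a :: "nat \<Rightarrow> real"
  assumes "\<epsilon> > 0" "\<And>m. a m \<ge> (\<epsilon> * real m) powr D" "\<And>m. a m \<le> (real k * real m + 1) ^ d"
  shows "D \<le> real d"
proof (rule ccontr)
  assume "\<not> D \<le> real d"
  then have D: "D - real d > 0" by simp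
  \<comment> \<open>By the two bounds on \<open>a\<close>, and as
    \<open>k m + 1 \<le> (k + 1) m\<close>, this constant would dominate \<open>m^(D-d)\<close> for
    all \<open>m \<ge> 1\<close>.\<close>
  define B where "B = (real k + 1) ^ d / \<epsilon> powr D"
  have B: "B > 0" using assms(1) by (simp add: B_def add_nonneg_pos)
  obtain m where m': "real m > max 1 (B powr (1 / (D - real d)))" using reals_Archimedean2 by blast
  have "B = (B powr (1 / (D - real d))) powr (D - real d)" using B D by (simp add: powr_powr)
  also have "\<dots> < real m powr (D - real d)" using m' D by (intro powr_less_mono2) auto
  finally have m: "real m powr (D - real d) > B" "m \<ge> 1" using m' by auto
  have "\<epsilon> powr D * real m powr D \<le> (real k * real m + 1) ^ d"
    using assms(2,3)[of m] assms(1) by (simp add: powr_mult)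
  also have "\<dots> \<le> ((real k + 1) * real m) ^ d" using m by (intro power_mono) (auto simp: algebra_simps)
  also have "\<dots> = (real k + 1) ^ d * real m powr real d" using m by (simp add: power_mult_distrib powr_realpow)
  finally have "real m powr D / real m powr real d \<le> B"
    using m assms(1) by (simp add: B_def field_simps)
  then show False using m by (simp add: powr_diff)
qed

lemma limsup_growth_le:
  fixes a :: "nat \<Rightarrow> real"
  assumes "\<And>m. a m \<ge> 1" "\<And>m. a m \<le> (real k * real m + 1) ^ d"
  shows "limsup (\<lambda>m. ereal (ln (a m) / ln (real m))) \<le> ereal (real d)"
proof -
  have "(\<lambda>m. real d + real d * ln (real k + 1) / ln (real m)) \<longlonglongrightarrow> real d + 0"
    by (intro tendsto_add tendsto_const real_tendsto_divide_at_top[OF tendsto_const]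
        filterlim_compose[OF ln_at_top filterlim_real_sequentially])
  then have lim: "limsup (\<lambda>m. ereal (real d + real d * ln (real k + 1) / ln (real m))) = ereal (real d)"
    by (intro lim_imp_Limsup) auto
  have "eventually (\<lambda>m. ereal (ln (a m) / ln (real m)) \<le> ereal (real d + real d * ln (real k + 1) / ln (real m))) sequentially"
    \<comment> \<open>The denominator \<open>ln (real m)\<close> is positive only from
      \<open>m = 2\<close> on.\<close>
    using eventually_ge_at_top[of 2]
  proof eventually_elim
    case (elim m)
    have "ln (a m) \<le> ln (((real k + 1) * real m) ^ d)"
    proof (subst ln_le_cancel_iff)
      have "(real k * real m + 1) ^ d \<le> ((real k + 1) * real m) ^ d"
        using elim by (intro power_mono) (auto simp: algebra_simps)
      then show "a m \<le> ((real k + 1) * real m) ^ d" using assms(2)[of m] by linarith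
    qed (use assms(1)[of m] elim in auto)
    also have "\<dots> = real d * (ln (real k + 1) + ln (real m))"
      using elim by (simp add: ln_realpow ln_mult)
    finally show ?case using elim by (simp add: field_simps)
  qed
  then have "limsup (\<lambda>m. ereal (ln (a m) / ln (real m)))
      \<le> limsup (\<lambda>m. ereal (real d + real d * ln (real k + 1) / ln (real m)))"
    by (rule Limsup_mono)
  then show ?thesis by (simp only: lim)
qed

lemma limsup_growth_ge:
  fixes a :: "nat \<Rightarrow> real"
  assumes "\<epsilon> > 0" "\<And>m. a m \<ge> (\<epsilon> * real m) powr D"
  shows "ereal D \<le> limsup (\<lambda>m. ereal (ln (a m) / ln (real m)))"
proof -
  have "(\<lambda>m. D + D * ln \<epsilon> / ln (real m)) \<longlonglongrightarrow> D + 0"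
    by (intro tendsto_add tendsto_const real_tendsto_divide_at_top[OF tendsto_const]
        filterlim_compose[OF ln_at_top filterlim_real_sequentially])
  then have lim: "limsup (\<lambda>m. ereal (D + D * ln \<epsilon> / ln (real m))) = ereal D"
    by (intro lim_imp_Limsup) auto
  have "eventually (\<lambda>m. ereal (D + D * ln \<epsilon> / ln (real m)) \<le> ereal (ln (a m) / ln (real m))) sequentially"
    using eventually_ge_at_top[of 2]
  proof eventually_elim
    case (elim m)
    have "ln ((\<epsilon> * real m) powr D) \<le> ln (a m)"
      using assms elim by (subst ln_le_cancel_iff) (auto intro: less_le_trans[OF _ assms(2)])
    then have "D * (ln \<epsilon> + ln (real m)) \<le> ln (a m)" using elim assms by (simp add: ln_powr ln_mult)
    moreover have l: "ln (real m) > 0" using elim by simp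
    ultimately have "D * (ln \<epsilon> + ln (real m)) / ln (real m) \<le> ln (a m) / ln (real m)"
      by (intro divide_right_mono) auto
    moreover have "D * (ln \<epsilon> + ln (real m)) / ln (real m) = D + D * ln \<epsilon> / ln (real m)"
      using l by (simp add: field_simps)
    ultimately show ?case by simp
  qed
  then have "limsup (\<lambda>m. ereal (D + D * ln \<epsilon> / ln (real m))) \<le> limsup (\<lambda>m. ereal (ln (a m) / ln (real m)))"
    by (rule Limsup_mono)
  then show ?thesis by (simp only: lim)
qed

section \<open>Leading monomials\<close>

definition lead :: "cpoly \<Rightarrow> expo" where
  "lead p = Max (support p)"

lemma support_nonempty: "p \<noteq> 0 \<Longrightarrow> support p \<noteq> {}"
  by simp

lemma lead_in_support: "p \<noteq> 0 \<Longrightarrow> lead p \<in> support p"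
  unfolding lead_def by (rule Max_in) (simp_all add: support_nonempty)

lemma lead_ge: "m \<in> support p \<Longrightarrow> m \<le> lead p"
  unfolding lead_def by simp

lemma lead_eqI:
  assumes "coeff_of p m \<noteq> 0" "support p \<subseteq> {..m}"
  shows "lead p = m"
  unfolding lead_def using assms by (intro Max_eqI) (auto simp: in_keys_iff)

lemma lead_add_lower:
  assumes "p \<noteq> 0" "r \<in> supported {..<lead p}"
  shows "p + r \<noteq> 0" "lead (p + r) = lead p"
proof -
  have "coeff_of r (lead p) = 0" using assms(2) by (auto simp: supported_def in_keys_iff)
  then have c: "coeff_of (p + r) (lead p) \<noteq> 0"
    using lead_in_support[OF assms(1)] by (simp add: lookup_add in_keys_iff)
  then show "p + r \<noteq> 0" by auto
  have "support (p + r) \<subseteq> {..lead p}"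
    using keys_add[of p r] assms(2) lead_ge[of _ p] by (fastforce simp: supported_def)
  then show "lead (p + r) = lead p" by (rule lead_eqI[OF c])
qed

lemma lead_mult:
  assumes "p \<noteq> 0" "q \<noteq> 0"
  shows "lead (p * q) = lead p + lead q"
proof -
  let ?a = "lead p" and ?b = "lead q"
  have tail: "f - Poly_Mapping.single (lead f) (coeff_of f (lead f)) \<in> supported {..<lead f}" for f
  proof -
    have "m < lead f" if "coeff_of (f - Poly_Mapping.single (lead f) (coeff_of f (lead f))) m \<noteq> 0" for m
    proof -
      have "m \<noteq> lead f" using that by (auto simp: lookup_minus)
      moreover then have "m \<in> support f" using that by (simp add: lookup_minus lookup_single when_def in_keys_iff)
      ultimately show ?thesis using lead_ge[of m f] by simp
    qed
    then show ?thesis by (auto simp: supported_def in_keys_iff)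
  qed
  define p' where "p' = p - Poly_Mapping.single ?a (coeff_of p ?a)"
  define q' where "q' = q - Poly_Mapping.single ?b (coeff_of q ?b)"
  have p': "p' \<in> supported {..<?a}" and q': "q' \<in> supported {..<?b}"
    unfolding p'_def q'_def by (fact tail)+
  have ca: "coeff_of p ?a \<noteq> 0" and cb: "coeff_of q ?b \<noteq> 0"
    using lead_in_support assms by (auto simp: in_keys_iff)
  have s: "Poly_Mapping.single m z \<in> supported {m}" for m and z :: complex
    by (simp add: supported_def)
  define r where "r = Poly_Mapping.single ?a (coeff_of p ?a) * q' + p' * Poly_Mapping.single ?b (coeff_of q ?b) + p' * q'"
  have r: "r \<in> supported {..<?a + ?b}"
    unfolding r_def
    by (intro supported_add supported_mult[OF s q'] supported_mult[OF p' s] supported_mult[OF p' q'])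
      (auto intro: add_strict_mono)
  have e: "p * q = Poly_Mapping.single (?a + ?b) (coeff_of p ?a * coeff_of q ?b) + r"
    unfolding r_def p'_def q'_def by (simp add: algebra_simps mult_single[symmetric])
  let ?s = "Poly_Mapping.single (?a + ?b) (coeff_of p ?a * coeff_of q ?b)"
  have l: "lead ?s = ?a + ?b" by (rule lead_eqI) (use ca cb in auto)
  have "?s \<noteq> 0" using ca cb by (metis lookup_single_eq lookup_zero no_zero_divisors)
  then show ?thesis using lead_add_lower[of ?s r] r l e by simp
qed

lemma lead_const_mult: "z \<noteq> 0 \<Longrightarrow> lead (const z * p) = lead p"
  unfolding lead_def by (rule arg_cong[of _ _ Max]) (auto simp: in_keys_iff)

text \<open>The largest leading exponent occurs in just one summand and cannot cancel. This gives
  independence in U and, by contraposition, a coincidence of leading exponents in the root relation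
  of an orbit.\<close>

lemma sum_distinct_leads_nonzero:
  assumes "finite A" "A \<noteq> {}" "\<And>x. x \<in> A \<Longrightarrow> f x \<noteq> 0" "inj_on (\<lambda>x. lead (f x)) A"
  shows "(\<Sum>x\<in>A. f x) \<noteq> 0"
proof -
  have "finite ((\<lambda>x. lead (f x)) ` A)" "(\<lambda>x. lead (f x)) ` A \<noteq> {}" using assms by auto
  from Max_in[OF this] obtain y where y: "y \<in> A" "Max ((\<lambda>x. lead (f x)) ` A) = lead (f y)" by blast
  have "(\<Sum>x\<in>A - {y}. f x) \<in> supported {..<lead (f y)}"
  proof (rule supported_sum)
    fix x assume x: "x \<in> A - {y}"
    then have "lead (f x) \<le> lead (f y)" unfolding y(2)[symmetric] using assms(1) by simp
    moreover have "lead (f x) \<noteq> lead (f y)" using assms(4) x y(1) by (auto dest: inj_onD)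
    ultimately show "f x \<in> supported {..<lead (f y)}"
      using lead_ge[of _ "f x"] by (force simp: supported_def)
  qed
  then have "f y + (\<Sum>x\<in>A - {y}. f x) \<noteq> 0" using lead_add_lower(1) assms(3) y(1) by blast
  then show ?thesis using assms(1) y(1) by (simp add: sum.remove)
qed

text \<open>Coordinate 0 is compared first, and on exponents of words it is the degree; so
  remainders of lower degree never reach a leading exponent.\<close>

lemma expo_less_degree:
  fixes a b :: expo
  shows "Poly_Mapping.lookup a 0 < Poly_Mapping.lookup b 0 \<Longrightarrow> a < b"
  by (auto simp: less_poly_mapping.rep_eq less_fun_def intro!: exI[of _ 0])

context deformed_commutation
begin

section \<open>Leading exponents of orbit elements\<close>

lemma expos_iff: "m \<in> expos n \<longleftrightarrow> m \<in> range word_expo \<and> Poly_Mapping.lookup m 0 < n"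
  unfolding expos_def by (auto simp: lookup_word_expo_0)

lemma support_nform: "finite_supp b \<Longrightarrow> support (nform b) \<subseteq> range word_expo"
  using nform_supported[of b] by (auto simp: supported_def expos_iff)

lemma nform_supported_lead:
  assumes "finite_supp b"
  shows "nform b \<in> supported (expos (Suc (Poly_Mapping.lookup (lead (nform b)) 0)))"
proof -
  have "Poly_Mapping.lookup m 0 \<le> Poly_Mapping.lookup (lead (nform b)) 0" if "m \<in> support (nform b)" for m
    using lead_ge[OF that] expo_less_degree[of "lead (nform b)" m] by (meson leD leI)
  then show ?thesis using support_nform[OF assms] by (force simp: supported_def expos_iff)
qed

lemma orbit_sym_supported: "support (orbit_sym v k) \<subseteq> word_expo ` {w. length w = k}"
proof -
  have "orbit_sym v k \<in> supported (word_expo ` {w. length w = k})"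
    unfolding orbit_sym_def
  proof (rule supported_sum)
    fix gs assume "gs \<in> arrangements k"
    then have l: "length (map (\<lambda>g. g *v v) gs) = k" by (simp add: arrangements_def)
    have "mext monomial (map (\<lambda>g. g *v v) gs) \<in> supported (word_expo ` {w. length w = k})"
      by (rule mext_supported) (use l in \<open>auto simp: supported_def\<close>)
    then show "(\<Prod>g\<leftarrow>gs. linear_form (g *v v)) \<in> supported (word_expo ` {w. length w = k})"
      by (simp add: mext_monomial o_def)
  qed
  then show ?thesis by (simp add: supported_def)
qed

lemma lead_orbit_sym:
  assumes "orbit_sym v k \<noteq> 0"
  obtains w where "lead (orbit_sym v k) = word_expo w" "length w = k"
  using lead_in_support[OF assms] orbit_sym_supported by blast

text \<open>The noncommutative error has smaller degree than the leading exponent of the commutative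
  product, hence lies below it in the order and cannot disturb it.\<close>

lemma lead_orbit_element_mult:
  assumes b: "b \<in> spherical_part" "nform b \<noteq> 0" and nz: "orbit_sym v k \<noteq> 0"
  shows "nform (sk_mult (orbit_element v k) b) \<noteq> 0"
    and "lead (nform (sk_mult (orbit_element v k) b)) = lead (orbit_sym v k) + lead (nform b)"
proof -
  let ?n = "Poly_Mapping.lookup (lead (nform b)) 0"
  let ?r = "nform (sk_mult (orbit_element v k) b) - orbit_sym v k * nform b"
  let ?p = "orbit_sym v k * nform b"
  have fb: "finite_supp b" using b spherical_skel skel_finite_supp by blast
  have r: "?r \<in> supported (expos (k + ?n))"
    by (rule nform_orbit_element_mult[OF b(1) nform_supported_lead[OF fb]])
  obtain w where w: "lead (orbit_sym v k) = word_expo w" "length w = k" using lead_orbit_sym[OF nz] .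
  have l: "lead ?p = lead (orbit_sym v k) + lead (nform b)" by (rule lead_mult[OF nz b(2)])
  have p: "?p \<noteq> 0" using nz b(2) by simp
  have "Poly_Mapping.lookup (lead ?p) 0 = k + ?n" by (simp add: l w lookup_add lookup_word_expo_0)
  then have "expos (k + ?n) \<subseteq> {..<lead ?p}" by (auto simp: expos_iff intro: expo_less_degree)
  then have r': "?r \<in> supported {..<lead ?p}" using r supported_mono by blast
  have e: "nform (sk_mult (orbit_element v k) b) = ?p + ?r" by simp
  show "nform (sk_mult (orbit_element v k) b) \<noteq> 0"
    using lead_add_lower(1)[OF p r'] unfolding e[symmetric] .
  show "lead (nform (sk_mult (orbit_element v k) b)) = lead (orbit_sym v k) + lead (nform b)"
    using lead_add_lower(2)[OF p r'] unfolding e[symmetric] l .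
qed

text \<open>Every \<open>k\<close>-subset of the group has \<open>k!\<close> orderings, and
  commuting linear forms do not distinguish them.\<close>

lemma orbit_sym_eq:
  "orbit_sym v k = const (fact k) * (\<Sum>S | S \<subseteq> G \<and> card S = k. \<Prod>g\<in>S. linear_form (g *v v))"
proof -
  let ?A = "{S. S \<subseteq> G \<and> card S = k}"
  have finA: "finite ?A" using finite_G by simp
  have finS: "finite S" if "S \<in> ?A" for S using that finite_G finite_subset by blast
  have u: "arrangements k = (\<Union>S\<in>?A. permutations_of_set S)"
    by (auto simp: arrangements_def permutations_of_set_def distinct_card)
  have "orbit_sym v k = (\<Sum>S\<in>?A. \<Sum>gs\<in>permutations_of_set S. \<Prod>g\<leftarrow>gs. linear_form (g *v v))"
    unfolding orbit_sym_def u
  proof (rule sum.UNION_disjoint[OF finA])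
    show "\<forall>S\<in>?A. finite (permutations_of_set S)" by simp
  qed (auto simp: permutations_of_set_def)
  also have "\<dots> = (\<Sum>S\<in>?A. \<Sum>gs\<in>permutations_of_set S. \<Prod>g\<in>S. linear_form (g *v v))"
  proof (intro sum.cong refl)
    fix S :: "(complex^'n^'n) set" and gs assume "gs \<in> permutations_of_set S"
    then have "distinct gs" "set gs = S" by (auto simp: permutations_of_set_def)
    then show "(\<Prod>g\<leftarrow>gs. linear_form (g *v v)) = (\<Prod>g\<in>S. linear_form (g *v v))"
      using prod.distinct_set_conv_list[of gs "\<lambda>g. linear_form (g *v v)"] by simp
  qed
  also have "\<dots> = (\<Sum>S\<in>?A. const (fact k) * (\<Prod>g\<in>S. linear_form (g *v v)))"
  proof (rule sum.cong[OF refl])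
    fix S assume S: "S \<in> ?A"
    have "(of_nat (fact k) :: cpoly) = const (fact k)"
      by (metis const_def of_nat_fact single_of_nat)
    then show "(\<Sum>gs\<in>permutations_of_set S. \<Prod>g\<in>S. linear_form (g *v v)) = const (fact k) * (\<Prod>g\<in>S. linear_form (g *v v))"
      using S finS[OF S] by simp
  qed
  finally show ?thesis by (simp add: sum_distrib_left)
qed

text \<open>The linear form of \<open>v\<close> is a root of the monic polynomial with roots its \<open>G\<close>-translates.\<close>

lemma orbit_sym_relation:
  "(\<Sum>k\<le>card G. const ((-1) ^ k / fact k) * (orbit_sym v k * linear_form v ^ (card G - k))) = 0"
proof -
  let ?x = "linear_form v" and ?y = "\<lambda>g. linear_form (g *v v)"
  have "0 = (\<Prod>g\<in>G. (- ?y g) + ?x)"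
    using finite_G one_G by (intro prod_zero[symmetric]) (auto intro!: bexI[of _ "mat 1"])
  also have "\<dots> = (\<Sum>S\<in>Pow G. (\<Prod>g\<in>S. - ?y g) * (\<Prod>g\<in>G - S. ?x))"
    by (rule prod_add[OF finite_G])
  also have "\<dots> = (\<Sum>S\<in>Pow G. (-1) ^ card S * (\<Prod>g\<in>S. ?y g) * ?x ^ (card G - card S))"
  proof (rule sum.cong[OF refl])
    fix S assume "S \<in> Pow G"
    then have "card (G - S) = card G - card S" using finite_G by (intro card_Diff_subset) (auto intro: finite_subset)
    moreover have "(\<Prod>g\<in>S. - ?y g) = (-1) ^ card S * (\<Prod>g\<in>S. ?y g)"
      using prod.distrib[of "\<lambda>_. -1" ?y S] by simp
    ultimately show "(\<Prod>g\<in>S. - ?y g) * (\<Prod>g\<in>G - S. ?x) = (-1) ^ card S * (\<Prod>g\<in>S. ?y g) * ?x ^ (card G - card S)"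
      by simp
  qed
  also have "\<dots> = (\<Sum>k\<le>card G. \<Sum>S\<in>{S\<in>Pow G. card S = k}. (-1) ^ card S * (\<Prod>g\<in>S. ?y g) * ?x ^ (card G - card S))"
    using finite_G by (intro sum.group[symmetric]) (auto intro: card_mono)
  also have "\<dots> = (\<Sum>k\<le>card G. const ((-1) ^ k / fact k) * (orbit_sym v k * linear_form v ^ (card G - k)))"
  proof (rule sum.cong[OF refl])
    fix k
    have c: "const ((-1) ^ k / fact k) * const (fact k) = (-1) ^ k"
    proof -
      have "const ((-1) ^ k / fact k) * const (fact k) = const ((-1) ^ k)"
        by (simp add: const_mult[symmetric])
      also have "\<dots> = (-1) ^ k" by (induction k) (simp_all add: const_uminus)
      finally show ?thesis .
    qed
    have "(\<Sum>S\<in>{S\<in>Pow G. card S = k}. (-1) ^ card S * (\<Prod>g\<in>S. ?y g) * ?x ^ (card G - card S))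
        = (-1) ^ k * (\<Sum>S | S \<subseteq> G \<and> card S = k. \<Prod>g\<in>S. ?y g) * ?x ^ (card G - k)"
      by (simp add: sum_distrib_left sum_distrib_right)
    then show "(\<Sum>S\<in>{S\<in>Pow G. card S = k}. (-1) ^ card S * (\<Prod>g\<in>S. ?y g) * ?x ^ (card G - card S))
        = const ((-1) ^ k / fact k) * (orbit_sym v k * ?x ^ (card G - k))"
      unfolding orbit_sym_eq c[symmetric] by (simp only: mult.assoc)
  qed
  finally show ?thesis by simp
qed

lemma linear_form_axis: "linear_form (ax i) = monomial [i]"
  unfolding linear_form_def by (simp add: sum_axis)

lemma monomial_power: "monomial [i] ^ m = monomial (replicate m i)"
proof (induction m)
  case (Suc m)
  then show ?case using monomial_append[of "[i]" "replicate m i"] by simp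
qed simp

text \<open>The terms of \<open>orbit_sym_relation\<close> add up to zero, so two of the nonzero
  ones share their leading exponent. Cancelling the common power of the variable leaves the power
  \<open>l - k\<close>. Nothing is known about which pair it is, and only its existence
  matters.\<close>

lemma orbit_sym_leads:
  obtains k l where "k < l" "l \<le> card G" "orbit_sym (ax i) k \<noteq> 0" "orbit_sym (ax i) l \<noteq> 0"
    "lead (orbit_sym (ax i) l) = lead (orbit_sym (ax i) k) + word_expo (replicate (l - k) i)"
proof -
  note goal = that
  let ?s = "orbit_sym (ax i)" and ?N = "card G"
  let ?K = "{k. k \<le> ?N \<and> ?s k \<noteq> 0}"
  let ?t = "\<lambda>k. const ((-1) ^ k / fact k) * (?s k * linear_form (ax i) ^ (?N - k))"
  have x: "linear_form (ax i) ^ m = Poly_Mapping.single (word_expo (replicate m i)) 1" for m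
    by (simp add: linear_form_axis monomial_power)
  have xnz: "linear_form (ax i) ^ m \<noteq> 0" for m
    unfolding x by (metis lookup_single_eq lookup_zero zero_neq_one)
  have t0: "?t k \<noteq> 0" and tl: "lead (?t k) = lead (?s k) + word_expo (replicate (?N - k) i)" if "k \<in> ?K" for k
  proof -
    have c: "((-1) ^ k / fact k :: complex) \<noteq> 0" by simp
    have "const ((-1) ^ k / fact k) \<noteq> 0" using c by (metis const_0 const_inject)
    then show "?t k \<noteq> 0" unfolding mult_eq_0_iff using xnz[of "?N - k"] that by blast
    have "lead (linear_form (ax i) ^ (?N - k)) = word_expo (replicate (?N - k) i)"
      unfolding x by (rule lead_eqI) auto
    then show "lead (?t k) = lead (?s k) + word_expo (replicate (?N - k) i)"
      using lead_const_mult[OF c] lead_mult[OF _ xnz] that by simp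
  qed
  \<comment> \<open>The empty product makes \<open>orbit_sym\<close> equal to 1 at index 0, so the
    set of nonzero terms is not empty.\<close>
  have "arrangements 0 = {[]}" by (auto simp: arrangements_def)
  then have K0: "0 \<in> ?K" by (simp add: orbit_sym_def)
  have "(\<Sum>k\<in>?K. ?t k) = (\<Sum>k\<le>?N. ?t k)"
    by (rule sum.mono_neutral_left) auto
  then have "(\<Sum>k\<in>?K. ?t k) = 0" by (simp only: orbit_sym_relation)
  then have "\<not> inj_on (\<lambda>k. lead (?t k)) ?K"
    using sum_distinct_leads_nonzero[of ?K ?t] K0 t0 by fastforce
  then obtain k l where kl: "k \<in> ?K" "l \<in> ?K" "k \<noteq> l" "lead (?t k) = lead (?t l)"
    unfolding inj_on_def by blast
  have *: thesis if "k \<in> ?K" "l \<in> ?K" "k < l" "lead (?t k) = lead (?t l)" for k l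
  proof -
    have "word_expo (replicate (?N - k) i) = word_expo (replicate (l - k) i) + word_expo (replicate (?N - l) i)"
      using that by (simp add: word_expo_append[symmetric] replicate_add[symmetric])
    then have "lead (?s k) + word_expo (replicate (l - k) i) + word_expo (replicate (?N - l) i) = lead (?s l) + word_expo (replicate (?N - l) i)"
      using tl that by (simp add: add.assoc)
    then have "lead (?s l) = lead (?s k) + word_expo (replicate (l - k) i)" by (simp only: add_right_cancel)
    then show thesis using goal[of k l] that by blast
  qed
  show thesis using *[of k l] *[of l k] kl by (metis linorder_neqE_nat)
qed

end

section \<open>The forms \<open>omega_s\<close> of a symplectic triple\<close>

lemma sform_add_left: "sform Om (x + y) z = sform Om x z + sform Om y z"
  by (simp add: sform_def sum.distrib distrib_right)

lemma sform_scale_left: "sform Om (a *s x) z = a * sform Om x z"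
  by (simp add: sform_def sum_distrib_left mult.assoc)

lemma sform_add_right: "sform Om z (x + y) = sform Om z x + sform Om z y"
  by (simp add: sform_def sum.distrib distrib_left matrix_vector_right_distrib)

lemma sform_scale_right: "sform Om z (a *s x) = a * sform Om z x"
  by (simp add: sform_def sum_distrib_left vector_scalar_commute mult.left_commute)

lemma sform_diff_left: "sform Om (x - y) z = sform Om x z - sform Om y z"
  using sform_add_left[of Om "x - y" y z] by simp

lemma sform_0_left [simp]: "sform Om 0 z = 0"
  by (simp add: sform_def)

lemma sform_0_right [simp]: "sform Om z 0 = 0"
  by (simp add: sform_def)

primrec mpow :: "complex^'n::finite^'n \<Rightarrow> nat \<Rightarrow> complex^'n^'n" where
  "mpow s 0 = mat 1"
| "mpow s (Suc k) = s ** mpow s k"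

lemma mpow_add: "mpow s (i + j) = mpow s i ** mpow s j"
  by (induction i) (simp_all add: matrix_mul_assoc)

lemma mpow_commute: "s ** mpow s k = mpow s k ** s"
  by (induction k) (simp_all add: matrix_mul_assoc)

text \<open>Expanding every row in a two-element basis of the row space factors \<open>M\<close>
  through dimension two; the two columns of coefficients then span all values.\<close>

lemma rank_two_range:
  fixes M :: "complex^'n::finite^'n"
  assumes "rank M = 2"
  obtains a b where "\<And>x. \<exists>p q. M *v x = p *s a + q *s b"
proof -
  obtain B where B: "B \<subseteq> rows M" "vec.independent B" "rows M \<subseteq> vec.span B" "card B = vec.dim (rows M)"
    using vec.basis_exists by blast
  then have "card B = 2" using assms by (simp add: row_rank_def_gen)
  then obtain r1 r2 where r: "B = {r1, r2}" by (auto simp: card_2_iff)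
  have "\<exists>c d. row i M = c *s r1 + d *s r2" for i
  proof -
    have "row i M \<in> vec.span {r1, r2}" using B(3) r by (auto simp: rows_def)
    then obtain c d where "row i M - c *s r1 = d *s r2"
      by (auto simp: vec.span_insert vec.span_singleton)
    then show ?thesis by (metis add.commute diff_add_cancel)
  qed
  then obtain c d where cd: "\<And>i. row i M = c i *s r1 + d i *s r2" by metis
  have "M *v x = (\<Sum>j\<in>UNIV. r1 $ j * x $ j) *s (\<chi> i. c i) + (\<Sum>j\<in>UNIV. r2 $ j * x $ j) *s (\<chi> i. d i)" for x
  proof -
    have "(M *v x) $ i = (\<Sum>j\<in>UNIV. r1 $ j * x $ j) * c i + (\<Sum>j\<in>UNIV. r2 $ j * x $ j) * d i" for i
    proof -
      have "M $ i $ j = c i * r1 $ j + d i * r2 $ j" for j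
        using cd[of i] by (simp add: row_def vec_eq_iff)
      then show ?thesis
        by (simp add: matrix_vector_mult_def sum_distrib_left sum.distrib algebra_simps)
    qed
    then show ?thesis by (simp add: vec_eq_iff)
  qed
  then show ?thesis using that by blast
qed

text \<open>Applied to a conjugation and to its inverse, the bounds show that conjugates of
  symplectic reflections are symplectic reflections.\<close>

lemma rank_mult_le:
  fixes A B :: "complex^'n::finite^'n"
  shows "rank (A ** B) \<le> rank A" "rank (A ** B) \<le> rank B"
proof -
  have "rows (A ** B) = (\<lambda>x. x v* B) ` rows A"
  proof -
    have "row i (A ** B) = row i A v* B" for i
      by (simp add: vec_eq_iff row_def vector_matrix_mult_def matrix_matrix_mult_def mult.commute)
    then show ?thesis by (auto simp: rows_def)
  qed
  moreover have "Vector_Spaces.linear (*s) (*s) (\<lambda>x :: complex^'n. x v* B)"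
    by unfold_locales (simp_all add: vec_eq_iff vector_matrix_mult_def sum.distrib algebra_simps sum_distrib_left)
  ultimately show "rank (A ** B) \<le> rank A"
    unfolding row_rank_def_gen using vec.dim_image_le by metis
  have "row i (A ** B) \<in> vec.span (rows B)" for i
  proof -
    have "row i (A ** B) = (\<Sum>j\<in>UNIV. A $ i $ j *s row j B)"
      by (simp add: vec_eq_iff row_def matrix_matrix_mult_def)
    also have "\<dots> \<in> vec.span (rows B)"
      by (intro vec.span_sum vec.span_scale vec.span_base) (auto simp: rows_def)
    finally show ?thesis .
  qed
  then have "rows (A ** B) \<subseteq> vec.span (rows B)" by (auto simp: rows_def)
  then show "rank (A ** B) \<le> rank B"
    unfolding row_rank_def_gen by (metis vec.dim_span vec.dim_subset)
qed

section \<open>Fixed and moved vectors of a group element\<close>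

locale sympl_group =
  fixes Om :: "complex^'n::finite^'n" and G :: "(complex^'n^'n) set"
  assumes triple: "symplectic_triple Om G"
begin

lemma skew: "sform Om x y = - sform Om y x"
  and nondegenerate: "(\<And>y. sform Om x y = 0) \<Longrightarrow> x = 0"
  and finite_group: "finite G"
  and one_group: "mat 1 \<in> G"
  and mult_group: "g \<in> G \<Longrightarrow> h \<in> G \<Longrightarrow> g ** h \<in> G"
  and inv_group: "g \<in> G \<Longrightarrow> invertible g \<and> matrix_inv g \<in> G"
  and invariant: "g \<in> G \<Longrightarrow> sform Om (g *v x) (g *v y) = sform Om x y"
  using triple unfolding symplectic_triple_def by blast+

lemma mpow_in: "s \<in> G \<Longrightarrow> mpow s k \<in> G"
  by (induction k) (simp_all add: one_group mult_group)

lemma finite_order: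
  assumes "s \<in> G"
  obtains m where "m > 0" "mpow s m = mat 1"
proof -
  have "\<not> inj (mpow s)"
    using finite_group mpow_in[OF assms] by (metis finite_subset image_subsetI infinite_UNIV_nat finite_imageD)
  then obtain i j where ij: "i < j" "mpow s i = mpow s j"
    by (metis injI linorder_neqE_nat)
  have "mpow s i ** mpow s (j - i) = mpow s i ** mat 1"
    using mpow_add[of s i "j - i"] ij by simp
  moreover obtain h where "h ** mpow s i = mat 1"
    using inv_group[OF mpow_in[OF assms, of i]] by (auto simp: invertible_def)
  ultimately have "mpow s (j - i) = mat 1" by (metis matrix_mul_assoc matrix_mul_lid)
  then show ?thesis using that[of "j - i"] ij by simp
qed

text \<open>As \<open>s\<close> has finite order, the average \<open>A\<close> over its powers
  exists and is the projection onto the fixed vectors. The complement \<open>1 - A\<close> takes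
  values in im(1 - s) because \<open>x - s^k x\<close> telescopes.\<close>

lemma moved_part_exists:
  assumes s: "s \<in> G"
  shows "\<exists>P. (\<forall>x y. P (x + y) = P x + P y) \<and> (\<forall>a x. P (a *s x) = a *s P x) \<and>
     (\<forall>x. P x \<in> range ((*v) (mat 1 - s))) \<and> (\<forall>x. s *v (x - P x) = x - P x) \<and>
     (\<forall>x. P (x - s *v x) = x - s *v x) \<and> (\<forall>x. s *v x = x \<longrightarrow> P x = 0)"
proof -
  obtain m where m: "m > 0" "mpow s m = mat 1" using finite_order[OF s] .
  define A where "A x = (1 / of_nat m) *s (\<Sum>k<m. mpow s k *v x)" for x :: "complex^'n"
  have A_add: "A (x + y) = A x + A y" for x y
    by (simp add: A_def matrix_vector_right_distrib sum.distrib vector_add_ldistrib)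
  have A_scale: "A (a *s x) = a *s A x" for a x
    by (simp add: A_def vector_scalar_commute vec.scale_sum_right mult.commute)
  have shift: "(\<Sum>k<m. mpow s (Suc k) *v x) = (\<Sum>k<m. mpow s k *v x)" for x
  proof -
    have "(\<Sum>k<m. mpow s k *v x) + x = (\<Sum>k<Suc m. mpow s k *v x)"
      by (simp only: sum.lessThan_Suc m(2) matrix_vector_mul_lid)
    also have "\<dots> = x + (\<Sum>k<m. mpow s (Suc k) *v x)"
      by (simp only: sum.lessThan_Suc_shift mpow.simps(1) matrix_vector_mul_lid)
    finally show ?thesis by simp
  qed
  have sA: "s *v A x = A x" for x
  proof -
    have "s *v A x = (1 / of_nat m) *s (\<Sum>k<m. mpow s (Suc k) *v x)"
      by (simp add: A_def vector_scalar_commute vec.linear_sum[OF matrix_vector_mul_linear_gen] matrix_vector_mul_assoc)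
    then show ?thesis by (simp only: shift A_def)
  qed
  have As: "A (s *v x) = A x" for x
  proof -
    have "A (s *v x) = (1 / of_nat m) *s (\<Sum>k<m. mpow s (Suc k) *v x)"
      by (simp add: A_def matrix_vector_mul_assoc mpow_commute)
    then show ?thesis by (simp only: shift A_def)
  qed
  have A_diff: "A (x - y) = A x - A y" for x y
    using A_add[of "x - y" y] by simp
  have A_fixed: "A x = x" if "s *v x = x" for x
  proof -
    have "mpow s k *v x = x" for k
      by (induction k) (simp_all add: matrix_vector_mul_assoc[symmetric] that)
    then have "A x = (1 / of_nat m) *s (of_nat m *s x)"
      by (simp add: A_def vec_eq_iff)
    then show ?thesis using m by simp
  qed
  have range_sub: "vec.subspace (range ((*v) (mat 1 - s)))"
    by (rule vec.linear_subspace_image[OF matrix_vector_mul_linear_gen]) simp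
  have telescope: "x - mpow s k *v x \<in> range ((*v) (mat 1 - s))" for x k
  proof (induction k)
    case 0
    then show ?case using vec.subspace_0[OF range_sub] by simp
  next
    case (Suc k)
    have "x - mpow s (Suc k) *v x = (x - mpow s k *v x) + (mat 1 - s) *v (mpow s k *v x)"
      by (simp add: matrix_vector_mult_diff_rdistrib matrix_vector_mul_assoc[symmetric])
    then show ?case using vec.subspace_add[OF range_sub Suc] by (metis rangeI)
  qed
  have A_range: "x - A x \<in> range ((*v) (mat 1 - s))" for x
  proof -
    have "x - A x = (1 / of_nat m) *s (\<Sum>k<m. x - mpow s k *v x)"
    proof -
      have "(\<Sum>k<m. x - mpow s k *v x) $ i = of_nat m * x $ i - (\<Sum>k<m. mpow s k *v x) $ i" for i
        by (simp only: sum_component vector_minus_component) (simp add: sum_subtractf)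
      then show ?thesis using m(1) by (simp add: A_def vec_eq_iff field_simps del: sum_component)
    qed
    also have "\<dots> \<in> range ((*v) (mat 1 - s))"
      by (intro vec.subspace_scale[OF range_sub] vec.subspace_sum[OF range_sub] telescope)
    finally show ?thesis .
  qed
  show ?thesis
  proof (intro exI[of _ "\<lambda>x. x - A x"] conjI allI impI)
    fix x y :: "complex^'n" and a
    show "x + y - A (x + y) = x - A x + (y - A y)" by (simp add: A_add)
    show "a *s x - A (a *s x) = a *s (x - A x)" by (simp add: A_scale vec.scale_right_diff_distrib)
    show "x - A x \<in> range ((*v) (mat 1 - s))" by (rule A_range)
    show "s *v (x - (x - A x)) = x - (x - A x)" by (simp add: sA)
    show "x - s *v x - A (x - s *v x) = x - s *v x" by (simp add: A_diff As)
    show "x - A x = 0" if "s *v x = x" using A_fixed[OF that] by simp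
  qed
qed

text \<open>The projection onto im(1 - s) along ker(1 - s).\<close>

definition moved :: "complex^'n^'n \<Rightarrow> complex^'n \<Rightarrow> complex^'n" where
  "moved s = (SOME P. (\<forall>x y. P (x + y) = P x + P y) \<and> (\<forall>a x. P (a *s x) = a *s P x) \<and>
     (\<forall>x. P x \<in> range ((*v) (mat 1 - s))) \<and> (\<forall>x. s *v (x - P x) = x - P x) \<and>
     (\<forall>x. P (x - s *v x) = x - s *v x) \<and> (\<forall>x. s *v x = x \<longrightarrow> P x = 0))"

context
  fixes s assumes s: "s \<in> G"
begin

lemma moved_add: "moved s (x + y) = moved s x + moved s y"
  and moved_scale: "moved s (a *s x) = a *s moved s x"
  and moved_range: "moved s x \<in> range ((*v) (mat 1 - s))"
  and moved_rest: "s *v (x - moved s x) = x - moved s x"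
  and moved_id: "moved s (x - s *v x) = x - s *v x"
  and moved_fixed: "s *v x = x \<Longrightarrow> moved s x = 0"
  using someI_ex[OF moved_part_exists[OF s]] unfolding moved_def[symmetric] by blast+

lemma moved_range': "\<exists>z. moved s x = z - s *v z"
  using moved_range[of x] by (auto simp: matrix_vector_mult_diff_rdistrib)

lemma fixed_orthogonal_moved: "s *v u = u \<Longrightarrow> sform Om (moved s x) u = 0"
proof -
  assume u: "s *v u = u"
  obtain z where z: "moved s x = z - s *v z" using moved_range' by blast
  have "sform Om (s *v z) u = sform Om z u" using invariant[OF s, of z u] u by simp
  then show ?thesis by (simp add: z sform_diff_left)
qed

text \<open>The pullback of omega along the projection has the demanded properties; its radical is
  ker(1 - s) because im(1 - s) is orthogonal to ker(1 - s) and omega is nondegenerate. Conversely, a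
  form with this radical is determined by its values on im(1 - s), so the definite description is
  justified.\<close>

lemma omega_s_eq: "omega_s Om s x y = sform Om (moved s x) (moved s y)"
proof -
  let ?f = "\<lambda>x y. sform Om (moved s x) (moved s y)"
  have ker: "(mat 1 - s) *v x = 0 \<longleftrightarrow> s *v x = x" for x
    by (auto simp: matrix_vector_mult_diff_rdistrib)
  have rad: "(\<forall>y. ?f x y = 0) \<longleftrightarrow> s *v x = x" for x
  proof
    assume *: "\<forall>y. ?f x y = 0"
    have "sform Om (moved s x) y = 0" for y
    proof -
      have "sform Om (moved s x) (y - moved s y) = 0"
        by (rule fixed_orthogonal_moved[OF moved_rest])
      then show ?thesis using * sform_add_right[of Om "moved s x" "y - moved s y" "moved s y"] by simp
    qed
    then have "moved s x = 0" by (rule nondegenerate)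
    then show "s *v x = x" using moved_rest[of x] by simp
  qed (simp add: moved_fixed)
  have "omega_s Om s = ?f"
    unfolding omega_s_def
  proof (rule the_equality)
    show "(\<forall>x x' y. ?f (x + x') y = ?f x y + ?f x' y) \<and> (\<forall>a x y. ?f (a *s x) y = a * ?f x y) \<and>
     (\<forall>x y. ?f x y = - ?f y x) \<and> {x. \<forall>y. ?f x y = 0} = {x. (mat 1 - s) *v x = 0} \<and>
     (\<forall>x\<in>range ((*v) (mat 1 - s)). \<forall>y\<in>range ((*v) (mat 1 - s)). ?f x y = sform Om x y)"
    proof (intro conjI allI ballI)
      fix x y assume "x \<in> range ((*v) (mat 1 - s))" "y \<in> range ((*v) (mat 1 - s))"
      then have "moved s x = x" "moved s y = y"
        by (auto simp: matrix_vector_mult_diff_rdistrib moved_id)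
      then show "?f x y = sform Om x y" by simp
    next
      show "?f x y = - ?f y x" for x y by (rule skew)
    qed (simp_all add: moved_add moved_scale sform_add_left sform_scale_left rad ker)
  next
    fix f :: "complex^'n \<Rightarrow> complex^'n \<Rightarrow> complex"
    assume f: "(\<forall>x x' y. f (x + x') y = f x y + f x' y) \<and> (\<forall>a x y. f (a *s x) y = a * f x y) \<and>
     (\<forall>x y. f x y = - f y x) \<and> {x. \<forall>y. f x y = 0} = {x. (mat 1 - s) *v x = 0} \<and>
     (\<forall>x\<in>range ((*v) (mat 1 - s)). \<forall>y\<in>range ((*v) (mat 1 - s)). f x y = sform Om x y)"
    then have add: "f (x + x') y = f x y + f x' y" and sk: "f x y = - f y x"
      and agree: "x \<in> range ((*v) (mat 1 - s)) \<Longrightarrow> y \<in> range ((*v) (mat 1 - s)) \<Longrightarrow> f x y = sform Om x y" for x x' y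
      by blast+
    have z: "f (x - moved s x) y = 0" for x y
    proof -
      have "x - moved s x \<in> {x. \<forall>y. f x y = 0}" using f moved_rest[of x] ker by blast
      then show ?thesis by simp
    qed
    have left: "f x y = f (moved s x) y" for x y
      using add[of "x - moved s x" "moved s x" y] z by simp
    have "f x y = ?f x y" for x y
      using left[of x y] sk[of "moved s x" y] left[of y "moved s x"] sk[of "moved s y" "moved s x"]
        agree[OF moved_range moved_range, of x y] by simp
    then show "f = ?f" by blast
  qed
  then show ?thesis by simp
qed

end

text \<open>Conjugation by \<open>g\<close> carries the fixed vectors and the range of
  \<open>1 - s\<close> to those of the conjugate, hence one projection to the other.\<close>

lemma moved_conj:
  assumes "g \<in> G" "s \<in> G" "h \<in> G" "g ** h = mat 1"
  shows "moved (g ** s ** h) (g *v x) = g *v moved s x"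
proof -
  have hg: "h ** g = mat 1" using assms(4) matrix_left_right_inverse by blast
  have S: "g ** s ** h \<in> G" using assms mult_group by blast
  have conj: "(g ** s ** h) *v (g *v y) = g *v (s *v y)" for y
    by (simp add: matrix_vector_mul_assoc matrix_mul_assoc[symmetric] hg)
  obtain z where z: "moved s x = z - s *v z" using moved_range'[OF assms(2)] by blast
  have "moved (g ** s ** h) (g *v (x - moved s x)) = 0"
    by (rule moved_fixed[OF S]) (simp only: conj moved_rest[OF assms(2)])
  moreover have "moved (g ** s ** h) (g *v moved s x) = g *v moved s x"
    using moved_id[OF S, of "g *v z"] by (simp add: conj z matrix_vector_mult_diff_distrib)
  moreover have "g *v x = g *v (x - moved s x) + g *v moved s x"
    by (simp add: matrix_vector_mult_diff_distrib)
  ultimately show ?thesis using moved_add[OF S, of "g *v (x - moved s x)" "g *v moved s x"] by simp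
qed

lemma omega_s_conj:
  assumes "g \<in> G" "s \<in> G" "h \<in> G" "g ** h = mat 1"
  shows "omega_s Om (g ** s ** h) (g *v x) (g *v y) = omega_s Om s x y"
proof -
  have "g ** s ** h \<in> G" using assms mult_group by blast
  then show ?thesis by (simp add: omega_s_eq assms(2) moved_conj[OF assms] invariant[OF assms(1)])
qed

lemma refls_conj:
  assumes "g \<in> G" "h \<in> G" "g ** h = mat 1" "s \<in> G"
  shows "g ** s ** h \<in> sympl_refls G \<longleftrightarrow> s \<in> sympl_refls G"
proof -
  have hg: "h ** g = mat 1" using assms(3) matrix_left_right_inverse by blast
  have e: "mat 1 - g ** s ** h = g ** (mat 1 - s) ** h"
  proof -
    have "g *v (h *v x) = x" for x by (simp add: matrix_vector_mul_assoc assms(3))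
    then show ?thesis
      by (simp add: matrix_eq matrix_vector_mul_assoc[symmetric] matrix_vector_mult_diff_rdistrib
        matrix_vector_mult_diff_distrib)
  qed
  have "h ** (g ** (mat 1 - s) ** h) ** g = (h ** g) ** (mat 1 - s) ** (h ** g)"
    by (simp add: matrix_mul_assoc)
  then have e': "h ** (mat 1 - g ** s ** h) ** g = mat 1 - s" by (simp add: e hg)
  have le: "rank (a ** M ** b) \<le> rank M" for a M b :: "complex^'n^'n"
    using rank_mult_le(1)[of "a ** M" b] rank_mult_le(2)[of a M] by linarith
  have "rank (mat 1 - g ** s ** h) \<le> rank (mat 1 - s)" using le[of g "mat 1 - s" h] by (simp only: e)
  moreover have "rank (mat 1 - s) \<le> rank (mat 1 - g ** s ** h)"
    using le[of h "mat 1 - g ** s ** h" g] by (simp only: e')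
  ultimately have "rank (mat 1 - g ** s ** h) = rank (mat 1 - s)" by (rule antisym)
  then show ?thesis using assms mult_group by (simp add: sympl_refls_def)
qed

text \<open>Both \<open>omega_s\<close> and \<open>x - s x\<close> factor through the projection to
  im(1 - s), which is spanned by two vectors. The left side is trilinear and alternating, and three
  vectors of a plane admit no nonzero such expression; in the coordinates \<open>p\<close> and
  \<open>q\<close> this is a polynomial identity.\<close>

lemma omega_s_jacobi:
  assumes "s \<in> sympl_refls G"
  shows "omega_s Om s y z *s (x - s *v x) + omega_s Om s z x *s (y - s *v y) + omega_s Om s x y *s (z - s *v z) = 0"
proof -
  have s: "s \<in> G" and r: "rank (mat 1 - s) = 2" using assms by (auto simp: sympl_refls_def)
  obtain a b where ab: "\<And>x. \<exists>p q. (mat 1 - s) *v x = p *s a + q *s b" using rank_two_range[OF r] by blast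
  have "\<exists>p q. moved s x = p *s a + q *s b" for x
    using moved_range[OF s, of x] ab by auto
  then obtain p q where pq: "\<And>x. moved s x = p x *s a + q x *s b" by metis
  have self: "sform Om v v = 0" for v using skew[of v v] by simp
  have w: "omega_s Om s x y = (p x * q y - q x * p y) * sform Om a b" for x y
    unfolding omega_s_eq[OF s] pq
    by (simp add: sform_add_left sform_add_right sform_scale_left sform_scale_right self skew[of b a] algebra_simps)
  have d: "x - s *v x = p x *s (a - s *v a) + q x *s (b - s *v b)" for x
  proof -
    have "x - s *v x = moved s x - s *v moved s x"
      using moved_rest[OF s, of x] by (simp add: matrix_vector_mult_diff_distrib algebra_simps)
    then show ?thesis
      by (simp add: pq matrix_vector_right_distrib vector_scalar_commute vec.scale_right_diff_distrib)
  qed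
  show ?thesis unfolding w d[of x] d[of y] d[of z] by (simp add: vec_eq_iff algebra_simps)
qed

end

section \<open>Dimensions in the spherical subalgebra\<close>

context deformed_commutation
begin

abbreviation "subsp \<equiv> qsubspace relator_ideal spherical_part"
abbreviation "findim \<equiv> qfindim relator_ideal"
abbreviation "dimq \<equiv> qdim relator_ideal"
abbreviation "prodq \<equiv> qprod relator_ideal"
abbreviation "frames \<equiv> subframes relator_ideal spherical_part idem"

definition leads :: "'n sk set \<Rightarrow> expo set" where
  "leads Y = {lead (nform y) | y. y \<in> Y \<and> nform y \<noteq> 0}"

lemma subsp_subspace: "subsp Y \<Longrightarrow> cvec.subspace Y"
  unfolding qsubspace_def cspan_eq_span by (metis cvec.subspace_span)

lemma subsp_skel: "subsp Y \<Longrightarrow> y \<in> Y \<Longrightarrow> skel G y"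
  unfolding qsubspace_def using spherical_skel by blast

lemma subsp_finite_supp: "subsp Y \<Longrightarrow> y \<in> Y \<Longrightarrow> finite_supp y"
  using subsp_skel skel_finite_supp by blast

lemma subspI:
  assumes "S \<subseteq> spherical_part"
  shows "subsp (cspan (S \<union> relator_ideal))"
  unfolding qsubspace_def cspan_eq_span
  using assms ideal_subset_spherical cvec.span_superset[of "S \<union> relator_ideal"]
    cvec.span_minimal[OF _ subspace_spherical_part, of "S \<union> relator_ideal"]
  by (simp add: cvec.span_span)

lemma subspace_nform_supported: "cvec.subspace {x. finite_supp x \<and> nform x \<in> supported E}"
  unfolding cvec.subspace_def
  by (auto simp: nform_add nform_csc finite_supp_add finite_supp_csc supported_add supported_const_mult
    simp del: plus_fun_apply csc_apply)

lemma span_nform_supported: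
  assumes "y \<in> cspan (S \<union> relator_ideal)" "\<And>x. x \<in> S \<Longrightarrow> finite_supp x \<and> nform x \<in> supported E"
  shows "nform y \<in> supported E"
proof -
  have "S \<union> relator_ideal \<subseteq> {x. finite_supp x \<and> nform x \<in> supported E}"
    using assms(2) nform_relator_ideal relator_ideal_skel skel_finite_supp by force
  then show ?thesis
    using assms(1) cvec.span_minimal[OF _ subspace_nform_supported] unfolding cspan_eq_span by blast
qed

lemma finite_leads:
  assumes "subsp Y" "findim Y"
  shows "finite (leads Y)"
proof -
  obtain F where F: "finite F" "F \<subseteq> Y" "Y \<subseteq> cspan (F \<union> relator_ideal)"
    using assms(2) unfolding qfindim_def by blast
  let ?E = "\<Union>f\<in>F. support (nform f)"
  have "nform y \<in> supported ?E" if "y \<in> Y" for y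
    by (rule span_nform_supported[of _ F]) (use F that subsp_finite_supp[OF assms(1)] in \<open>auto simp: supported_def\<close>)
  then have "leads Y \<subseteq> ?E" using lead_in_support by (fastforce simp: leads_def supported_def)
  then show ?thesis using F(1) finite_subset by fastforce
qed

lemma nform_combination:
  assumes "\<And>f. f \<in> F \<Longrightarrow> finite_supp f"
  shows "nform (\<Sum>f\<in>F. csc (c f) f) = (\<Sum>f\<in>F. const (c f) * nform f)"
proof -
  have "nform (\<Sum>f\<in>F. csc (c f) f) = (\<Sum>f\<in>F. nform (csc (c f) f))"
    by (rule nform_sum) (use assms finite_supp_csc in blast)
  also have "\<dots> = (\<Sum>f\<in>F. const (c f) * nform f)"
    by (rule sum.cong) (simp_all add: nform_csc assms del: csc_apply)
  finally show ?thesis .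
qed

text \<open>With more elements than leading exponents, a nontrivial combination has zero
  coefficients at all of them. A nonzero normal form would have its own leading exponent there, so
  the combination lies in the ideal.\<close>

lemma indep_card_le:
  assumes Y: "subsp Y" "findim Y" and F: "finite F" "F \<subseteq> Y" "indep_mod relator_ideal F"
  shows "card F \<le> card (leads Y)"
proof (rule ccontr)
  assume "\<not> card F \<le> card (leads Y)"
  then obtain c where c: "\<exists>f\<in>F. c f \<noteq> 0" "\<forall>q\<in>leads Y. (\<Sum>f\<in>F. c f * coeff_of (nform f) q) = 0"
    using underdetermined_system[OF finite_leads[OF Y] F(1), of "\<lambda>f q. coeff_of (nform f) q"] by auto
  let ?x = "\<Sum>f\<in>F. csc (c f) f"
  have x: "?x \<in> Y"
    by (intro cvec.subspace_sum[OF subsp_subspace[OF Y(1)]] cvec.subspace_scale[OF subsp_subspace[OF Y(1)]])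
      (use F in blast)
  have n: "nform ?x = (\<Sum>f\<in>F. const (c f) * nform f)"
    by (rule nform_combination) (use F Y subsp_finite_supp in blast)
  have "nform ?x = 0"
  proof (rule ccontr)
    assume nz: "nform ?x \<noteq> 0"
    then have "lead (nform ?x) \<in> leads Y" using x unfolding leads_def by blast
    then have "coeff_of (nform ?x) (lead (nform ?x)) = 0"
      using c(2) unfolding n by (simp add: lookup_sum)
    then show False using lead_in_support[OF nz] by (simp add: in_keys_iff)
  qed
  then have "?x \<in> relator_ideal" using spherical_nform_zero x Y(1) unfolding qsubspace_def by blast
  then show False using c(1) F(3) unfolding indep_mod_def linear_combination_eq by blast
qed

text \<open>Choosing one element for each leading exponent gives an independent set of maximal size.
  The supremum in \<open>qdim\<close> is attained, so no supremum of an unbounded set of naturals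
  arises.\<close>

lemma dimq_eq:
  assumes Y: "subsp Y" "findim Y"
  shows "dimq Y = card (leads Y)"
  unfolding qdim_def
proof (rule cSup_eq_maximum)
  have "\<forall>q\<in>leads Y. \<exists>y. y \<in> Y \<and> nform y \<noteq> 0 \<and> lead (nform y) = q" by (auto simp: leads_def)
  then obtain y where y: "\<And>q. q \<in> leads Y \<Longrightarrow> y q \<in> Y \<and> nform (y q) \<noteq> 0 \<and> lead (nform (y q)) = q"
    by metis
  have inj: "inj_on y (leads Y)" by (metis inj_onI y)
  have "indep_mod relator_ideal (y ` leads Y)"
    unfolding indep_mod_def linear_combination_eq
  proof (intro allI impI ballI)
    fix c f assume i: "(\<Sum>f\<in>y ` leads Y. csc (c f) f) \<in> relator_ideal" and f: "f \<in> y ` leads Y"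
    let ?F = "{f \<in> y ` leads Y. c f \<noteq> 0}"
    have fin: "finite (y ` leads Y)" using finite_leads[OF Y] by simp
    have "nform (\<Sum>f\<in>y ` leads Y. csc (c f) f) = (\<Sum>f\<in>y ` leads Y. const (c f) * nform f)"
      by (rule nform_combination) (use y Y subsp_finite_supp in blast)
    then have "0 = (\<Sum>f\<in>y ` leads Y. const (c f) * nform f)"
      using nform_relator_ideal[OF i] by simp
    also have "\<dots> = (\<Sum>f\<in>?F. const (c f) * nform f)"
      by (rule sum.mono_neutral_right[OF fin]) auto
    finally have z: "(\<Sum>f\<in>?F. const (c f) * nform f) = 0" by simp
    have chosen: "f = y (lead (nform f))" "nform f \<noteq> 0" if fy: "f \<in> y ` leads Y" for f
    proof -
      obtain q where q: "q \<in> leads Y" "f = y q" using fy by blast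
      show "f = y (lead (nform f))" "nform f \<noteq> 0" using y[OF q(1)] q(2) by simp_all
    qed
    have nz: "const (c f) * nform f \<noteq> 0" and l: "lead (const (c f) * nform f) = lead (nform f)" if "f \<in> ?F" for f
    proof -
      have "const (c f) \<noteq> const 0" unfolding const_inject using that by simp
      then show "const (c f) * nform f \<noteq> 0" using chosen(2)[of f] that by simp
      show "lead (const (c f) * nform f) = lead (nform f)" by (rule lead_const_mult) (use that in simp)
    qed
    have "inj_on (\<lambda>f. lead (const (c f) * nform f)) ?F"
    proof (rule inj_onI)
      fix f f' assume ff: "f \<in> ?F" "f' \<in> ?F" "lead (const (c f) * nform f) = lead (const (c f') * nform f')"
      then have "lead (nform f) = lead (nform f')" by (simp only: l[OF ff(1)] l[OF ff(2)])
      moreover have "f = y (lead (nform f))" "f' = y (lead (nform f'))"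
        using ff(1,2) chosen by blast+
      ultimately show "f = f'" by simp
    qed
    moreover have "finite ?F" using fin by simp
    ultimately have "?F = {}"
      using sum_distinct_leads_nonzero[of ?F "\<lambda>f. const (c f) * nform f", OF _ _ nz] z by blast
    then show "c f = 0" using f by blast
  qed
  then show "card (leads Y) \<in> {card F | F. finite F \<and> F \<subseteq> Y \<and> indep_mod relator_ideal F}"
    using card_image[OF inj] y finite_leads[OF Y] by (intro CollectI exI[of _ "y ` leads Y"]) auto
qed (use indep_card_le[OF Y] in auto)

lemma prodq_subsp:
  assumes "subsp W" "subsp X"
  shows "subsp (prodq W X)"
  unfolding qprod_def by (rule subspI) (use assms spherical_mult in \<open>unfold qsubspace_def, blast\<close>)

lemma prodq_mem: "w \<in> W \<Longrightarrow> x \<in> X \<Longrightarrow> sk_mult w x \<in> prodq W X"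
  unfolding qprod_def cspan_eq_span by (rule cvec.span_base) blast

lemma prodq_findim:
  assumes "subsp W" "findim W" "subsp X" "findim X"
  shows "findim (prodq W X)"
proof -
  obtain F where F: "finite F" "F \<subseteq> W" "W \<subseteq> cvec.span (F \<union> relator_ideal)"
    using assms(2) unfolding qfindim_def cspan_eq_span by blast
  obtain F' where F': "finite F'" "F' \<subseteq> X" "X \<subseteq> cvec.span (F' \<union> relator_ideal)"
    using assms(4) unfolding qfindim_def cspan_eq_span by blast
  define P where "P = (\<lambda>(f, g). sk_mult f g) ` (F \<times> F')"
  let ?S = "cvec.span (P \<union> relator_ideal)"
  have I: "relator_ideal \<subseteq> ?S" using cvec.span_superset by blast
  have 1: "sk_mult f x \<in> ?S" if "f \<in> F" "x \<in> X" for f x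
  proof (rule mult_left_span[OF _ _ _ cvec.subspace_span])
    show "x \<in> cvec.span (F' \<union> relator_ideal)" using F' that by blast
    show "finite_supp f" using F that subsp_finite_supp assms by blast
    fix y assume y: "y \<in> F' \<union> relator_ideal"
    then show "finite_supp y" using F' subsp_finite_supp assms relator_ideal_skel skel_finite_supp by blast
    show "sk_mult f y \<in> ?S"
    proof (cases "y \<in> F'")
      case True
      then have "sk_mult f y \<in> P" using that by (auto simp: P_def)
      then show ?thesis by (intro cvec.span_base) blast
    next
      case False
      then show ?thesis using y relator_ideal_left I F that assms subsp_skel by blast
    qed
  qed
  have 2: "sk_mult w x \<in> ?S" if "w \<in> W" "x \<in> X" for w x
  proof (rule mult_right_span[OF _ _ _ cvec.subspace_span])
    show "w \<in> cvec.span (F \<union> relator_ideal)" using F that by blast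
    show "finite_supp x" using that subsp_finite_supp assms by blast
    fix y assume y: "y \<in> F \<union> relator_ideal"
    then show "finite_supp y" using F subsp_finite_supp assms relator_ideal_skel skel_finite_supp by blast
    show "sk_mult y x \<in> ?S"
      using y 1 that relator_ideal_right I assms subsp_skel by blast
  qed
  have "prodq W X \<subseteq> ?S"
    unfolding qprod_def cspan_eq_span
    by (rule cvec.span_minimal[OF _ cvec.subspace_span]) (use 2 I in blast)
  moreover have "P \<subseteq> prodq W X"
    unfolding P_def using F(2) F'(2) by (auto intro!: prodq_mem)
  moreover have "finite P" using F F' by (simp add: P_def)
  ultimately show ?thesis unfolding qfindim_def cspan_eq_span by blast
qed

lemma findim_span: "finite F \<Longrightarrow> findim (cspan (F \<union> relator_ideal))"
  unfolding qfindim_def cspan_eq_span using cvec.span_superset[of "F \<union> relator_ideal"] by blast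

lemma qpow_subsp:
  assumes "W \<in> frames"
  shows "subsp (qpow relator_ideal idem W m)" "findim (qpow relator_ideal idem W m)" "idem \<in> qpow relator_ideal idem W m"
proof (induction m)
  case 0
  show "subsp (qpow relator_ideal idem W 0)" using subspI[of "{idem}"] idem_spherical by simp
  show "findim (qpow relator_ideal idem W 0)" using findim_span[of "{idem}"] by simp
  show "idem \<in> qpow relator_ideal idem W 0" unfolding cspan_eq_span qpow.simps by (intro cvec.span_base) simp
next
  case (Suc m)
  have W: "subsp W" "findim W" "idem \<in> W" using assms by (auto simp: subframes_def)
  show "subsp (qpow relator_ideal idem W (Suc m))" "findim (qpow relator_ideal idem W (Suc m))"
    using prodq_subsp prodq_findim W Suc by simp_all
  show "idem \<in> qpow relator_ideal idem W (Suc m)"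
    using prodq_mem[OF W(3) Suc(3)] by (simp add: idem_idem)
qed

section \<open>Growth of frames and the isoperimetric inequality\<close>

definition exponents :: "expo \<Rightarrow> 'n \<Rightarrow> nat" where
  "exponents m j = Poly_Mapping.lookup m (Suc (idx j))"

lemma exponents_word_expo: "exponents (word_expo w) = count (mset w)"
  by (simp add: exponents_def fun_eq_iff lookup_word_expo_Suc)

text \<open>On words the degree coordinate is the sum of the others and may be dropped. Leading
  exponents thus become points of a grid with independent coordinates, as the projection inequality
  requires.\<close>

lemma inj_exponents: "inj_on exponents (range word_expo)"
  by (rule inj_onI) (auto simp: exponents_word_expo word_expo_eq_iff count_inject)

lemma exponents_shift: "exponents (word_expo (replicate k i) + m) = (exponents m)(i := exponents m i + k)"
proof
  fix j
  have "Poly_Mapping.lookup (word_expo (replicate k i)) (Suc (idx j)) = (if j = i then k else 0)"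
    by (simp add: lookup_word_expo_Suc)
  then show "exponents (word_expo (replicate k i) + m) j = ((exponents m)(i := exponents m i + k)) j"
    by (simp add: exponents_def lookup_add)
qed

lemma leads_word_expo:
  assumes "subsp Y"
  shows "leads Y \<subseteq> range word_expo"
  using support_nform[OF subsp_finite_supp[OF assms]] lead_in_support by (fastforce simp: leads_def)

lemma finite_expos: "finite (expos n)"
proof -
  have "expos n \<subseteq> word_expo ` {w. set w \<subseteq> UNIV \<and> length w \<le> n}" by (auto simp: expos_def)
  then show ?thesis by (rule finite_subset) (intro finite_imageI finite_lists_length_le finite)
qed

lemma card_expos_le: "card (expos (Suc n)) \<le> (n + 1) ^ CARD('n)"
proof -
  have "exponents m j \<le> n" if m: "m \<in> expos (Suc n)" for m j
  proof -
    obtain w where w: "m = word_expo w" "length w \<le> n" using m by (auto simp: expos_def)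
    then show ?thesis using count_le_size[of "mset w" j] by (simp add: exponents_word_expo)
  qed
  then have "exponents ` expos (Suc n) \<subseteq> PiE UNIV (\<lambda>_. {..n})" by (auto simp: PiE_iff)
  then have "card (exponents ` expos (Suc n)) \<le> card (PiE (UNIV :: 'n set) (\<lambda>_. {..n}))"
    by (intro card_mono finite_PiE) auto
  moreover have "card (exponents ` expos (Suc n)) = card (expos (Suc n))"
    by (rule card_image[OF inj_on_subset[OF inj_exponents]]) (auto simp: expos_def)
  ultimately show ?thesis by (simp add: card_PiE)
qed

text \<open>Take \<open>k\<close> to be the greatest word length in finitely many generators of
  \<open>W\<close>. The ideal part of \<open>W\<close> may contain longer words but contributes
  nothing to normal forms, so \<open>W^m\<close> has degree at most \<open>k m\<close>, and the
  exponents of that degree lie in a cube.\<close>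

lemma frame_growth_upper:
  assumes "W \<in> frames"
  obtains k where "\<And>m. real (dimq (qpow relator_ideal idem W m)) \<le> (real k * real m + 1) ^ CARD('n)"
proof -
  have W: "subsp W" "findim W" "idem \<in> W" using assms by (auto simp: subframes_def)
  obtain F where F: "finite F" "F \<subseteq> W" "W \<subseteq> cvec.span (F \<union> relator_ideal)"
    using W(2) unfolding qfindim_def cspan_eq_span by blast
  have "finite ((\<lambda>p. length (fst p)) ` (\<Union>f\<in>F. {p. f p \<noteq> 0}))"
    using F subsp_finite_supp[OF W(1)] by blast
  then obtain k where "\<forall>n\<in>(\<lambda>p. length (fst p)) ` (\<Union>f\<in>F. {p. f p \<noteq> 0}). n \<le> k"
    unfolding finite_nat_set_iff_bounded_le by blast
  then have k: "\<And>f p. f \<in> F \<Longrightarrow> f p \<noteq> 0 \<Longrightarrow> length (fst p) \<le> k" by blast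
  have mult: "nform (sk_mult w b) \<in> supported (expos (k + n))"
    if "w \<in> W" "b \<in> spherical_part" "nform b \<in> supported (expos n)" for w b n
  proof -
    have fb: "skel G b" "finite_supp b" using that spherical_skel skel_finite_supp by blast+
    have "sk_mult w b \<in> {x. finite_supp x \<and> nform x \<in> supported (expos (k + n))}"
    proof (rule mult_right_span[OF _ fb(2) _ subspace_nform_supported])
      show "w \<in> cvec.span (F \<union> relator_ideal)" using F that by blast
      fix y assume y: "y \<in> F \<union> relator_ideal"
      show fy: "finite_supp y" using y F subsp_finite_supp[OF W(1)] relator_ideal_skel skel_finite_supp by blast
      have "nform (sk_mult y b) \<in> supported (expos (k + n))"
      proof (cases "y \<in> F")
        case True
        then have "skel G y" using F subsp_skel[OF W(1)] by blast
        then show ?thesis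
          by (rule nform_mult_supported[OF _ fb(2) _ that(3)]) (use k[OF True] in force)
      next
        case False
        then show ?thesis using y relator_ideal_right[OF _ fb(1)] nform_relator_ideal by auto
      qed
      then show "sk_mult y b \<in> {x. finite_supp x \<and> nform x \<in> supported (expos (k + n))}"
        using finite_supp_mult[OF fy fb(2)] by simp
    qed
    then show ?thesis by simp
  qed
  \<comment> \<open>The successor appears because \<open>expos\<close> bounds degrees
    strictly.\<close>
  have deg: "nform y \<in> supported (expos (Suc (k * m)))" if "y \<in> qpow relator_ideal idem W m" for y m
    using that
  proof (induction m arbitrary: y)
    case 0
    have "nform idem \<in> supported (expos (Suc 0))"
      by (rule nform_supported_expos) (auto simp: sym_idem_def sk_basis_def split: if_splits elim!: sum.not_neutral_contains_not_neutral)
    then show ?case using span_nform_supported[of y "{idem}" "expos (Suc 0)"] 0 finite_supp_idem by simp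
  next
    case (Suc m)
    show ?case
    proof (rule span_nform_supported)
      show "y \<in> cspan ({sk_mult w z | w z. w \<in> W \<and> z \<in> qpow relator_ideal idem W m} \<union> relator_ideal)"
        using Suc.prems by (simp add: qprod_def)
      fix x assume "x \<in> {sk_mult w z | w z. w \<in> W \<and> z \<in> qpow relator_ideal idem W m}"
      then obtain w z where x: "x = sk_mult w z" "w \<in> W" "z \<in> qpow relator_ideal idem W m" by blast
      have z: "z \<in> spherical_part" using qpow_subsp(1)[OF assms, of m] x by (auto simp: qsubspace_def)
      have "nform x \<in> supported (expos (k + Suc (k * m)))"
        unfolding x(1) by (rule mult[OF x(2) z Suc.IH[OF x(3)]])
      moreover have "finite_supp x"
        unfolding x(1) using subsp_finite_supp[OF W(1) x(2)] spherical_skel[OF z] skel_finite_supp finite_supp_mult by blast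
      ultimately show "finite_supp x \<and> nform x \<in> supported (expos (Suc (k * Suc m)))" by simp
    qed
  qed
  have "real (dimq (qpow relator_ideal idem W m)) \<le> (real k * real m + 1) ^ CARD('n)" for m
  proof -
    have "leads (qpow relator_ideal idem W m) \<subseteq> expos (Suc (k * m))"
      using deg[of _ m] lead_in_support by (fastforce simp: leads_def supported_def)
    then have "card (leads (qpow relator_ideal idem W m)) \<le> (k * m + 1) ^ CARD('n)"
      using card_mono[OF finite_expos] card_expos_le le_trans by blast
    then have "real (card (leads (qpow relator_ideal idem W m))) \<le> real ((k * m + 1) ^ CARD('n))"
      by (rule of_nat_mono)
    then show ?thesis using dimq_eq qpow_subsp[OF assms, of m] by (simp add: add.commute)
  qed
  then show ?thesis using that by blast
qed

lemma nform_idem: "nform idem = 1"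
  by (simp add: nform_def pairing_idem NF_sorted del: sum_constant)

lemma frame_dim_positive:
  assumes "W \<in> frames"
  shows "dimq (qpow relator_ideal idem W m) \<ge> 1"
proof -
  note q = qpow_subsp[OF assms, of m]
  have "leads (qpow relator_ideal idem W m) \<noteq> {}"
    using q(3) nform_idem by (force simp: leads_def)
  then show ?thesis
    using finite_leads[OF q(1,2)] dimq_eq[OF q(1,2)] by (simp add: Suc_le_eq card_gt_0_iff)
qed

definition orbit_frame :: "'n sk set" where
  "orbit_frame = cspan (insert idem ((\<lambda>(i, k). orbit_element (ax i) k) ` (UNIV \<times> {..card G})) \<union> relator_ideal)"

lemma orbit_frame_frames: "orbit_frame \<in> frames"
proof -
  have "idem \<in> orbit_frame" unfolding orbit_frame_def cspan_eq_span by (intro cvec.span_base) simp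
  moreover have "subsp orbit_frame"
    unfolding orbit_frame_def by (rule subspI) (auto simp: idem_spherical orbit_element_spherical)
  moreover have "findim orbit_frame"
    unfolding orbit_frame_def by (rule findim_span) simp
  ultimately show ?thesis by (simp add: subframes_def)
qed

lemma orbit_element_frame: "k \<le> card G \<Longrightarrow> orbit_element (ax i) k \<in> orbit_frame"
  unfolding orbit_frame_def cspan_eq_span by (intro cvec.span_base) auto

text \<open>In each direction \<open>i\<close> the number of leading exponents grows at least by the
  size of the projection along \<open>i\<close>. Averaging over the \<open>CARD('n)\<close>
  directions, with \<open>card_le_sum_projections\<close>, yields the constant.\<close>

lemma orbit_frame_isoperimetric:
  assumes X: "subsp X" "findim X" "dimq X \<noteq> 0"
  shows "real (dimq (prodq orbit_frame X))
    \<ge> real (dimq X) + 1 / real CARD('n) * real (dimq X) powr ((real CARD('n) - 1) / real CARD('n))"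
proof -
  let ?W = orbit_frame
  have W: "subsp ?W" "findim ?W" using orbit_frame_frames by (auto simp: subframes_def)
  note WX = prodq_subsp[OF W(1) X(1)] prodq_findim[OF W X(1,2)]
  let ?S = "exponents ` leads X"
  have finX: "finite (leads X)" by (rule finite_leads[OF X(1,2)])
  have cS: "card ?S = dimq X"
    unfolding dimq_eq[OF X(1,2)] by (rule card_image[OF inj_on_subset[OF inj_exponents leads_word_expo[OF X(1)]]])
  have one: "card ?S + card ((\<lambda>f. f(i := 0)) ` ?S) \<le> dimq (prodq ?W X)" for i
  proof -
    obtain k l where kl: "k < l" "l \<le> card G" "orbit_sym (ax i) k \<noteq> 0" "orbit_sym (ax i) l \<noteq> 0"
      "lead (orbit_sym (ax i) l) = lead (orbit_sym (ax i) k) + word_expo (replicate (l - k) i)"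
      using orbit_sym_leads .
    have mem: "lead (orbit_sym (ax i) j) + q \<in> leads (prodq ?W X)"
      if j: "j \<le> card G" "orbit_sym (ax i) j \<noteq> 0" "q \<in> leads X" for j q
    proof -
      obtain x where x: "x \<in> X" "nform x \<noteq> 0" "q = lead (nform x)" using j(3) by (auto simp: leads_def)
      have "x \<in> spherical_part" using x X(1) by (auto simp: qsubspace_def)
      note l = lead_orbit_element_mult[OF this x(2) j(2)]
      show ?thesis
        unfolding leads_def x(3) using l prodq_mem[OF orbit_element_frame[OF j(1), of i] x(1)]
        by (intro CollectI exI[of _ "sk_mult (orbit_element (ax i) j) x"]) simp
    qed
    \<comment> \<open>The exponent \<open>?p\<close> is unknown but common to both translates, so it
      cancels and leaves a shift by \<open>l - k\<close> in direction \<open>i\<close>.\<close>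
    let ?p = "lead (orbit_sym (ax i) k)" and ?m = "word_expo (replicate (l - k) i)"
    let ?T = "leads X \<union> (\<lambda>q. ?m + q) ` leads X"
    have "(\<lambda>q. ?p + q) ` ?T \<subseteq> leads (prodq ?W X)"
      using mem[of k] mem[of l] kl by (auto simp: add.assoc)
    then have "card ((\<lambda>q. ?p + q) ` ?T) \<le> card (leads (prodq ?W X))"
      by (rule card_mono[OF finite_leads[OF WX]])
    moreover have "card ((\<lambda>q. ?p + q) ` ?T) = card ?T"
      by (rule card_image) (simp add: inj_on_def)
    moreover have "card ?T = card (exponents ` ?T)"
    proof (rule card_image[symmetric, OF inj_on_subset[OF inj_exponents]])
      show "?T \<subseteq> range word_expo" using leads_word_expo[OF X(1)] by (auto simp: word_expo_append[symmetric])
    qed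
    moreover have "exponents ` ?T = ?S \<union> (\<lambda>f. f(i := f i + (l - k))) ` ?S"
      by (simp add: image_Un image_image exponents_shift)
    moreover have "card ?S + card ((\<lambda>f. f(i := 0)) ` ?S) \<le> card (?S \<union> (\<lambda>f. f(i := f i + (l - k))) ` ?S)"
      by (rule card_shift_union) (use finX kl in auto)
    ultimately show ?thesis using dimq_eq[OF WX] by simp
  qed
  let ?d = "real CARD('n)"
  have "real (card ?S) powr ((?d - 1) / ?d) \<le> (\<Sum>i\<in>UNIV. real (card ((\<lambda>f. f(i := 0)) ` ?S)))"
    using card_le_sum_projections[of "UNIV :: 'n set" ?S] finX by simp
  also have "\<dots> \<le> (\<Sum>i\<in>(UNIV :: 'n set). real (dimq (prodq ?W X)) - real (dimq X))"
  proof (rule sum_mono)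
    fix i
    show "real (card ((\<lambda>f. f(i := 0)) ` ?S)) \<le> real (dimq (prodq ?W X)) - real (dimq X)"
      using one[of i] unfolding cS by linarith
  qed
  also have "\<dots> = ?d * (real (dimq (prodq ?W X)) - real (dimq X))" by simp
  finally show ?thesis by (simp add: cS field_simps)
qed

definition isoperimetric :: "'n sk set \<Rightarrow> real \<Rightarrow> bool" where
  "isoperimetric W d \<longleftrightarrow> (\<exists>c'>0. \<forall>X. subsp X \<and> findim X \<and> dimq X \<noteq> 0 \<longrightarrow>
      real (dimq (prodq W X)) \<ge> real (dimq X) + c' * real (dimq X) powr ((d - 1) / d))"

text \<open>With \<open>X = W^m\<close> the inequality becomes the recursion of
  \<open>growth_lower_bound\<close> for the dimensions of the powers.\<close>

lemma isoperimetric_growth: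
  assumes W: "W \<in> frames" and iso: "isoperimetric W D" and D: "D \<ge> 1"
  obtains \<epsilon> where "\<epsilon> > 0" "\<And>m. real (dimq (qpow relator_ideal idem W m)) \<ge> (\<epsilon> * real m) powr D"
proof -
  obtain c where c: "c > 0" "\<And>X. subsp X \<Longrightarrow> findim X \<Longrightarrow> dimq X \<noteq> 0 \<Longrightarrow>
      real (dimq (prodq W X)) \<ge> real (dimq X) + c * real (dimq X) powr ((D - 1) / D)"
    using iso unfolding isoperimetric_def by blast
  show ?thesis
  proof (rule growth_lower_bound[OF D c(1), of "\<lambda>m. real (dimq (qpow relator_ideal idem W m))"])
    show "real (dimq (qpow relator_ideal idem W 0)) \<ge> 1"
      using frame_dim_positive[OF W, of 0] by linarith
    show "real (dimq (qpow relator_ideal idem W m)) + c * real (dimq (qpow relator_ideal idem W m)) powr ((D - 1) / D)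
        \<le> real (dimq (qpow relator_ideal idem W (Suc m)))" for m
      using c(2)[OF qpow_subsp(1,2)[OF W, of m]] frame_dim_positive[OF W, of m] by simp
  qed (rule that)
qed

lemma orbit_frame_iso: "isoperimetric orbit_frame (real CARD('n))"
  unfolding isoperimetric_def
  by (intro exI[of _ "1 / real CARD('n)"]) (use orbit_frame_isoperimetric in auto)

theorem GKdim_spherical: "GKdim relator_ideal spherical_part idem = ereal (real CARD('n))"
  unfolding GKdim_def
proof (rule antisym)
  show "(SUP W\<in>frames. limsup (\<lambda>m. ereal (ln (real (dimq (qpow relator_ideal idem W m))) / ln (real m))))
      \<le> ereal (real CARD('n))"
  proof (rule SUP_least)
    fix W assume W: "W \<in> frames"
    obtain k where k: "\<And>m. real (dimq (qpow relator_ideal idem W m)) \<le> (real k * real m + 1) ^ CARD('n)"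
      using frame_growth_upper[OF W] by blast
    show "limsup (\<lambda>m. ereal (ln (real (dimq (qpow relator_ideal idem W m))) / ln (real m))) \<le> ereal (real CARD('n))"
      by (rule limsup_growth_le[OF _ k]) (use frame_dim_positive[OF W] in \<open>simp add: Suc_le_eq\<close>)
  qed
  obtain \<epsilon> where e: "\<epsilon> > 0" "\<And>m. real (dimq (qpow relator_ideal idem orbit_frame m)) \<ge> (\<epsilon> * real m) powr real CARD('n)"
    using isoperimetric_growth[OF orbit_frame_frames orbit_frame_iso] by (auto simp: Suc_le_eq)
  show "ereal (real CARD('n)) \<le>
      (SUP W\<in>frames. limsup (\<lambda>m. ereal (ln (real (dimq (qpow relator_ideal idem W m))) / ln (real m))))"
    by (rule SUP_upper2[OF orbit_frame_frames]) (rule limsup_growth_ge[OF e])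
qed

theorem LDdim_spherical: "LDdim relator_ideal spherical_part idem = ereal (real CARD('n))"
proof -
  \<comment> \<open>The orbit frame strictly enlarges every nonzero \<open>X\<close>, which excludes
    the first branch in the definition of \<open>LDdim\<close>.\<close>
  have "dimq (prodq orbit_frame X) \<noteq> dimq X" if X: "subsp X" "findim X" "dimq X \<noteq> 0" for X
  proof -
    have "1 / real CARD('n) * real (dimq X) powr ((real CARD('n) - 1) / real CARD('n)) > 0" using X by simp
    then show ?thesis using orbit_frame_isoperimetric[OF X] by linarith
  qed
  then have n: "\<not> (\<forall>W\<in>frames. \<exists>X. subsp X \<and> findim X \<and> dimq X \<noteq> 0 \<and> dimq (prodq W X) = dimq X)"
    using orbit_frame_frames by blast
  have LD: "LDdim relator_ideal spherical_part idem
      = (SUP W\<in>frames. Sup {ereal d | d. d > 0 \<and> isoperimetric W d})"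
    unfolding LDdim_def isoperimetric_def by (rule if_not_P[OF n])
  show ?thesis
    unfolding LD
  proof (rule antisym)
    show "(SUP W\<in>frames. Sup {ereal d | d. d > 0 \<and> isoperimetric W d}) \<le> ereal (real CARD('n))"
    proof (intro SUP_least Sup_least)
      fix W x assume W: "W \<in> frames" and "x \<in> {ereal d | d. d > 0 \<and> isoperimetric W d}"
      then obtain D where D: "x = ereal D" "isoperimetric W D" by blast
      \<comment> \<open>The growth lemma needs \<open>D \<ge> 1\<close>; smaller exponents are below
        the dimension anyway.\<close>
      have "D \<le> real CARD('n)"
      proof (cases "D \<ge> 1")
        case True
        obtain \<epsilon> where e: "\<epsilon> > 0" "\<And>m. real (dimq (qpow relator_ideal idem W m)) \<ge> (\<epsilon> * real m) powr D"
          using isoperimetric_growth[OF W D(2) True] by blast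
        obtain k where k: "\<And>m. real (dimq (qpow relator_ideal idem W m)) \<le> (real k * real m + 1) ^ CARD('n)"
          using frame_growth_upper[OF W] by blast
        show ?thesis by (rule growth_exponent_le[OF e k])
      next
        case False
        moreover have "real CARD('n) \<ge> 1" by (simp add: Suc_le_eq)
        ultimately show ?thesis by linarith
      qed
      then show "x \<le> ereal (real CARD('n))" using D by simp
    qed
    have "ereal (real CARD('n)) \<le> Sup {ereal d | d. d > 0 \<and> isoperimetric orbit_frame d}"
      by (rule Sup_upper) (use orbit_frame_iso in auto)
    then show "ereal (real CARD('n)) \<le> (SUP W\<in>frames. Sup {ereal d | d. d > 0 \<and> isoperimetric W d})"
      by (rule SUP_upper2[OF orbit_frame_frames])
  qed
qed

end

section \<open>Symplectic reflection algebras\<close>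

theorem theorem8p5:
  fixes Om :: "complex^'n::finite^'n" and G :: "(complex^'n^'n) set"
    and t :: complex and c :: "complex^'n^'n \<Rightarrow> complex"
  assumes "symplectic_triple Om G"
    and "indecomposable Om G"
    and "\<forall>s\<in>sympl_refls G. \<forall>g\<in>G. c (g ** s ** matrix_inv g) = c s"
  shows "LDdim (sra_ideal Om G t c) (spherical Om G t c) (sym_idem G)
           = GKdim (sra_ideal Om G t c) (spherical Om G t c) (sym_idem G)
         \<and> LDdim (sra_ideal Om G t c) (spherical Om G t c) (sym_idem G) = ereal (real CARD('n))"
proof -
  interpret S: sympl_group Om G by unfold_locales (fact assms(1))
  \<comment> \<open>The coefficient of \<open>s\<close> in the commutator: the form
    \<open>t omega\<close> sits at the identity, \<open>c(s) omega_s\<close> at the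
    reflections.\<close>
  define K where "K s x y = (if s = mat 1 then t * sform Om x y else 0)
      + (if s \<in> sympl_refls G then c s * omega_s Om s x y else 0)" for s x y
  have refl: "s \<in> G" if "s \<in> sympl_refls G" for s using that by (simp add: sympl_refls_def)
  have minv: "g ** matrix_inv g = mat 1 \<and> matrix_inv g ** g = mat 1" if "g \<in> G" for g
    unfolding matrix_inv_def
    by (rule someI_ex) (use S.inv_group[OF that] in \<open>simp add: invertible_def\<close>)
  have inv: "\<exists>h\<in>G. g ** h = mat 1 \<and> h ** g = mat 1" if "g \<in> G" for g
    using S.inv_group[OF that] minv[OF that] by blast
  interpret D: deformed_commutation "to_nat :: 'n \<Rightarrow> nat" G K
  proof unfold_locales
    show "inj (to_nat :: 'n \<Rightarrow> nat)" by (rule inj_to_nat)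
    fix s :: "complex^'n^'n" and x x' y z :: "complex^'n" and a :: complex
    show "K s (x + x') y = K s x y + K s x' y"
      by (simp add: K_def sform_add_left S.omega_s_eq S.moved_add refl algebra_simps)
    show "K s (a *s x) y = a * K s x y"
      by (simp add: K_def sform_scale_left S.omega_s_eq S.moved_scale refl algebra_simps)
    show "K s x y = - K s y x"
      using S.skew[of x y] S.skew[of "S.moved s x" "S.moved s y"] by (simp add: K_def S.omega_s_eq refl)
    \<comment> \<open>At the identity all differences \<open>x - s x\<close> vanish, so only
      reflections matter; there \<open>c s\<close> factors out.\<close>
    show "K s y z *s (x - s *v x) + K s z x *s (y - s *v y) + K s x y *s (z - s *v z) = 0"
    proof (cases "s = mat 1")
      case False
      show ?thesis
      proof (cases "s \<in> sympl_refls G")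
        case True
        have "K s u v = c s * omega_s Om s u v" for u v using True False by (simp add: K_def)
        then have "K s y z *s (x - s *v x) + K s z x *s (y - s *v y) + K s x y *s (z - s *v z)
           = c s *s (omega_s Om s y z *s (x - s *v x) + omega_s Om s z x *s (y - s *v y) + omega_s Om s x y *s (z - s *v z))"
          by (simp add: vec_eq_iff algebra_simps)
        then show ?thesis by (simp only: S.omega_s_jacobi[OF True] vec.scale_zero_right)
      qed (use False in \<open>simp add: K_def\<close>)
    qed simp
    fix g h assume g: "g \<in> G" "s \<in> G" "h \<in> G" "g ** h = mat 1"
    have hg: "h ** g = mat 1" using g(4) matrix_left_right_inverse by blast
    \<comment> \<open>Brings \<open>g s h\<close> into the form in which the invariance of
      \<open>c\<close> is assumed.\<close>
    have "h = matrix_inv g"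
      using minv[OF g(1)] hg by (metis matrix_mul_assoc matrix_mul_lid matrix_mul_rid)
    then have c: "c (g ** s ** h) = c s" if "s \<in> sympl_refls G" using assms(3) that g(1) by blast
    have "g ** s ** h = mat 1 \<longleftrightarrow> s = mat 1"
    proof
      assume e: "g ** s ** h = mat 1"
      have "s = (h ** g) ** s ** (h ** g)" by (simp add: hg)
      also have "\<dots> = h ** (g ** s ** h) ** g" by (simp add: matrix_mul_assoc)
      finally show "s = mat 1" by (simp add: e hg)
    qed (simp add: g(4))
    then show "K (g ** s ** h) (g *v x) (g *v y) = K s x y"
      using S.refls_conj[OF g(1,3,4,2)] S.omega_s_conj[OF g(1,2,3,4)] S.invariant[OF g(1)] c
      by (simp add: K_def)
  qed (simp_all add: S.finite_group S.one_group S.mult_group inv)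
  \<comment> \<open>Splitting \<open>K\<close> into its summands separates the sum over the group
    into the term at the identity and the sum over reflections.\<close>
  have rel: "sra_rel Om G t c i j = D.relator i j" for i j
  proof
    fix p
    have "(\<Sum>s\<in>G. csc (K s (ax i) (ax j)) (sk_basis [] s)) p
        = (\<Sum>s\<in>G. if s = mat 1 then t * sform Om (ax i) (ax j) * sk_basis [] s p else 0)
        + (\<Sum>s\<in>G. if s \<in> sympl_refls G then c s * omega_s Om s (ax i) (ax j) * sk_basis [] s p else 0)"
      unfolding sum.distrib[symmetric] sum_fun_apply
      by (rule sum.cong) (auto simp: K_def distrib_right)
    also have "(\<Sum>s\<in>G. if s = mat 1 then t * sform Om (ax i) (ax j) * sk_basis [] s p else 0)
        = t * sform Om (ax i) (ax j) * sk_basis [] (mat 1) p"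
      using S.one_group S.finite_group by simp
    also have "(\<Sum>s\<in>G. if s \<in> sympl_refls G then c s * omega_s Om s (ax i) (ax j) * sk_basis [] s p else 0)
        = (\<Sum>s\<in>sympl_refls G. c s * omega_s Om s (ax i) (ax j) * sk_basis [] s p)"
      using S.finite_group refl by (intro sum.mono_neutral_cong_right) auto
    finally have e: "(\<Sum>s\<in>G. csc (K s (ax i) (ax j)) (sk_basis [] s)) p
        = t * sform Om (ax i) (ax j) * sk_basis [] (mat 1) p
        + (\<Sum>s\<in>sympl_refls G. c s * omega_s Om s (ax i) (ax j) * sk_basis [] s p)" .
    show "sra_rel Om G t c i j p = D.relator i j p"
      by (simp add: sra_rel_def D.relator_def e)
  qed
  have "sra_ideal Om G t c = D.relator_ideal"
    by (simp add: sra_ideal_def D.relator_ideal_def rel cspan_eq_span)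
  moreover then have "spherical Om G t c = D.spherical_part"
    by (simp add: spherical_def D.spherical_part_def cspan_eq_span)
  ultimately show ?thesis by (simp add: D.GKdim_spherical D.LDdim_spherical)
qed

end
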